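(* Let the standing assumptions stated in the context hold. Let $\{x_t\}_{t=0}^T$ be the sequence of iterates produced by the algorithm Z-ProxSG described in the context, with $x_{t^*}$ being the point that the algorithm returns. For any $t\ge 0$, $\mu>0$, and any $\bar\rho\in(\rho,2\rho]$, it holds that $$\mathbb{E}_{U,\xi}\left[\phi_{\mu}^{1/\bar{\rho}}(x_{t+1}) \right] \leq \mathbb{E}_{U,\xi}\left[\phi_{\mu}^{1/\bar{\rho}}(x_{t}) \right] - \frac{\alpha_t(\bar{\rho}-\rho)}{\bar{\rho}}\, \mathbb{E}_{U,\xi}\left[\left\| \nabla \phi_{\mu}^{1/\bar{\rho}}(x_t) \right\|_2^2 \right] + 2(n^2 + 2n)\bar{\rho}\,\alpha_t^2L_{f,0}^2,$$ and $x_{t^*}$ satisfies $$\mathbb{E}_{U,\xi}\left[\left\| \nabla \phi_{\mu}^{1/\bar{\rho}}(x_{t^*})\right\|_2^2 \right] \leq \frac{\bar{\rho}}{\bar{\rho}-\rho}\cdot \frac{\left(\phi_{\mu}^{1/\bar{\rho}}(x_0) - \min_{x}\phi_{\mu}(x) \right)+ 2(n^2 + 2n)\bar{\rho}L_{f,0}^2 \sum_{t=0}^{T} \alpha_t^2}{\sum_{t=0}^T \alpha_t}.$$ In particular, letting $\bar\rho=2\rho$, $\Delta \geq \phi_{\mu}^{1/\bar{\rho}}(x_0) - \min_{x} \phi_{\mu}(x)$, and setting $$\alpha_t = \frac{1}{2}\min\left\{\frac{1}{\rho}, \sqrt{\frac{\Delta}{(n^2+2n)\rho L_{f,0}^2(T+1)}}\right\}$$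 in the algorithm Z-ProxSG yields $$\mathbb{E}_{U,\xi}\left[\left\| \nabla \phi_{\mu}^{1/(2\rho)}(x_{t^*})\right\|_2^2 \right] \leq 8 \max\left\{ \frac{\Delta \rho}{T+1},\; L_{f,0}\sqrt{\frac{\Delta \rho\, n(n+2)}{T+1}}\right\}.$$
   Context: Standing assumptions. Let $(\Omega,\mathscr{F},P)$ be a complete probability space, $\xi:\Omega\to\mathbb{R}^d$ a random vector with values in $\Xi\subset\mathbb{R}^d$, and $F:\mathbb{R}^n\times\Xi\to\mathbb{R}$ a function such that: (C1) for any $x\in\mathbb{R}^n$, $F(x,\cdot)$ is Borel and $F(x,\cdot)\in\mathcal{L}_2(\Omega,\mathscr{F},P;\mathbb{R})$, i.e. $F(x,\xi)$ is square-integrable; (C2) $f(x):=\mathbb{E}_\xi[F(x,\xi)]$ is $\rho$-weakly convex for some $\rho\ge0$, i.e. $f(\lambda x_1+(1-\lambda)x_2)\le\lambda f(x_1)+(1-\lambda)f(x_2)+\frac{\lambda(1-\lambda)\rho}{2}\|x_1-x_2\|_2^2$ for all $x_1,x_2\in\mathbb{R}^n$, $\lambda\in[0,1]$; (C3) there is a positive random variable $C(\xi)$ with $\sqrt{\mathbb{E}_\xi[C(\xi)^2]}<\infty$ such that $|F(x_1,\xi)-F(x_2,\xi)|\le C(\xi)\|x_1-x_2\|_2$ for all $x_1,x_2\in\mathbb{R}^n$ and a.e. $\xi\in\Xi$. Under (C1) and (C3) there exists a constant $L_{f,0}>0$ such that $f$ is $L_{f,0}$-Lipschitz continuous on $\mathbb{R}^n$;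 this is the constant $L_{f,0}$ in the claim. Let $r:\mathbb{R}^n\to\mathbb{R}\cup\{+\infty\}$ be a proper, closed (thus lower semicontinuous), convex function that is proximable (its proximity operator can be evaluated analytically). Finally, one can generate two statistically independent random sequences $\{U_i\}_{i\ge0}$ and $\{\xi_i\}_{i\ge0}$, such that each $U_i\sim\mathcal{N}(0_n,I_n)$ and $\xi_i$ is i.i.d., respectively. Gaussian smoothing. For $\mu>0$ and $U\sim\mathcal{N}(0_n,I_n)$, $f_\mu(x):=\mathbb{E}_U[f(x+\mu U)]$ and $\phi_\mu(x):=f_\mu(x)+r(x)$; the function $f_\mu$ is $\rho$-weakly convex and Lipschitz continuously differentiable. Proximal map and Moreau envelope. For a closed function $p:\mathbb{R}^n\to\mathbb{R}\cup\{+\infty\}$ and $\lambda>0$, $\mathrm{prox}_{\lambda p}(u):=\arg\min_x\{p(x)+\frac{1}{2\lambda}\|u-x\|_2^2\}$ and $p^\lambda(u):=\min_x\{p(x)+\frac1{2\lambda}\|x-u\|_2^2\}$. If $p$ is $\rho$-weakly convex with $\rho>0$ and $\lambda\in(0,\rho^{-1})$, then $p^\lambda$ is continuously differentiable with $\nabla p^\lambda(u)=\lambda^{-1}(u-\mathrm{prox}_{\lambda p}(u))$. In particular, $\phi_\mu^{1/\bar\rho}$ denotes the Moreau envelope of $\phi_\mu$ with $\lambda=1/\bar\rho$. Algorithm Z-ProxSG. Input: $x_0\in\mathrm{dom}(r)$, a sequence $\{\alpha_t\}_{t\ge0}\subset\mathbb{R}_+$, $\mu>0$, and $T>0$. For $t=0,1,\dots,T$: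 sample $\xi_t$ and $U_t\sim\mathcal{N}(0_n,I_n)$, and set $$x_{t+1}=\mathrm{prox}_{\alpha_t r}\bigl(x_t-\alpha_t G(x_t,U_t,\xi_t)\bigr),\qquad G(x_t,U_t,\xi_t):=\mu^{-1}\bigl(F(x_t+\mu U_t,\xi_t)-F(x_t,\xi_t)\bigr)U_t .$$ Then sample $t^*\in\{0,\dots,T\}$ according to $\mathbb{P}(t^*=t)=\alpha_t/\sum_{i=0}^T\alpha_i$, and return $x_{t^*}$. $\mathbb{E}_{U,\xi}$ denotes total expectation over the randomness of the algorithm (the samples $U_t,\xi_t$ and, where it appears, the index $t^*$).
   Formalization: The first two bounds are proved for positive step sizes with α_t ≤ 1/ρ̄ (at the given t, resp. all t ≤ T), since they fail for large steps (F=0, r=x², ρ=1, ρ̄=2, x_0=1, α_0=10, small L_{f,0}); L_{f,0} is taken as sqrt(E[C(ξ)²]), as an arbitrary Lipschitz constant of f would not do. *)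

theory Defs
  imports "HOL-Probability.Probability"
begin

section \<open>Extended-real-valued convex analysis\<close>

text \<open>A function into the reals extended by \<open>+\<infinity>\<close> is modelled by an \<open>ereal\<close>-valued function that never
  takes the value \<open>-\<infinity>\<close>; properness includes this side condition.\<close>

definition dom_ext :: "('a \<Rightarrow> ereal) \<Rightarrow> 'a set" where
  "dom_ext p = {x. p x < \<infinity>}"

definition proper_fun :: "('a \<Rightarrow> ereal) \<Rightarrow> bool" where
  "proper_fun p \<longleftrightarrow> (\<forall>x. p x \<noteq> -\<infinity>) \<and> dom_ext p \<noteq> {}"

definition epi :: "('a \<Rightarrow> ereal) \<Rightarrow> ('a \<times> real) set" where
  "epi p = {(x, c). p x \<le> ereal c}"

definition closed_fun :: "('a::topological_space \<Rightarrow> ereal) \<Rightarrow> bool" where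
  "closed_fun p \<longleftrightarrow> closed (epi p)"

definition convex_fun :: "('a::real_vector \<Rightarrow> ereal) \<Rightarrow> bool" where
  "convex_fun p \<longleftrightarrow> convex (epi p)"

definition weakly_convex :: "real \<Rightarrow> ('a::real_normed_vector \<Rightarrow> real) \<Rightarrow> bool" where
  "weakly_convex \<rho> f \<longleftrightarrow> (\<forall>x1 x2. \<forall>l\<in>{0..1}.
     f (l *\<^sub>R x1 + (1 - l) *\<^sub>R x2)
       \<le> l * f x1 + (1 - l) * f x2 + l * (1 - l) * \<rho> / 2 * (norm (x1 - x2))\<^sup>2)"

definition prox_obj :: "real \<Rightarrow> ('a::real_normed_vector \<Rightarrow> ereal) \<Rightarrow> 'a \<Rightarrow> 'a \<Rightarrow> ereal" where
  "prox_obj l p u x = p x + ereal ((norm (u - x))\<^sup>2 / (2 * l))"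

text \<open>Both operators are meant for \<open>l > 0\<close>. If \<open>p\<close> is closed, proper and \<open>\<rho>\<close>-weakly convex with
  \<open>l * \<rho> < 1\<close>, the objective is closed and strongly convex, so its infimum is finite and is attained
  at exactly one point: \<open>arg_min\<close> then returns this point, and \<open>moreau_env\<close> is the minimum.\<close>

definition prox :: "real \<Rightarrow> ('a::real_normed_vector \<Rightarrow> ereal) \<Rightarrow> 'a \<Rightarrow> 'a" where
  "prox l p u = arg_min (prox_obj l p u) (\<lambda>_. True)"

definition moreau_env :: "real \<Rightarrow> ('a::real_normed_vector \<Rightarrow> ereal) \<Rightarrow> 'a \<Rightarrow> real" where
  "moreau_env l p u = real_of_ereal (INF x. prox_obj l p u x)"

definition grad :: "('a::real_inner \<Rightarrow> real) \<Rightarrow> 'a \<Rightarrow> 'a" where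
  "grad g x = (THE D. GDERIV g x :> D)"


section \<open>Gaussian smoothing\<close>

text \<open>The law \<open>N(0,I)\<close> on \<open>real ^ 'n\<close>, by its density.\<close>

definition std_gaussian :: "(real ^ 'n) measure" where
  "std_gaussian = density lborel (\<lambda>u. ennreal (\<Prod>i\<in>UNIV. std_normal_density (u $ i)))"

definition smoothing :: "real \<Rightarrow> (real ^ 'n \<Rightarrow> real) \<Rightarrow> real ^ 'n \<Rightarrow> real" where
  "smoothing \<mu> f x = (\<integral>u. f (x + \<mu> *\<^sub>R u) \<partial>std_gaussian)"


section \<open>The stochastic objective\<close>

definition objective ::
  "'w measure \<Rightarrow> ('w \<Rightarrow> 'z) \<Rightarrow> ('x \<Rightarrow> 'z \<Rightarrow> real) \<Rightarrow> 'x \<Rightarrow> real" where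
  "objective M \<xi> F x = (\<integral>w. F x (\<xi> w) \<partial>M)"

definition smoothed_objective ::
  "'w measure \<Rightarrow> ('w \<Rightarrow> 'z) \<Rightarrow> (real ^ 'n \<Rightarrow> 'z \<Rightarrow> real) \<Rightarrow> (real ^ 'n \<Rightarrow> ereal) \<Rightarrow> real \<Rightarrow> real ^ 'n \<Rightarrow> ereal"
  where
  "smoothed_objective M \<xi> F r \<mu> x = ereal (smoothing \<mu> (objective M \<xi> F) x) + r x"

text \<open>The Lipschitz constant of the objective that the random Lipschitz modulus \<open>C\<close> provides. An
  arbitrary Lipschitz constant of the expectation would not do: it does not control the second
  moment of the two-point gradient estimator (take \<open>F x z = z * x\<close> with a centred \<open>z\<close>).\<close>

definition lip_const :: "'w measure \<Rightarrow> ('w \<Rightarrow> 'z) \<Rightarrow> ('z \<Rightarrow> real) \<Rightarrow> real" where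
  "lip_const M \<xi> C = sqrt (\<integral>w. (C (\<xi> w))\<^sup>2 \<partial>M)"

lemma lip_const_lipschitz:
  fixes F :: "'x::real_normed_vector \<Rightarrow> 'z \<Rightarrow> real"
  assumes "prob_space M" and \<xi>: "\<xi> \<in> M \<rightarrow>\<^sub>M S"
    and F: "\<And>x. F x \<in> borel_measurable S"
    and F2: "\<And>x. integrable M (\<lambda>w. (F x (\<xi> w))\<^sup>2)"
    and C: "C \<in> borel_measurable S" and Cpos: "\<And>z. z \<in> space S \<Longrightarrow> 0 < C z"
    and C2: "integrable M (\<lambda>w. (C (\<xi> w))\<^sup>2)"
    and lip: "AE z in distr M S \<xi>. \<forall>x1 x2. \<bar>F x1 z - F x2 z\<bar> \<le> C z * norm (x1 - x2)"
  shows "0 < lip_const M \<xi> C" and "(lip_const M \<xi> C)-lipschitz_on UNIV (objective M \<xi> F)"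
proof -
  interpret prob_space M by fact
  have Cm [measurable]: "(\<lambda>w. C (\<xi> w)) \<in> borel_measurable M"
    using measurable_compose[OF \<xi> C] by simp
  have Fm [measurable]: "(\<lambda>w. F x (\<xi> w)) \<in> borel_measurable M" for x
    using measurable_compose[OF \<xi> F] by simp
  have Cw: "0 < C (\<xi> w)" if "w \<in> space M" for w
    using Cpos measurable_space[OF \<xi> that] by blast
  have C1: "integrable M (\<lambda>w. C (\<xi> w))"
    using square_integrable_imp_integrable[OF Cm C2] .
  have F1: "integrable M (\<lambda>w. F x (\<xi> w))" for x
    using square_integrable_imp_integrable[OF Fm F2] .
  have EC: "expectation (\<lambda>w. C (\<xi> w)) \<le> lip_const M \<xi> C"
  proof -
    have "0 \<le> variance (\<lambda>w. C (\<xi> w))" by simp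
    then have "(expectation (\<lambda>w. C (\<xi> w)))\<^sup>2 \<le> expectation (\<lambda>w. (C (\<xi> w))\<^sup>2)"
      using variance_eq[OF C1 C2] by simp
    then show ?thesis unfolding lip_const_def by (rule real_le_rsqrt)
  qed
  have "0 < expectation (\<lambda>w. C (\<xi> w))"
  proof (rule ccontr)
    assume "\<not> ?thesis"
    moreover have "0 \<le> expectation (\<lambda>w. C (\<xi> w))"
      by (rule integral_nonneg_AE) (use Cw in \<open>auto intro!: AE_I2 less_imp_le\<close>)
    ultimately have "expectation (\<lambda>w. C (\<xi> w)) = 0" by simp
    then have "AE w in M. C (\<xi> w) = 0"
      using integral_nonneg_eq_0_iff_AE[OF C1 AE_I2] Cw by (simp add: less_imp_le)
    then have "AE w in M. False"
      using AE_space by eventually_elim (use Cw in force)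
    then show False by simp
  qed
  with EC show pos: "0 < lip_const M \<xi> C" by simp
  have lip': "AE w in M. \<forall>x1 x2. \<bar>F x1 (\<xi> w) - F x2 (\<xi> w)\<bar> \<le> C (\<xi> w) * norm (x1 - x2)"
    using AE_distrD[OF \<xi> lip] .
  show "(lip_const M \<xi> C)-lipschitz_on UNIV (objective M \<xi> F)"
  proof (rule lipschitz_onI)
    fix x y
    have "\<bar>objective M \<xi> F x - objective M \<xi> F y\<bar> = \<bar>expectation (\<lambda>w. F x (\<xi> w) - F y (\<xi> w))\<bar>"
      unfolding objective_def by (simp add: Bochner_Integration.integral_diff F1)
    also have "\<dots> \<le> expectation (\<lambda>w. \<bar>F x (\<xi> w) - F y (\<xi> w)\<bar>)" by (rule integral_abs_bound)
    also have "\<dots> \<le> expectation (\<lambda>w. C (\<xi> w) * norm (x - y))"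
      by (rule integral_mono_AE) (use lip' F1 C1 in auto)
    also have "\<dots> = expectation (\<lambda>w. C (\<xi> w)) * norm (x - y)" by simp
    also have "\<dots> \<le> lip_const M \<xi> C * norm (x - y)" using EC by (rule mult_right_mono) simp
    finally show "dist (objective M \<xi> F x) (objective M \<xi> F y) \<le> lip_const M \<xi> C * dist x y"
      by (simp add: dist_norm)
  qed (use pos in simp)
qed


section \<open>The algorithm Z-ProxSG\<close>

definition grad_est ::
  "('x::real_vector \<Rightarrow> 'z \<Rightarrow> real) \<Rightarrow> real \<Rightarrow> 'x \<Rightarrow> 'x \<Rightarrow> 'z \<Rightarrow> 'x" where
  "grad_est F \<mu> x u z = (inverse \<mu> * (F (x + \<mu> *\<^sub>R u) z - F x z)) *\<^sub>R u"

text \<open>The iterates as a function of the sampled sequences \<open>u\<close> and \<open>z\<close>; the \<open>t\<close>-th iterate uses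
  only the samples with index below \<open>t\<close>. Step sizes must be positive, since \<open>prox\<close> is meaningful for
  positive parameters only.\<close>

primrec zproxsg ::
  "('x::real_normed_vector \<Rightarrow> 'z \<Rightarrow> real) \<Rightarrow> ('x \<Rightarrow> ereal) \<Rightarrow> real \<Rightarrow> (nat \<Rightarrow> real) \<Rightarrow> 'x
     \<Rightarrow> (nat \<Rightarrow> 'x) \<Rightarrow> (nat \<Rightarrow> 'z) \<Rightarrow> nat \<Rightarrow> 'x" where
  "zproxsg F r \<mu> \<alpha> x0 u z 0 = x0"
| "zproxsg F r \<mu> \<alpha> x0 u z (Suc t) =
     (let x = zproxsg F r \<mu> \<alpha> x0 u z t
      in prox (\<alpha> t) r (x - \<alpha> t *\<^sub>R grad_est F \<mu> x (u t) (z t)))"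

text \<open>Independence of two random variables with values in different types; the library's
  \<open>indep_var\<close> requires a common value type.\<close>

definition indep_rv ::
  "'w measure \<Rightarrow> 'a measure \<Rightarrow> ('w \<Rightarrow> 'a) \<Rightarrow> 'b measure \<Rightarrow> ('w \<Rightarrow> 'b) \<Rightarrow> bool" where
  "indep_rv M A X B Y \<longleftrightarrow> X \<in> M \<rightarrow>\<^sub>M A \<and> Y \<in> M \<rightarrow>\<^sub>M B \<and>
     prob_space.indep_set M {X -` E \<inter> space M | E. E \<in> sets A} {Y -` E \<inter> space M | E. E \<in> sets B}"

text \<open>The two sample sequences: \<open>U\<close> is i.i.d. standard Gaussian, \<open>\<xi>s\<close> is i.i.d. with the law of \<open>\<xi>\<close>
  on \<open>S\<close>, and the sequences are independent of each other.\<close>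

definition zproxsg_samples ::
  "'w measure \<Rightarrow> 'z measure \<Rightarrow> ('w \<Rightarrow> 'z) \<Rightarrow> (nat \<Rightarrow> 'w \<Rightarrow> real ^ 'n) \<Rightarrow> (nat \<Rightarrow> 'w \<Rightarrow> 'z) \<Rightarrow> bool" where
  "zproxsg_samples M S \<xi> U \<xi>s \<longleftrightarrow>
     prob_space.indep_vars M (\<lambda>_. borel) U UNIV \<and> (\<forall>i. distr M borel (U i) = std_gaussian) \<and>
     prob_space.indep_vars M (\<lambda>_. S) \<xi>s UNIV \<and> (\<forall>i. distr M S (\<xi>s i) = distr M S \<xi>) \<and>
     indep_rv M (PiM UNIV (\<lambda>_. borel)) (\<lambda>w i. U i w) (PiM UNIV (\<lambda>_. S)) (\<lambda>w i. \<xi>s i w)"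

text \<open>The output index: \<open>\<tau>\<close> is drawn from \<open>{0..T}\<close> with weights \<open>\<alpha> t\<close>, independently of all samples.\<close>

definition zproxsg_index ::
  "'w measure \<Rightarrow> 'z measure \<Rightarrow> (nat \<Rightarrow> 'w \<Rightarrow> real ^ 'n) \<Rightarrow> (nat \<Rightarrow> 'w \<Rightarrow> 'z)
     \<Rightarrow> (nat \<Rightarrow> real) \<Rightarrow> nat \<Rightarrow> ('w \<Rightarrow> nat) \<Rightarrow> bool" where
  "zproxsg_index M S U \<xi>s \<alpha> T \<tau> \<longleftrightarrow>
     (\<forall>t\<le>T. measure M {w \<in> space M. \<tau> w = t} = \<alpha> t / (\<Sum>i\<le>T. \<alpha> i)) \<and>
     indep_rv M (count_space {..T}) \<tau>
       (PiM UNIV (\<lambda>_. borel) \<Otimes>\<^sub>M PiM UNIV (\<lambda>_. S)) (\<lambda>w. (\<lambda>i. U i w, \<lambda>i. \<xi>s i w))"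

end

theory Submission
  imports Defs
begin

text \<open>Let \<open>g\<close> be the gradient of the smoothing \<open>f\<^sub>\<mu>\<close> and \<open>z = prox \<phi> x\<close>. Optimality of \<open>z\<close> says that \<open>z\<close> is a
  fixed point of a forward-backward step with the gradient \<open>g z\<close>, so nonexpansiveness of \<open>prox r\<close> bounds
  the distance of the next iterate to \<open>z\<close> by the norm of \<open>(1 - \<alpha> \<rho>') (x - z) - \<alpha> (G - g z)\<close>. Since \<open>G\<close> is an
  unbiased estimator of \<open>g x\<close> and \<open>g\<close> is \<open>\<rho>\<close>-hypomonotone, taking expectations gives the descent of the
  Moreau envelope up to the second moment of \<open>G\<close>, which is at most \<open>L\<^sup>2 E|u|^4 = L\<^sup>2 (n\<^sup>2 + 2 n)\<close>. The bound
  for the random output is the telescoped sum.\<close>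

section \<open>Proximal maps of a convex function plus a smooth weakly convex function\<close>

text \<open>The condition \<alpha> \<le> 1/\<rho>' keeps 1 - \<alpha> \<rho>' nonnegative, so that
  hypomonotonicity may be multiplied by it; \<rho>' \<le> 2 \<rho> then gives the right sign to what
  is left at second order in \<alpha>. The constant 2 N \<rho>' with N = n^2 + 2 n comes from |G - g
  z|^2 \<le> 2 |G|^2 + 2 |g z|^2, where both squares have mean at most N L^2, times the envelope
  factor \<rho>'/2. Three obstacles shape the rest. The objective is only Lipschitz, so its
  smoothing is differentiated by moving the translation onto the Gaussian density. No expectation is
  known to be finite in advance: the iterates get second moments by induction, and the envelope is
  shown to grow at most quadratically. The Lipschitz bound on F holds only almost surely, while
  joint measurability uses continuity in x at every sample point; F is therefore altered on a null
  set, and completeness of the measure carries the conclusions back to the original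
  iterates.\<close>

lemma convex_funD:
  assumes p: "convex_fun p" and "p x \<le> ereal a" "p y \<le> ereal b" "0 \<le> s" "s \<le> 1"
  shows "p (x + s *\<^sub>R (y - x)) \<le> ereal (a + s * (b - a))"
proof -
  have "(1 - s) *\<^sub>R (x, a) + s *\<^sub>R (y, b) \<in> epi p"
    by (rule convexD[OF p[unfolded convex_fun_def]]) (use assms in \<open>auto simp: epi_def\<close>)
  also have "(1 - s) *\<^sub>R (x, a) + s *\<^sub>R (y, b) = (x + s *\<^sub>R (y - x), a + s * (b - a))"
    by (simp add: algebra_simps)
  finally show ?thesis by (simp add: epi_def)
qed

text \<open>The bound \<open>k\<close> may vary with the point, so that a continuous summand can be
  moved to the right-hand side: sublevel sets of such a sum have this shape.\<close>

lemma closed_fun_sublevel: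
  fixes p :: "'a::t2_space \<Rightarrow> ereal"
  assumes "closed_fun p" "continuous_on UNIV k"
  shows "closed {x. p x \<le> ereal (k x)}"
proof -
  have "closed ((\<lambda>x. (x, k x)) -` epi p)"
    using assms by (intro closed_vimage continuous_intros) (auto simp: closed_fun_def)
  also have "(\<lambda>x. (x, k x)) -` epi p = {x. p x \<le> ereal (k x)}" by (auto simp: epi_def)
  finally show ?thesis .
qed

text \<open>The sublevel sets are nested and compact, so a finite family of them has its smallest
  member as intersection; a point common to all of them minimises \<open>q\<close>.\<close>

lemma ereal_minimizer_exists:
  fixes q :: "'a::heine_borel \<Rightarrow> ereal"
  assumes pr: "proper_fun q"
    and cl: "\<And>c. closed {x. q x \<le> ereal c}" and bd: "\<And>c. bounded {x. q x \<le> ereal c}"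
  obtains m where "\<And>y. q m \<le> q y"
proof -
  obtain y0 where y0: "q y0 < \<infinity>" using pr by (auto simp: proper_fun_def dom_ext_def)
  have cpt: "compact {x. q x \<le> q y}" if "q y < \<infinity>" for y
  proof -
    have "q y = ereal (real_of_ereal (q y))"
      using that pr by (cases "q y") (auto simp: proper_fun_def)
    then show ?thesis
      using cl[of "real_of_ereal (q y)"] bd[of "real_of_ereal (q y)"] by (metis compact_eq_bounded_closed)
  qed
  let ?F = "(\<lambda>y. {x. q x \<le> q y}) ` {y. q y \<le> q y0}"
  have "{x. q x \<le> q y0} \<inter> \<Inter> ?F \<noteq> {}"
  proof (rule compact_imp_fip_image)
    fix I assume I: "finite I" "I \<subseteq> {y. q y \<le> q y0}"
    show "{x. q x \<le> q y0} \<inter> (\<Inter>y\<in>I. {x. q x \<le> q y}) \<noteq> {}"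
    proof (cases "I = {}")
      case False
      define m where "m = arg_min_on q I"
      have "m \<in> I" "\<And>y. y \<in> I \<Longrightarrow> q m \<le> q y"
        using I False arg_min_if_finite[of I q] by (auto simp: m_def not_less)
      then show ?thesis using I by auto
    qed auto
    next
    show "closed {x. q x \<le> q y}" if "y \<in> {y. q y \<le> q y0}" for y
      using order.strict_trans1[OF _ y0, of "q y"] that by (auto intro!: compact_imp_closed cpt)
  qed (use y0 cpt in auto)
  then obtain m where "q m \<le> q y0" "\<And>y. q y \<le> q y0 \<Longrightarrow> q m \<le> q y" by auto
  then have "q m \<le> q y" for y by (meson linear order_trans)
  then show ?thesis by (rule that)
qed

text \<open>A minimum over a unit ball around a point of the domain, propagated outwards along rays by
  convexity.\<close>

lemma convex_fun_linear_lower_bound: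
  fixes p :: "'a::euclidean_space \<Rightarrow> ereal"
  assumes pr: "proper_fun p" and cl: "closed_fun p" and cv: "convex_fun p"
  obtains A B where "0 \<le> B" "\<And>y. ereal (A - B * norm y) \<le> p y"
proof -
  obtain x0 where x0: "p x0 < \<infinity>" using pr by (auto simp: proper_fun_def dom_ext_def)
  define c where "c = real_of_ereal (p x0)"
  have fin: "p y \<noteq> -\<infinity>" for y using pr by (auto simp: proper_fun_def)
  have c: "p x0 = ereal c" using x0 fin[of x0] by (cases "p x0") (auto simp: c_def)
  \<comment> \<open>Setting the value to infinity off the unit ball makes all sublevel sets bounded,
    so a minimum over the ball exists.\<close>
  define q where "q = (\<lambda>y. if y \<in> cball x0 1 then p y else \<infinity>)"
  have sub: "{x. q x \<le> ereal d} = cball x0 1 \<inter> {x. p x \<le> ereal d}" for d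
    by (auto simp: q_def split: if_splits)
  obtain m where m: "\<And>y. q m \<le> q y"
  proof (rule ereal_minimizer_exists)
    have "x0 \<in> dom_ext q" using x0 by (simp add: dom_ext_def q_def)
    then show "proper_fun q" using fin unfolding proper_fun_def by (auto simp: q_def)
    show "closed {x. q x \<le> ereal d}" for d
      unfolding sub using closed_fun_sublevel[OF cl continuous_on_const] by (intro closed_Int) auto
    show "bounded {x. q x \<le> ereal d}" for d
      unfolding sub by (intro bounded_Int) auto
  qed blast
  have "q m \<noteq> \<infinity>" "q m \<noteq> -\<infinity>" using m[of x0] c fin by (auto simp: q_def split: if_splits)
  then obtain b where b: "q m = ereal b" by (cases "q m") auto
  have ball: "ereal b \<le> p y" if "y \<in> cball x0 1" for y using m[of y] b that by (simp add: q_def)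
  have bc: "b \<le> c" using ball[of x0] c by simp
  have "ereal (b - (c - b) * norm (y - x0)) \<le> p y" for y
  proof (cases "y \<in> cball x0 1 \<or> p y = \<infinity>")
    case True
    have "b - (c - b) * norm (y - x0) \<le> b" using bc by (simp add: mult_nonneg_nonneg)
    then have "ereal (b - (c - b) * norm (y - x0)) \<le> ereal b" by simp
    then show ?thesis using True ball[of y] by (metis ereal_less_eq(1) order_trans)
  next
    case False
    then obtain d where d: "p y = ereal d" using fin[of y] by (cases "p y") auto
    \<comment> \<open>At fraction \<open>s\<close> the segment from \<open>x0\<close> to
      \<open>y\<close> crosses the unit sphere around \<open>x0\<close>, where the value is at least
      \<open>b\<close>; convexity then bounds \<open>p y\<close> from below.\<close>
    define s where "s = 1 / norm (y - x0)"
    have s: "0 < s" "s \<le> 1" using False by (auto simp: s_def dist_norm norm_minus_commute[of x0 y] divide_le_eq_1)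
    have "x0 + s *\<^sub>R (y - x0) \<in> cball x0 1"
      using False by (auto simp: s_def dist_norm)
    then have "ereal b \<le> ereal (c + s * (d - c))"
      by (rule order_trans[OF ball convex_funD[OF cv]]) (use c d s in auto)
    then have "b - c \<le> s * (d - c)" by simp
    then have "(b - c) / s \<le> d - c" using s by (simp add: field_simps)
    moreover have "(b - c) / s = - ((c - b) * norm (y - x0))" by (simp add: s_def algebra_simps)
    ultimately show ?thesis using bc d by simp
  qed
  \<comment> \<open>Recentring from \<open>x0\<close> to the origin costs only a constant.\<close>
  moreover have "b - (c - b) * norm x0 - (c - b) * norm y \<le> b - (c - b) * norm (y - x0)" for y
  proof -
    have "(c - b) * norm (y - x0) \<le> (c - b) * (norm y + norm x0)"
      using bc by (intro mult_left_mono norm_triangle_ineq4) auto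
    then show ?thesis by (simp add: algebra_simps)
  qed
  ultimately have "ereal (b - (c - b) * norm x0 - (c - b) * norm y) \<le> p y" for y
    by (meson ereal_less_eq(3) order_trans)
  then show ?thesis by (rule that[rotated]) (use bc in simp)
qed

text \<open>Chain rule along a ray. The limit is one-sided because optimality and weak convexity are
  both tested on segments leaving \<open>x\<close>.\<close>

lemma GDERIV_quotient_tendsto:
  assumes "GDERIV f x :> D"
  shows "((\<lambda>s. (f (x + s *\<^sub>R v) - f x) / s) \<longlongrightarrow> D \<bullet> v) (at_right 0)"
proof -
  have "((\<lambda>s. f (x + s *\<^sub>R v)) has_derivative (\<lambda>s. (s *\<^sub>R v) \<bullet> D)) (at 0)"
    using assms[unfolded gderiv_def]
    by (intro has_derivative_compose[of "\<lambda>s. x + s *\<^sub>R v" "\<lambda>s. s *\<^sub>R v", where g = f])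
       (auto intro!: derivative_eq_intros)
  then have "((\<lambda>s. f (x + s *\<^sub>R v)) has_field_derivative D \<bullet> v) (at 0)"
    by (simp add: has_field_derivative_def inner_commute mult_commute_abs)
  then show ?thesis
    by (auto simp: has_field_derivative_iff filterlim_at_split)
qed

lemma GDERIV_unique: "GDERIV f x :> D \<Longrightarrow> GDERIV f x :> E \<Longrightarrow> D = E"
proof -
  assume "GDERIV f x :> D" "GDERIV f x :> E"
  then have "(\<lambda>h. h \<bullet> D) = (\<lambda>h. h \<bullet> E)" unfolding gderiv_def by (rule has_derivative_unique)
  then have "(D - E) \<bullet> D = (D - E) \<bullet> E" by meson
  then have "(D - E) \<bullet> (D - E) = 0" by (simp add: inner_diff_right)
  then show "D = E" by simp
qed

lemma grad_eq: "GDERIV f x :> D \<Longrightarrow> grad f x = D"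
  unfolding grad_def by (rule the_equality) (auto dest: GDERIV_unique)

lemma inner_divideR_left: "(v /\<^sub>R l) \<bullet> d = v \<bullet> d / l"
  unfolding inner_scaleR_left divide_inverse_commute ..

text \<open>At distance d > 1 the right side is at most (|a| + |b|) d, which k d^2 exceeds once k d
  > |a| + |b|; the radius in the proof ensures both.\<close>

lemma quadratic_coercive_bounded:
  fixes u :: "'a::real_normed_vector"
  assumes k: "0 < k" and S: "\<And>y. y \<in> S \<Longrightarrow> k * (norm (y - u))\<^sup>2 \<le> a + b * norm (y - u)"
  shows "bounded S"
proof -
  have "dist u y \<le> 1 + (\<bar>a\<bar> + \<bar>b\<bar>) / k" if "y \<in> S" for y
  proof (rule ccontr)
    assume "\<not> ?thesis"
    moreover define d where "d = norm (y - u)"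
    ultimately have d: "1 + (\<bar>a\<bar> + \<bar>b\<bar>) / k < d" by (simp add: dist_norm norm_minus_commute)
    moreover have "0 \<le> (\<bar>a\<bar> + \<bar>b\<bar>) / k" using k by simp
    ultimately have d1: "1 < d" by linarith
    have "\<bar>a\<bar> + \<bar>b\<bar> < k * d" using d k by (simp add: field_simps)
    then have "(\<bar>a\<bar> + \<bar>b\<bar>) * d < k * d * d" using d1 by (intro mult_strict_right_mono) auto
    moreover have "k * d * d \<le> a + b * d" using S[OF that] by (simp add: d_def power2_eq_square)
    moreover have "a \<le> \<bar>a\<bar> * d" using d1 mult_left_mono[of 1 d "\<bar>a\<bar>"] by simp
    moreover have "b * d \<le> \<bar>b\<bar> * d" using d1 by (intro mult_right_mono) auto
    ultimately show False by (simp add: algebra_simps)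
  qed
  then show ?thesis by (meson bounded_def)
qed

section \<open>Proximal map and Moreau envelope of a smooth weakly convex plus a convex
  function\<close>

locale weakly_convex_composite =
  fixes h :: "'a::euclidean_space \<Rightarrow> real" and g :: "'a \<Rightarrow> 'a" and \<rho> :: real and r :: "'a \<Rightarrow> ereal"
  assumes proper: "proper_fun r" and closed: "closed_fun r" and convex: "convex_fun r"
    and gderiv: "\<And>x. GDERIV h x :> g x"
    and subgrad: "\<And>x y. h x + g x \<bullet> (y - x) - \<rho> / 2 * (norm (y - x))\<^sup>2 \<le> h y"
    and rho_nonneg: "0 \<le> \<rho>"
begin

definition p :: "'a \<Rightarrow> ereal" where "p x = ereal (h x) + r x"

lemma r_not_MInf [simp]: "r x \<noteq> -\<infinity>"
  using proper by (auto simp: proper_fun_def)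

lemma prox_obj_p: "prox_obj l p u y = ereal (h y + (norm (u - y))\<^sup>2 / (2 * l)) + r y"
  by (cases "r y") (auto simp: prox_obj_def p_def)

lemma continuous_h: "continuous_on UNIV h"
  by (rule has_derivative_continuous_on[where f' = "\<lambda>x k. k \<bullet> g x"])
     (use gderiv in \<open>auto simp: gderiv_def\<close>)

text \<open>Adding the quadratic minorants of \<open>h\<close> at \<open>x\<close> and at
  \<open>y\<close> cancels the function values and leaves \<rho>/2 twice.\<close>

lemma hypomonotone: "- \<rho> * (norm (x - y))\<^sup>2 \<le> (g x - g y) \<bullet> (x - y)"
  using subgrad[of x y] subgrad[of y x]
  by (simp add: norm_minus_commute[of y x] algebra_simps)

end

locale weakly_convex_prox = weakly_convex_composite +
  fixes l :: real
  assumes l_pos: "0 < l" and l_less: "l * \<rho> < 1"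
begin

text \<open>The linear minorant of \<open>r\<close> and the minorant of \<open>h\<close> with
  curvature -\<rho> are dominated by the proximal term because l \<rho> < 1. Sublevel sets are thus
  compact, a minimiser exists, and the choice made by \<open>prox\<close> is one.\<close>

lemma prox_minimizes: "prox_obj l p u (prox l p u) \<le> prox_obj l p u y"
proof -
  obtain A B where B: "0 \<le> B" and AB: "\<And>y. ereal (A - B * norm y) \<le> r y"
    using convex_fun_linear_lower_bound[OF proper closed convex] by metis
  have level: "{x. prox_obj l p u x \<le> ereal c} =
      {x. r x \<le> ereal (c - h x - (norm (u - x))\<^sup>2 / (2 * l))}" for c
  proof -
    have "prox_obj l p u x \<le> ereal c \<longleftrightarrow> r x \<le> ereal (c - h x - (norm (u - x))\<^sup>2 / (2 * l))" for x
      by (cases "r x") (auto simp: prox_obj_p)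
    then show ?thesis by blast
  qed
  obtain m where m: "\<And>y. prox_obj l p u m \<le> prox_obj l p u y"
  proof (rule ereal_minimizer_exists)
    have "dom_ext r \<subseteq> dom_ext (prox_obj l p u)"
      by (auto simp: dom_ext_def prox_obj_p)
    then show "proper_fun (prox_obj l p u)"
      using proper by (auto simp: proper_fun_def prox_obj_p)
    show "closed {x. prox_obj l p u x \<le> ereal c}" for c
      unfolding level using l_pos
      by (intro closed_fun_sublevel[OF closed] continuous_intros continuous_h) auto
    show "bounded {x. prox_obj l p u x \<le> ereal c}" for c
    proof (rule quadratic_coercive_bounded)
      \<comment> \<open>Half of what remains of the curvature 1/l of the proximal term after the
        loss \<rho> in the minorant of \<open>h\<close>.\<close>
      show "0 < (1 / l - \<rho>) / 2" using l_pos l_less by (simp add: field_simps)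
    next
      fix y assume "y \<in> {x. prox_obj l p u x \<le> ereal c}"
      then have "ereal (A - B * norm y) \<le> ereal (c - h y - (norm (u - y))\<^sup>2 / (2 * l))"
        unfolding level mem_Collect_eq by (rule order_trans[OF AB])
      then have 1: "A - B * norm y \<le> c - h y - (norm (y - u))\<^sup>2 / (2 * l)"
        by (simp add: norm_minus_commute)
      have 2: "B * norm y \<le> B * norm u + B * norm (y - u)"
        using mult_left_mono[OF norm_triangle_sub[of y u] B] by (simp add: algebra_simps)
      have 3: "- (g u \<bullet> (y - u)) \<le> norm (g u) * norm (y - u)"
        using Cauchy_Schwarz_ineq2[of "g u" "y - u"] by linarith
      have 4: "(1 / l - \<rho>) / 2 * (norm (y - u))\<^sup>2
          = (norm (y - u))\<^sup>2 / (2 * l) - \<rho> / 2 * (norm (y - u))\<^sup>2"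
        by (simp add: field_simps)
      show "(1 / l - \<rho>) / 2 * (norm (y - u))\<^sup>2
          \<le> (c - h u - A + B * norm u) + (norm (g u) + B) * norm (y - u)"
        unfolding 4 using 1 2 3 subgrad[of u y] by (simp add: algebra_simps)
    qed
  qed blast
  then have "is_arg_min (prox_obj l p u) (\<lambda>_. True) m"
    by (simp add: is_arg_min_linorder)
  then have "is_arg_min (prox_obj l p u) (\<lambda>_. True) (prox l p u)"
    unfolding prox_def arg_min_def by (rule someI)
  then show ?thesis by (simp add: is_arg_min_linorder)
qed

definition rp :: "'a \<Rightarrow> real" where "rp u = real_of_ereal (r (prox l p u))"

text \<open>An infinite value of \<open>r\<close> at the proximal point would make the minimal
  objective infinite, against properness.\<close>

lemma r_prox: "r (prox l p u) = ereal (rp u)"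
proof -
  obtain y where "r y < \<infinity>" using proper by (auto simp: proper_fun_def dom_ext_def)
  then have "r (prox l p u) \<noteq> \<infinity>" using prox_minimizes[of u y] by (auto simp: prox_obj_p)
  then show ?thesis by (cases "r (prox l p u)") (auto simp: rp_def)
qed

lemma moreau_env_eq:
  "moreau_env l p u = h (prox l p u) + rp u + (norm (u - prox l p u))\<^sup>2 / (2 * l)"
proof -
  have "(INF y. prox_obj l p u y) = prox_obj l p u (prox l p u)"
    by (intro antisym INF_lower INF_greatest prox_minimizes) auto
  then show ?thesis by (simp add: moreau_env_def prox_obj_p r_prox)
qed

text \<open>The proximal point of \<open>v\<close> competes in the minimisation at \<open>u\<close>;
  the upper estimates of the envelope below start here.\<close>

lemma moreau_env_le_prox:
  "moreau_env l p u \<le> h (prox l p v) + rp v + (norm (u - prox l p v))\<^sup>2 / (2 * l)"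
  using prox_minimizes[of u "prox l p v"] unfolding moreau_env_eq
  by (simp add: prox_obj_p r_prox)

lemma INF_le_moreau_env: "(INF y. p y) \<le> ereal (moreau_env l p u)"
proof -
  have "(INF y. p y) \<le> p (prox l p u)" by (rule INF_lower) simp
  also have "\<dots> \<le> ereal (moreau_env l p u)"
    using l_pos by (simp add: p_def r_prox moreau_env_eq)
  finally show ?thesis .
qed

text \<open>First-order optimality: (u - z)/l - g z is a convex subgradient of \<open>r\<close> at z
  = \<open>prox l p u\<close>. Moving from z towards \<open>y\<close> by a fraction s, dividing by s
  and letting s tend to 0 removes the quadratic term and turns the increment of \<open>h\<close>
  into its derivative.\<close>

lemma prox_subgrad:
  assumes "r y = ereal c"
  shows "rp u + ((u - prox l p u) /\<^sub>R l - g (prox l p u)) \<bullet> (y - prox l p u) \<le> c"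
proof -
  define z where "z = prox l p u"
  define d where "d = y - z"
  have key: "- ((h (z + s *\<^sub>R d) - h z) / s) + (u - z) \<bullet> d / l - s * (norm d)\<^sup>2 / (2 * l) \<le> c - rp u"
    if s: "0 < s" "s \<le> 1" for s
  proof -
    have "r (z + s *\<^sub>R d) \<le> ereal (rp u + s * (c - rp u))"
      unfolding d_def using s assms r_prox[of u] by (intro convex_funD[OF convex]) (auto simp: z_def)
    then have "prox_obj l p u (z + s *\<^sub>R d)
        \<le> ereal (h (z + s *\<^sub>R d) + (norm (u - (z + s *\<^sub>R d)))\<^sup>2 / (2 * l)) + ereal (rp u + s * (c - rp u))"
      unfolding prox_obj_p by (rule add_left_mono)
    with prox_minimizes[of u] have "prox_obj l p u z
        \<le> ereal (h (z + s *\<^sub>R d) + (norm (u - (z + s *\<^sub>R d)))\<^sup>2 / (2 * l)) + ereal (rp u + s * (c - rp u))"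
      unfolding z_def by (rule order_trans)
    then have "h z + (norm (u - z))\<^sup>2 / (2 * l)
        \<le> h (z + s *\<^sub>R d) + (norm (u - (z + s *\<^sub>R d)))\<^sup>2 / (2 * l) + s * (c - rp u)"
      using r_prox[of u] by (simp add: prox_obj_p z_def[symmetric])
    moreover have "(norm (u - (z + s *\<^sub>R d)))\<^sup>2
        = (norm (u - z))\<^sup>2 - 2 * s * ((u - z) \<bullet> d) + s\<^sup>2 * (norm d)\<^sup>2"
      unfolding power2_norm_eq_inner
      by (simp add: algebra_simps inner_commute power2_eq_square)
    ultimately have "h z - h (z + s *\<^sub>R d) + s * ((u - z) \<bullet> d) / l - s\<^sup>2 * (norm d)\<^sup>2 / (2 * l)
        \<le> s * (c - rp u)"
      using l_pos by (simp add: add_divide_distrib diff_divide_distrib)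
    then have "(h z - h (z + s *\<^sub>R d) + s * ((u - z) \<bullet> d) / l - s\<^sup>2 * (norm d)\<^sup>2 / (2 * l)) / s
        \<le> c - rp u"
      using s by (simp add: pos_divide_le_eq mult.commute)
    moreover have "(h z - h (z + s *\<^sub>R d) + s * ((u - z) \<bullet> d) / l - s\<^sup>2 * (norm d)\<^sup>2 / (2 * l)) / s
        = - ((h (z + s *\<^sub>R d) - h z) / s) + (u - z) \<bullet> d / l - s * (norm d)\<^sup>2 / (2 * l)"
      using s l_pos by (simp add: field_simps power2_eq_square)
    ultimately show ?thesis by simp
  qed
  have lim: "((\<lambda>s. - ((h (z + s *\<^sub>R d) - h z) / s) + (u - z) \<bullet> d / l - s * (norm d)\<^sup>2 / (2 * l))
      \<longlongrightarrow> - (g z \<bullet> d) + (u - z) \<bullet> d / l - 0 * (norm d)\<^sup>2 / (2 * l)) (at_right 0)"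
    by (intro tendsto_intros GDERIV_quotient_tendsto[OF gderiv]) (use l_pos in auto)
  have "- (g z \<bullet> d) + (u - z) \<bullet> d / l - 0 * (norm d)\<^sup>2 / (2 * l) \<le> c - rp u"
  proof (rule tendsto_upperbound[OF lim eventually_at_rightI])
    show "- ((h (z + s *\<^sub>R d) - h z) / s) + (u - z) \<bullet> d / l - s * (norm d)\<^sup>2 / (2 * l) \<le> c - rp u"
      if "s \<in> {0<..<1}" for s
      using that by (intro key) auto
  qed auto
  then show ?thesis
    unfolding z_def[symmetric] d_def[symmetric] inner_diff_left[of "_ /\<^sub>R _"] inner_divideR_left by simp
qed

text \<open>Adding the minorant of \<open>h\<close> to \<open>prox_subgrad\<close> cancels
  \<open>g\<close>: (u - z)/l is a subgradient of the whole sum up to the weak convexity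
  defect.\<close>

lemma prox_weak_subgrad:
  assumes "r y = ereal c"
  shows "h (prox l p u) + rp u + (u - prox l p u) \<bullet> (y - prox l p u) / l
    - \<rho> / 2 * (norm (y - prox l p u))\<^sup>2 \<le> h y + c"
  using prox_subgrad[OF assms, of u] subgrad[of "prox l p u" y]
  unfolding inner_diff_left[of "_ /\<^sub>R _"] inner_divideR_left by linarith

text \<open>Each proximal point is tested against the other; the sum is a monotonicity inequality
  with defect \<rho>, and Cauchy-Schwarz gives the factor 1 - l \<rho>.\<close>

lemma prox_lipschitz: "(1 - l * \<rho>) * norm (prox l p u - prox l p v) \<le> norm (u - v)"
proof -
  define x y where "x = prox l p u" and "y = prox l p v"
  have 0: "((u - x) \<bullet> (y - x) + (v - y) \<bullet> (x - y)) / l \<le> \<rho> * (norm (x - y))\<^sup>2"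
    using prox_weak_subgrad[OF r_prox[of v], of u] prox_weak_subgrad[OF r_prox[of u], of v]
    by (simp add: x_def[symmetric] y_def[symmetric] norm_minus_commute[of y x] add_divide_distrib)
  have "(u - x) \<bullet> (y - x) + (v - y) \<bullet> (x - y) \<le> l * \<rho> * (norm (x - y))\<^sup>2"
    using 0 l_pos by (simp add: pos_divide_le_eq mult_ac)
  moreover have "(u - x) \<bullet> (y - x) + (v - y) \<bullet> (x - y) = (norm (x - y))\<^sup>2 - (u - v) \<bullet> (x - y)"
    unfolding power2_norm_eq_inner by (simp add: algebra_simps inner_commute)
  ultimately have "(norm (x - y))\<^sup>2 \<le> l * \<rho> * (norm (x - y))\<^sup>2 + (u - v) \<bullet> (x - y)" by linarith
  moreover have "(u - v) \<bullet> (x - y) \<le> norm (u - v) * norm (x - y)" by (rule norm_cauchy_schwarz)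
  ultimately have "((1 - l * \<rho>) * norm (x - y)) * norm (x - y) \<le> norm (u - v) * norm (x - y)"
    by (simp add: algebra_simps power2_eq_square)
  then show ?thesis
    unfolding x_def[symmetric] y_def[symmetric]
    by (cases "x = y") auto
qed

lemma continuous_prox: "continuous_on A (prox l p)"
proof -
  have "dist (prox l p u) (prox l p v) \<le> 1 / (1 - l * \<rho>) * dist u v" for u v
    using prox_lipschitz[of u v] l_less by (simp add: dist_norm field_simps)
  then have "(1 / (1 - l * \<rho>))-lipschitz_on A (prox l p)"
    using l_less by (intro lipschitz_onI) auto
  then show ?thesis by (rule lipschitz_on_continuous_on)
qed

text \<open>The proximal point of \<open>u\<close> is kept as competitor at \<open>v\<close>, and
  the square is expanded around \<open>u\<close>.\<close>

lemma moreau_env_upper: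
  "moreau_env l p v \<le> moreau_env l p u + (u - prox l p u) \<bullet> (v - u) / l + (norm (v - u))\<^sup>2 / (2 * l)"
proof -
  define z where "z = prox l p u"
  have "(norm (v - z))\<^sup>2 = (norm (u - z))\<^sup>2 + 2 * ((u - z) \<bullet> (v - u)) + (norm (v - u))\<^sup>2"
    unfolding power2_norm_eq_inner by (simp add: algebra_simps inner_commute)
  then show ?thesis
    using moreau_env_le_prox[of v u] l_pos
    by (simp add: moreau_env_eq[of u] z_def[symmetric] add_divide_distrib)
qed

text \<open>\<open>moreau_env_upper\<close> is used twice. With \<open>u\<close> and
  \<open>v\<close> exchanged it gives a lower estimate whose slope is taken at \<open>v\<close>;
  Lipschitz continuity of the proximal map moves the slope to \<open>u\<close> at the price of a
  quadratic error.\<close>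

lemma GDERIV_moreau_env: "GDERIV (moreau_env l p) u :> (u - prox l p u) /\<^sub>R l"
proof -
  define z where "z = prox l p"
  \<comment> \<open>The displacement from a point to its proximal point has Lipschitz constant 1 +
    1/(1 - l \<rho>); the second summand is the quadratic term of
    \<open>moreau_env_upper\<close>.\<close>
  define K where "K = (1 + 1 / (1 - l * \<rho>)) / l + 1 / (2 * l)"
  have K: "0 \<le> 1 / (2 * l)" "1 / (2 * l) \<le> K"
    using l_pos l_less by (auto simp: K_def intro!: divide_nonneg_pos add_nonneg_nonneg)
  have zl: "norm (z v - z u) \<le> 1 / (1 - l * \<rho>) * norm (v - u)" for v
    using prox_lipschitz[of v u] l_less by (simp add: z_def field_simps)
  have bound: "\<bar>moreau_env l p v - moreau_env l p u - (v - u) \<bullet> ((u - z u) /\<^sub>R l)\<bar> \<le> K * (norm (v - u))\<^sup>2"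
    (is "\<bar>?e\<bar> \<le> _") for v
  proof -
    have in_eq: "(v - u) \<bullet> ((u - z u) /\<^sub>R l) = (u - z u) \<bullet> (v - u) / l"
      by (subst inner_commute) (rule inner_divideR_left)
    have "?e \<le> 1 / (2 * l) * (norm (v - u))\<^sup>2"
      using moreau_env_upper[of v u] unfolding in_eq z_def[symmetric] by simp
    also have "\<dots> \<le> K * (norm (v - u))\<^sup>2" using K by (intro mult_right_mono) auto
    finally have up: "?e \<le> K * (norm (v - u))\<^sup>2" .
    have "- ?e \<le> ((v - z v) \<bullet> (u - v) - (u - z u) \<bullet> (u - v)) / l + (norm (v - u))\<^sup>2 / (2 * l)"
    proof -
      have "(u - z u) \<bullet> (v - u) = - ((u - z u) \<bullet> (u - v))" by (simp add: inner_diff_right)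
      then show ?thesis
        using moreau_env_upper[of u v] in_eq
        unfolding z_def[symmetric] norm_minus_commute[of u v] diff_divide_distrib by simp
    qed
    also have "(v - z v) \<bullet> (u - v) - (u - z u) \<bullet> (u - v) = ((v - u) - (z v - z u)) \<bullet> (u - v)"
      by (simp add: algebra_simps)
    also have "\<dots> \<le> norm ((v - u) - (z v - z u)) * norm (u - v)" by (rule norm_cauchy_schwarz)
    also have "\<dots> \<le> (norm (v - u) + 1 / (1 - l * \<rho>) * norm (v - u)) * norm (u - v)"
      by (intro mult_right_mono order_trans[OF norm_triangle_ineq4] add_left_mono zl) auto
    also have "\<dots> / l + (norm (v - u))\<^sup>2 / (2 * l) = K * (norm (v - u))\<^sup>2"
      by (simp add: K_def norm_minus_commute[of u v] algebra_simps power2_eq_square add_divide_distrib)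
    finally have "- ?e \<le> K * (norm (v - u))\<^sup>2"
      using l_pos by (simp add: divide_right_mono)
    with up show ?thesis by (rule abs_leI)
  qed
  show ?thesis unfolding gderiv_def has_derivative_at2
  proof (intro conjI bounded_linear_inner_left)
    have "((\<lambda>v. K * norm (v - u)) \<longlongrightarrow> K * norm (u - u)) (at u)" by (intro tendsto_intros)
    then have lim: "((\<lambda>v. K * norm (v - u)) \<longlongrightarrow> 0) (at u)" by simp
    have "norm ((1 / norm (v - u)) *\<^sub>R (moreau_env l p v - (moreau_env l p u + (v - u) \<bullet> ((u - z u) /\<^sub>R l))))
        \<le> K * norm (v - u)" if "v \<noteq> u" for v
      using bound[of v] that
      by (simp add: abs_mult divide_le_eq power2_eq_square mult.assoc diff_diff_eq del: inner_scaleR_right)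
    then show "((\<lambda>v. (1 / norm (v - u)) *\<^sub>R (moreau_env l p v
        - (moreau_env l p u + (v - u) \<bullet> ((u - prox l p u) /\<^sub>R l)))) \<longlongrightarrow> 0) (at u)"
      unfolding z_def[symmetric]
      by (intro Lim_null_comparison[OF _ lim]) (auto simp: eventually_at_filter)
  qed
qed

lemma grad_moreau_env: "grad (moreau_env l p) u = (u - prox l p u) /\<^sub>R l"
  by (rule grad_eq) (rule GDERIV_moreau_env)

lemma continuous_moreau_env: "continuous_on A (moreau_env l p)"
  by (rule continuous_on_subset[OF has_derivative_continuous_on[of UNIV _ "\<lambda>u k. k \<bullet> ((u - prox l p u) /\<^sub>R l)"]])
     (use GDERIV_moreau_env in \<open>auto simp: gderiv_def\<close>)

text \<open>Together with second moments of the iterates, this makes the squared gradient of the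
  envelope integrable.\<close>

lemma displacement_linear_growth:
  obtains K where "0 \<le> K" "\<And>u. norm (u - prox l p u) \<le> K * (1 + norm u)"
proof -
  define c where "c = 1 / (1 - l * \<rho>)"
  have c: "0 \<le> c" using l_less by (simp add: c_def)
  define K where "K = norm (prox l p 0) + 1 + c"
  have "norm (u - prox l p u) \<le> K * (1 + norm u)" for u
  proof -
    have "norm (prox l p u - prox l p 0) \<le> c * norm u"
      using prox_lipschitz[of u 0] l_less by (simp add: c_def field_simps)
    moreover have "norm (u - prox l p u) \<le> norm u + norm (prox l p u - prox l p 0) + norm (prox l p 0)"
      using norm_triangle_ineq4[of u "prox l p u"] norm_triangle_sub[of "prox l p u" "prox l p 0"] by linarith
    ultimately have "norm (u - prox l p u) \<le> norm (prox l p 0) + (1 + c) * norm u"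
      by (simp add: algebra_simps)
    also have "\<dots> \<le> K * (1 + norm u)"
      using c mult_nonneg_nonneg[of "norm (prox l p 0)" "norm u"] by (simp add: K_def algebra_simps)
    finally show ?thesis .
  qed
  then show ?thesis using that[of K] c by (simp add: K_def)
qed

text \<open>Expanding with \<open>moreau_env_upper\<close> from \<open>u\<close> to 0 bounds the
  envelope below, from 0 to \<open>u\<close> above; linear growth of the displacement makes both
  bounds quadratic. It serves to integrate the envelope along the iterates.\<close>

lemma moreau_env_quadratic_growth:
  obtains K where "\<And>u. \<bar>moreau_env l p u\<bar> \<le> K * (1 + (norm u)\<^sup>2)"
proof -
  obtain K where K: "0 \<le> K" "\<And>u. norm (u - prox l p u) \<le> K * (1 + norm u)"
    using displacement_linear_growth by blast
  have *: "K * (1 + a) * a / l + a\<^sup>2 / (2 * l) \<le> (2 * K / l + 1 / (2 * l)) * (1 + a\<^sup>2)" if "0 \<le> a" for a :: real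
  proof -
    have "(1 + a) * a \<le> 2 * (1 + a\<^sup>2)"
      using sum_squares_bound[of 1 a] that by (simp add: power2_eq_square algebra_simps)
    then have "K / l * ((1 + a) * a) \<le> K / l * (2 * (1 + a\<^sup>2))" using K l_pos by (intro mult_left_mono) auto
    moreover have "1 / (2 * l) * a\<^sup>2 \<le> 1 / (2 * l) * (1 + a\<^sup>2)" using l_pos by (intro mult_left_mono) auto
    moreover have "K / l * ((1 + a) * a) = K * (1 + a) * a / l" "1 / (2 * l) * a\<^sup>2 = a\<^sup>2 / (2 * l)"
      "K / l * (2 * (1 + a\<^sup>2)) = 2 * K / l * (1 + a\<^sup>2)" by simp_all
    ultimately show ?thesis unfolding distrib_right by linarith
  qed
  define e where "e = \<bar>moreau_env l p 0\<bar>"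
  have low: "- moreau_env l p u \<le> e + norm (u - prox l p u) * norm u / l + (norm u)\<^sup>2 / (2 * l)" for u
  proof -
    have "(u - prox l p u) \<bullet> (0 - u) / l \<le> norm (u - prox l p u) * norm u / l"
      using norm_cauchy_schwarz[of "u - prox l p u" "0 - u"] l_pos by (intro divide_right_mono) auto
    then show ?thesis using moreau_env_upper[of 0 u] by (simp add: e_def)
  qed
  have up: "moreau_env l p u \<le> e + norm (0 - prox l p 0) * norm u / l + (norm u)\<^sup>2 / (2 * l)" for u
  proof -
    have "(0 - prox l p 0) \<bullet> (u - 0) / l \<le> norm (0 - prox l p 0) * norm u / l"
      using norm_cauchy_schwarz[of "0 - prox l p 0" "u - 0"] l_pos by (intro divide_right_mono) auto
    then show ?thesis using moreau_env_upper[of u 0] by (simp add: e_def)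
  qed
  have "\<bar>moreau_env l p u\<bar> \<le> (e + (2 * K / l + 1 / (2 * l))) * (1 + (norm u)\<^sup>2)" for u
  proof -
    have "norm (0 - prox l p 0) \<le> K * (1 + norm u)"
      using K(2)[of 0] mult_nonneg_nonneg[OF K(1) norm_ge_zero[of u]] by (simp add: distrib_left)
    then have a: "norm (0 - prox l p 0) * norm u / l \<le> K * (1 + norm u) * norm u / l"
      using l_pos by (intro divide_right_mono mult_right_mono) auto
    have b: "norm (u - prox l p u) * norm u / l \<le> K * (1 + norm u) * norm u / l"
      using l_pos K(2)[of u] by (intro divide_right_mono mult_right_mono) auto
    have "e \<le> e * (1 + (norm u)\<^sup>2)" by (simp add: e_def algebra_simps)
    then have "e + K * (1 + norm u) * norm u / l + (norm u)\<^sup>2 / (2 * l) \<le> (e + (2 * K / l + 1 / (2 * l))) * (1 + (norm u)\<^sup>2)"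
      using *[of "norm u"] by (simp add: algebra_simps)
    then show ?thesis using low[of u] up[of u] a b by linarith
  qed
  then show ?thesis by (rule that)
qed

end

text \<open>The point \<open>prox l \<phi> x\<close> is itself a forward-backward step with the gradient at that point, so that
  nonexpansiveness of \<open>prox a r\<close> compares it with a stochastic step from \<open>x\<close>.\<close>

lemma (in weakly_convex_prox) prox_step_distance:
  fixes x G :: 'a
  assumes a: "0 < a"
  defines "z \<equiv> prox l p x"
  shows "norm (prox a r (x - a *\<^sub>R G) - z) \<le> norm ((1 - a / l) *\<^sub>R (x - z) - a *\<^sub>R (G - g z))"
proof -
  \<comment> \<open>With \<open>h\<close> = 0 and \<rho> = 0, \<open>r\<close> alone becomes an
    instance, so the same optimality lemma describes the stochastic step.\<close>
  interpret R0: weakly_convex_prox "\<lambda>_. 0" "\<lambda>_. 0" 0 r a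
    by unfold_locales (use proper closed convex a in \<open>auto simp: GDERIV_const\<close>)
  have p0: "R0.p = r" by (auto simp: R0.p_def)
  define y where "y = prox a r (x - a *\<^sub>R G)"
  define w where "w = x - a *\<^sub>R G - y"
  define q where "q = (x - z) /\<^sub>R l - g z"
  \<comment> \<open>\<open>q\<close> is a subgradient of \<open>r\<close> at \<open>z\<close> and
    \<open>w /\<^sub>R a\<close> one at \<open>y\<close>; testing each at the other point and adding
    is monotonicity of the subdifferential.\<close>
  have "rp x + q \<bullet> (y - z) \<le> R0.rp (x - a *\<^sub>R G)"
    unfolding q_def z_def by (rule prox_subgrad) (use R0.r_prox in \<open>simp add: y_def p0\<close>)
  moreover have "R0.rp (x - a *\<^sub>R G) + (w /\<^sub>R a) \<bullet> (z - y) \<le> rp x"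
    using R0.prox_subgrad[of z "rp x" "x - a *\<^sub>R G"] r_prox[of x] by (simp add: w_def y_def p0 z_def)
  ultimately have "q \<bullet> (y - z) + (w /\<^sub>R a) \<bullet> (z - y) \<le> 0" by linarith
  then have "a * (q \<bullet> (y - z) + (w /\<^sub>R a) \<bullet> (z - y)) \<le> 0" using a by (simp add: mult_le_0_iff)
  moreover have "a * (q \<bullet> (y - z) + (w /\<^sub>R a) \<bullet> (z - y)) = (a *\<^sub>R q - w) \<bullet> (y - z)"
    using a by (simp add: distrib_left right_diff_distrib mult.assoc[symmetric] inner_diff_left inner_diff_right)
  ultimately have "(a *\<^sub>R q - w) \<bullet> (y - z) \<le> 0" by simp
  \<comment> \<open>This identity turns monotonicity into |y - z|^2 \<le> v . (y - z), with v the
    vector whose norm is the claimed bound.\<close>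
  moreover have "a *\<^sub>R q - w = (y - z) - ((1 - a / l) *\<^sub>R (x - z) - a *\<^sub>R (G - g z))"
    by (simp add: q_def w_def algebra_simps divide_inverse)
  ultimately have "(norm (y - z))\<^sup>2 \<le> ((1 - a / l) *\<^sub>R (x - z) - a *\<^sub>R (G - g z)) \<bullet> (y - z)"
    by (simp add: power2_norm_eq_inner inner_diff_left)
  also have "\<dots> \<le> norm ((1 - a / l) *\<^sub>R (x - z) - a *\<^sub>R (G - g z)) * norm (y - z)" by (rule norm_cauchy_schwarz)
  finally show ?thesis unfolding y_def[symmetric]
    by (cases "y = z") (auto simp: power2_eq_square)
qed

text \<open>The old proximal point \<open>z\<close> attains the envelope at \<open>x\<close> and
  competes in the one at the new point y. The two objective values differ by (|y - z|^2 - |x -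
  z|^2)/(2 l), hence the -1 in the first coefficient.\<close>

lemma (in weakly_convex_prox) moreau_env_step:
  fixes x G :: 'a
  assumes a: "0 < a"
  defines "z \<equiv> prox l p x"
  shows "moreau_env l p (prox a r (x - a *\<^sub>R G)) \<le> moreau_env l p x
    + (((1 - a / l)\<^sup>2 - 1) * (norm (x - z))\<^sup>2 - 2 * a * (1 - a / l) * ((x - z) \<bullet> (G - g z))
        + a\<^sup>2 * (norm (G - g z))\<^sup>2) / (2 * l)"
proof -
  define y where "y = prox a r (x - a *\<^sub>R G)"
  have "(norm (y - z))\<^sup>2 \<le> (norm ((1 - a / l) *\<^sub>R (x - z) - a *\<^sub>R (G - g z)))\<^sup>2"
    using prox_step_distance[OF a, of x G] by (intro power_mono) (auto simp: y_def z_def)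
  also have "\<dots> = (1 - a / l)\<^sup>2 * (norm (x - z))\<^sup>2 - 2 * a * (1 - a / l) * ((x - z) \<bullet> (G - g z))
        + a\<^sup>2 * (norm (G - g z))\<^sup>2"
  proof -
    have "(norm (b *\<^sub>R v - a *\<^sub>R w))\<^sup>2 = b\<^sup>2 * (norm v)\<^sup>2 - 2 * a * b * (v \<bullet> w) + a\<^sup>2 * (norm w)\<^sup>2" for b and v w :: 'a
      unfolding power2_norm_eq_inner by (simp add: algebra_simps inner_commute power2_eq_square)
    then show ?thesis by blast
  qed
  finally have "(norm (y - z))\<^sup>2 / (2 * l) \<le> ((1 - a / l)\<^sup>2 * (norm (x - z))\<^sup>2 - 2 * a * (1 - a / l) * ((x - z) \<bullet> (G - g z))
        + a\<^sup>2 * (norm (G - g z))\<^sup>2) / (2 * l)"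
    using l_pos by (intro divide_right_mono) auto
  moreover have "((1 - a / l)\<^sup>2 * X - Y + W) / (2 * l) - X / (2 * l) = (((1 - a / l)\<^sup>2 - 1) * X - Y + W) / (2 * l)"
    for X Y W by (simp add: diff_divide_distrib[symmetric] left_diff_distrib)
  ultimately show ?thesis
    using moreau_env_le_prox[of y x] unfolding moreau_env_eq[of x] y_def[symmetric] z_def[symmetric]
    by (smt (verit))
qed

section \<open>Gaussian smoothing\<close>

lemma borel_measurable_vec_nth [measurable]: "(\<lambda>x::real^'n. x $ i) \<in> borel_measurable borel"
  by (intro borel_measurable_continuous_onI continuous_intros)

text \<open>Fubini: \<open>lborel\<close> is the image of a product of one-dimensional Lebesgue
  measures under assembling a vector from its coordinates.\<close>

lemma has_bochner_integral_lborel_prod: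
  fixes f :: "'a::euclidean_space \<Rightarrow> real \<Rightarrow> real"
  assumes f: "\<And>b. b \<in> Basis \<Longrightarrow> has_bochner_integral lborel (f b) (I b)"
  shows "has_bochner_integral lborel (\<lambda>x. \<Prod>b\<in>Basis. f b (x \<bullet> b)) (\<Prod>b\<in>Basis. I b)"
proof -
  interpret product_sigma_finite "\<lambda>_::'a. lborel :: real measure" by standard
  have [measurable]: "f b \<in> borel_measurable borel" if "b \<in> Basis" for b
    using borel_measurable_has_bochner_integral[OF f[OF that]] by simp
  have "has_bochner_integral (\<Pi>\<^sub>M b\<in>(Basis :: 'a set). lborel) (\<lambda>x. \<Prod>b\<in>Basis. f b (x b)) (\<Prod>b\<in>Basis. I b)"
    using f by (simp add: has_bochner_integral_iff product_integrable_prod product_integral_prod)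
  moreover have "(\<Prod>b\<in>Basis. f b ((\<Sum>c\<in>Basis. x c *\<^sub>R c) \<bullet> b)) = (\<Prod>b\<in>Basis. f b (x b))" for x :: "'a \<Rightarrow> real"
    by (intro prod.cong refl) simp
  ultimately have "has_bochner_integral (distr (\<Pi>\<^sub>M b\<in>(Basis :: 'a set). lborel) borel (\<lambda>f. \<Sum>b\<in>Basis. f b *\<^sub>R b))
      (\<lambda>x. \<Prod>b\<in>Basis. f b (x \<bullet> b)) (\<Prod>b\<in>Basis. I b)"
    by (simp add: has_bochner_integral_iff integrable_distr_eq integral_distr)
  then show ?thesis by (simp add: lborel_eq[symmetric])
qed

lemma prod_Basis_vec: "(\<Prod>b\<in>(Basis :: (real^'n) set). F b) = (\<Prod>i\<in>UNIV. F (axis i 1))"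
proof -
  have "(Basis :: (real^'n) set) = range (\<lambda>i. axis i 1)" by (auto simp: Basis_vec_def)
  then show ?thesis by (subst \<open>Basis = _\<close>, subst prod.reindex) (auto simp: inj_on_def axis_eq_axis)
qed

definition gdensity :: "real^'n \<Rightarrow> real" where
  "gdensity u = (\<Prod>i\<in>UNIV. std_normal_density (u $ i))"

lemma gdensity_measurable [measurable]: "gdensity \<in> borel_measurable borel"
  unfolding gdensity_def by measurable

lemma gdensity_nonneg [simp]: "0 \<le> gdensity u"
  by (simp add: gdensity_def prod_nonneg)

lemma std_gaussian_eq: "std_gaussian = density lborel (\<lambda>u. ennreal (gdensity u))"
  by (simp add: std_gaussian_def gdensity_def)

lemma sets_std_gaussian [simp, measurable_cong]: "sets std_gaussian = sets borel"
  by (simp add: std_gaussian_def)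

lemma space_std_gaussian [simp]: "space std_gaussian = UNIV"
  by (simp add: std_gaussian_def)

lemma has_bochner_integral_std_gaussian_prod:
  fixes f :: "'n::finite \<Rightarrow> real \<Rightarrow> real"
  assumes [measurable]: "\<And>i. f i \<in> borel_measurable borel"
    and f: "\<And>i. has_bochner_integral lborel (\<lambda>x. std_normal_density x * f i x) (I i)"
  shows "has_bochner_integral std_gaussian (\<lambda>u. \<Prod>i\<in>UNIV. f i (u $ i)) (\<Prod>i\<in>UNIV. I i)"
proof -
  have "has_bochner_integral lborel
      (\<lambda>x::real^'n. \<Prod>b\<in>Basis. (\<lambda>y. std_normal_density y * f (axis_index b) y) (x \<bullet> b))
      (\<Prod>b\<in>(Basis :: (real^'n) set). I (axis_index b))"
    using f by (intro has_bochner_integral_lborel_prod) auto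
  then have "has_bochner_integral lborel (\<lambda>u::real^'n. gdensity u *\<^sub>R (\<Prod>i\<in>UNIV. f i (u $ i))) (\<Prod>i\<in>UNIV. I i)"
    by (simp add: prod_Basis_vec gdensity_def prod.distrib inner_axis)
  then show ?thesis
    unfolding std_gaussian_eq by (intro has_bochner_integral_density) auto
qed

lemma std_normal_moments:
  "has_bochner_integral lborel (\<lambda>x. std_normal_density x * x ^ 0) 1"
  "has_bochner_integral lborel (\<lambda>x. std_normal_density x * x ^ 1) 0"
  "has_bochner_integral lborel (\<lambda>x. std_normal_density x * x ^ 2) 1"
  "has_bochner_integral lborel (\<lambda>x. std_normal_density x * x ^ 4) 3"
proof -
  \<comment> \<open>Even moments are (2 k)! / (2^k k!); this is k = 2.\<close>
  have "fact 4 / (2\<^sup>2 * fact 2) = (3 :: real)" by (simp add: fact_numeral)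
  then show "has_bochner_integral lborel (\<lambda>x. std_normal_density x * x ^ 0) 1"
    "has_bochner_integral lborel (\<lambda>x. std_normal_density x * x ^ 1) 0"
    "has_bochner_integral lborel (\<lambda>x. std_normal_density x * x ^ 2) 1"
    "has_bochner_integral lborel (\<lambda>x. std_normal_density x * x ^ 4) 3"
    using std_normal_moment_even[of 0] std_normal_moment_odd[of 0] std_normal_moment_even[of 1]
      std_normal_moment_even[of 2] by (simp_all add: fact_numeral)
qed

lemma prod_if_singleton:
  fixes i j :: "'n::finite"
  shows "i \<noteq> j \<Longrightarrow> (\<Prod>k\<in>UNIV. F k (if k = i \<or> k = j then a else b)) = F i a * F j a * (\<Prod>k\<in>UNIV - {i, j}. F k b)"
    and "(\<Prod>k\<in>UNIV. F k (if k = i then a else b)) = F i a * (\<Prod>k\<in>UNIV - {i}. F k b)"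
proof -
  assume "i \<noteq> j"
  have "(\<Prod>k\<in>UNIV. F k (if k = i \<or> k = j then a else b))
      = F i a * (\<Prod>k\<in>UNIV - {i}. F k (if k = i \<or> k = j then a else b))"
    by (subst prod.remove[of _ i]) auto
  also have "(\<Prod>k\<in>UNIV - {i}. F k (if k = i \<or> k = j then a else b))
      = F j a * (\<Prod>k\<in>UNIV - {i} - {j}. F k (if k = i \<or> k = j then a else b))"
    using \<open>i \<noteq> j\<close> by (subst prod.remove[of _ j]) auto
  also have "(\<Prod>k\<in>UNIV - {i} - {j}. F k (if k = i \<or> k = j then a else b)) = (\<Prod>k\<in>UNIV - {i, j}. F k b)"
    by (intro prod.cong) auto
  finally show "(\<Prod>k\<in>UNIV. F k (if k = i \<or> k = j then a else b)) = F i a * F j a * (\<Prod>k\<in>UNIV - {i, j}. F k b)"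
    by (simp add: mult.assoc)
next
  show "(\<Prod>k\<in>UNIV. F k (if k = i then a else b)) = F i a * (\<Prod>k\<in>UNIV - {i}. F k b)"
    by (subst prod.remove[of _ i]) auto
qed

text \<open>Distinct coordinates are independent and give a product of moments; equal ones merge
  into the power 2 q. The case q = 1 yields the covariance, q = 2 the fourth moment of the
  norm.\<close>

lemma std_gaussian_monomial:
  fixes i j :: "'n::finite"
  assumes q: "has_bochner_integral lborel (\<lambda>x. std_normal_density x * x ^ q) a"
    and q2: "has_bochner_integral lborel (\<lambda>x. std_normal_density x * x ^ (2 * q)) b"
  shows "has_bochner_integral std_gaussian (\<lambda>u::real^'n. (u $ i) ^ q * (u $ j) ^ q) (if i = j then b else a\<^sup>2)"
proof (cases "i = j")
  case True
  have "has_bochner_integral std_gaussian (\<lambda>u::real^'n. \<Prod>k\<in>UNIV. (u $ k) ^ (if k = i then 2 * q else 0))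
      (\<Prod>k\<in>UNIV. if k = i then b else 1)"
    using q2 std_normal_moments(1) by (intro has_bochner_integral_std_gaussian_prod) auto
  then show ?thesis
    using True unfolding prod_if_singleton(2)[of "\<lambda>k y. (_ $ k) ^ y"]
    by (simp add: mult_2 power_add)
next
  case False
  have "has_bochner_integral std_gaussian (\<lambda>u::real^'n. \<Prod>k\<in>UNIV. (u $ k) ^ (if k = i \<or> k = j then q else 0))
      (\<Prod>k\<in>UNIV. if k = i \<or> k = j then a else 1)"
    using q std_normal_moments(1) by (intro has_bochner_integral_std_gaussian_prod) auto
  then show ?thesis
    using False unfolding prod_if_singleton(1)[OF False, of "\<lambda>k y. (_ $ k) ^ y"] 
      prod_if_singleton(1)[OF False, of "\<lambda>k y. y"]
    by (simp add: power2_eq_square)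
qed

lemma prob_space_std_gaussian: "prob_space (std_gaussian :: (real^'n) measure)"
proof -
  have "has_bochner_integral std_gaussian (\<lambda>u::real^'n. \<Prod>k\<in>UNIV. (u $ k) ^ 0) (\<Prod>k\<in>(UNIV :: 'n set). 1)"
    using std_normal_moments(1) by (intro has_bochner_integral_std_gaussian_prod) auto
  then have "integrable (std_gaussian :: (real^'n) measure) (\<lambda>_. 1 :: real)"
    "measure (std_gaussian :: (real^'n) measure) UNIV = 1"
    by (simp_all add: has_bochner_integral_iff)
  then have "emeasure (std_gaussian :: (real^'n) measure) UNIV = 1"
    using nn_integral_eq_integral[of "std_gaussian :: (real^'n) measure" "\<lambda>_. 1"] by simp
  then show ?thesis by (intro prob_spaceI) simp
qed

text \<open>In the expansion of |u|^4 into terms u_i^2 u_j^2, the n diagonal ones give 3 each and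
  the n (n - 1) others give 1: the source of n^2 + 2 n.\<close>

lemma std_gaussian_norm_4:
  "has_bochner_integral std_gaussian (\<lambda>u::real^'n. (norm u) ^ 4) ((real CARD('n))\<^sup>2 + 2 * real CARD('n))"
proof -
  have "has_bochner_integral std_gaussian (\<lambda>u::real^'n. \<Sum>i\<in>UNIV. \<Sum>j\<in>UNIV. (u $ i)\<^sup>2 * (u $ j)\<^sup>2)
      (\<Sum>i\<in>(UNIV :: 'n set). \<Sum>j\<in>(UNIV :: 'n set). if i = j then 3 else 1\<^sup>2)"
    by (intro has_bochner_integral_sum std_gaussian_monomial) (use std_normal_moments(3,4) in auto)
  moreover have "(\<Sum>i\<in>UNIV. \<Sum>j\<in>UNIV. (u $ i)\<^sup>2 * (u $ j)\<^sup>2) = (norm u) ^ 4" for u :: "real^'n"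
  proof -
    have "(norm u)\<^sup>2 = (\<Sum>i\<in>UNIV. (u $ i)\<^sup>2)"
      unfolding power2_norm_eq_inner inner_vec_def by (simp add: power2_eq_square)
    moreover have "(norm u) ^ 4 = (norm u)\<^sup>2 * (norm u)\<^sup>2" by (simp add: power2_eq_square power4_eq_xxxx)
    ultimately show ?thesis by (simp add: sum_product)
  qed
  moreover have "(\<Sum>i\<in>(UNIV :: 'n set). \<Sum>j\<in>(UNIV :: 'n set). if i = j then 3 else 1\<^sup>2)
      = (real CARD('n))\<^sup>2 + 2 * real CARD('n)"
  proof -
    have "(\<Sum>j\<in>(UNIV :: 'n set). if i = j then 3 else 1\<^sup>2) = 2 + real CARD('n)" for i :: 'n
    proof -
      have "(\<Sum>j\<in>(UNIV :: 'n set). if i = j then 3 else 1\<^sup>2) = (\<Sum>j\<in>(UNIV :: 'n set). (if i = j then 2 else 0) + (1::real))"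
        by (intro sum.cong) auto
      then show ?thesis by (simp add: sum.distrib)
    qed
    then show ?thesis by (simp add: power2_eq_square algebra_simps)
  qed
  ultimately show ?thesis by simp
qed

lemma std_gaussian_inner_square:
  "has_bochner_integral std_gaussian (\<lambda>u::real^'n. (u \<bullet> v)\<^sup>2) ((norm v)\<^sup>2)"
proof -
  have "has_bochner_integral std_gaussian (\<lambda>u::real^'n. \<Sum>i\<in>UNIV. \<Sum>j\<in>UNIV. ((u $ i) ^ 1 * (u $ j) ^ 1) * (v $ i * v $ j))
      (\<Sum>i\<in>(UNIV :: 'n set). \<Sum>j\<in>(UNIV :: 'n set). (if i = j then 1 else 0\<^sup>2) * (v $ i * v $ j))"
    by (intro has_bochner_integral_sum has_bochner_integral_mult_left std_gaussian_monomial) (use std_normal_moments(2,3) in auto)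
  moreover have "(\<Sum>i\<in>UNIV. \<Sum>j\<in>UNIV. ((u $ i) ^ 1 * (u $ j) ^ 1) * (v $ i * v $ j)) = (u \<bullet> v)\<^sup>2" for u :: "real^'n"
    by (simp add: inner_vec_def power2_eq_square sum_product mult_ac)
  moreover have "(\<Sum>i\<in>(UNIV :: 'n set). \<Sum>j\<in>(UNIV :: 'n set). (if i = j then 1 else 0\<^sup>2) * (v $ i * v $ j)) = (norm v)\<^sup>2"
    by (simp add: power2_norm_eq_inner inner_vec_def if_distrib[of "\<lambda>x. x * _"] cong: if_cong)
  ultimately show ?thesis by simp
qed

lemma std_gaussian_inner: "has_bochner_integral std_gaussian (\<lambda>u::real^'n. u \<bullet> v) 0"
proof -
  have coord: "has_bochner_integral std_gaussian (\<lambda>u::real^'n. u $ i) 0" for i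
  proof -
    have "has_bochner_integral std_gaussian (\<lambda>u::real^'n. \<Prod>k\<in>UNIV. (u $ k) ^ (if k = i then 1 else 0))
        (\<Prod>k\<in>UNIV. if k = i then 0 else 1)"
      using std_normal_moments(1,2) by (intro has_bochner_integral_std_gaussian_prod) auto
    then show ?thesis
      unfolding prod_if_singleton(2)[of "\<lambda>k y. (_ $ k) ^ y"] by (simp add: prod_zero)
  qed
  have "has_bochner_integral std_gaussian (\<lambda>u::real^'n. \<Sum>i\<in>UNIV. u $ i * v $ i) (\<Sum>i\<in>(UNIV :: 'n set). 0 * v $ i)"
    by (intro has_bochner_integral_sum has_bochner_integral_mult_left coord)
  then show ?thesis by (simp add: inner_vec_def)
qed

section \<open>Translation of the Gaussian as a change of density\<close>

definition cm_density :: "real^'n \<Rightarrow> real^'n \<Rightarrow> real" where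
  "cm_density v u = exp (u \<bullet> v - (norm v)\<^sup>2 / 2)"

lemma cm_density_measurable [measurable]: "cm_density v \<in> borel_measurable borel"
  unfolding cm_density_def by measurable

text \<open>Expanding the shifted square in the exponent, coordinate by coordinate. So
  \<open>cm_density v\<close> is the density of the Gaussian with mean \<open>v\<close> relative to
  the centred one.\<close>

lemma gdensity_shift: "gdensity (u - v) = gdensity u * cm_density v u"
proof -
  have *: "std_normal_density (x - a) = std_normal_density x * exp (x * a - a * a / 2)" for x a :: real
    by (simp add: std_normal_density_def mult_exp_exp power2_eq_square field_simps)
  have "(norm v)\<^sup>2 / 2 = (\<Sum>i\<in>UNIV. v $ i * v $ i / 2)"
    by (simp add: power2_norm_eq_inner inner_vec_def sum_divide_distrib)
  then show ?thesis
    by (simp add: gdensity_def cm_density_def * prod.distrib exp_sum[symmetric] inner_vec_def sum_subtractf)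
qed

lemma distr_std_gaussian_shift:
  fixes v :: "real^'n"
  shows "distr std_gaussian borel (\<lambda>u. u + v) = density std_gaussian (\<lambda>u. ennreal (cm_density v u))"
proof (rule measure_eqI)
  fix A assume "A \<in> sets (distr std_gaussian borel (\<lambda>u. u + v))"
  then have [measurable]: "A \<in> sets borel" by simp
  have "emeasure (distr std_gaussian borel (\<lambda>u. u + v)) A = (\<integral>\<^sup>+u. indicator A u \<partial>distr std_gaussian borel (\<lambda>u. u + v))"
    by simp
  also have "\<dots> = (\<integral>\<^sup>+u. ennreal (gdensity u) * indicator A (u + v) \<partial>lborel)"
    by (subst nn_integral_distr) (simp_all add: std_gaussian_eq nn_integral_density)
  also have "\<dots> = (\<integral>\<^sup>+u. ennreal (gdensity ((v + u) - v)) * indicator A (v + u) \<partial>lborel)"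
    by (simp add: add.commute)
  also have "\<dots> = (\<integral>\<^sup>+u. ennreal (gdensity (u - v)) * indicator A u \<partial>distr lborel borel ((+) v))"
    by (subst nn_integral_distr) simp_all
  also have "\<dots> = (\<integral>\<^sup>+u. ennreal (gdensity u) * (ennreal (cm_density v u) * indicator A u) \<partial>lborel)"
    by (simp add: lborel_distr_plus gdensity_shift ennreal_mult cm_density_def mult.assoc)
  also have "\<dots> = emeasure (density std_gaussian (\<lambda>u. ennreal (cm_density v u))) A"
    by (simp add: emeasure_density std_gaussian_eq nn_integral_density)
  finally show "emeasure (distr std_gaussian borel (\<lambda>u. u + v)) A
      = emeasure (density std_gaussian (\<lambda>u. ennreal (cm_density v u))) A" .
qed simp

text \<open>The translation leaves the argument of \<open>G\<close> and enters a weight that is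
  smooth in \<open>v\<close>, so the dependence on \<open>v\<close> can be expanded without
  differentiating \<open>G\<close>.\<close>

lemma has_bochner_integral_std_gaussian_shift:
  fixes v :: "real^'n" and G :: "real^'n \<Rightarrow> real"
  assumes [measurable]: "G \<in> borel_measurable borel"
    and G: "has_bochner_integral std_gaussian (\<lambda>u. G (u + v)) a"
  shows "has_bochner_integral std_gaussian (\<lambda>u. cm_density v u * G u) a"
proof -
  have "has_bochner_integral (distr std_gaussian borel (\<lambda>u. u + v)) G a"
    using G by (simp add: has_bochner_integral_iff integrable_distr_eq integral_distr)
  then have "has_bochner_integral (density std_gaussian (\<lambda>u. ennreal (cm_density v u))) G a"
    by (simp add: distr_std_gaussian_shift)
  then show ?thesis
    by (simp add: has_bochner_integral_iff integrable_real_density integral_real_density cm_density_def)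
qed

text \<open>With b = |v|^2, the mean square of the first-order remainder of the density is exactly
  exp b - 1 - b, which is at most b^2 for b \<le> 1.\<close>

lemma cm_density_remainder:
  fixes v :: "real^'n"
  assumes "norm v \<le> 1"
  shows "integrable std_gaussian (\<lambda>u. (cm_density v u - 1 - u \<bullet> v)\<^sup>2)"
    and "(\<integral>u. (cm_density v u - 1 - u \<bullet> v)\<^sup>2 \<partial>std_gaussian) \<le> (norm v) ^ 4"
proof -
  interpret prob_space "std_gaussian :: (real^'n) measure" by (rule prob_space_std_gaussian)
  define b where "b = (norm v)\<^sup>2"
  have one: "has_bochner_integral (std_gaussian :: (real^'n) measure) (\<lambda>_. 1 :: real) 1"
    by (simp add: has_bochner_integral_iff prob_space[simplified])
  have w: "has_bochner_integral std_gaussian (cm_density x) 1" for x :: "real^'n"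
    using has_bochner_integral_std_gaussian_shift[of "\<lambda>_. 1" x 1] one by simp
  \<comment> \<open>Squaring doubles the shift; exp b repairs the normalisation, as |2 v|^2 / 2 = 2
    b while squaring produces only b.\<close>
  have "(cm_density v u)\<^sup>2 = exp b * cm_density (2 *\<^sub>R v) u" for u
    unfolding cm_density_def power2_eq_square mult_exp_exp
    by (simp add: b_def power2_eq_square)
  then have w2: "has_bochner_integral std_gaussian (\<lambda>u. (cm_density v u)\<^sup>2) (exp b * 1)"
    using has_bochner_integral_mult_right[OF w, of "exp b"] by simp
  \<comment> \<open>The mixed moment is computed by undoing the shift: the weighted mean of u . v is
    the plain mean of (u + v) . v.\<close>
  have "has_bochner_integral std_gaussian (\<lambda>u. u \<bullet> v + b * 1) (0 + b * 1)"
    by (intro has_bochner_integral_add std_gaussian_inner has_bochner_integral_mult_right one)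
  then have "has_bochner_integral std_gaussian (\<lambda>u. (u + v) \<bullet> v) b"
    by (simp add: b_def inner_add_left power2_norm_eq_inner)
  then have wa: "has_bochner_integral std_gaussian (\<lambda>u. cm_density v u * (u \<bullet> v)) b"
    by (intro has_bochner_integral_std_gaussian_shift) auto
  have "has_bochner_integral std_gaussian
      (\<lambda>u. (cm_density v u)\<^sup>2 + 1 + (u \<bullet> v)\<^sup>2 - 2 * cm_density v u - 2 * (cm_density v u * (u \<bullet> v)) + 2 * (u \<bullet> v))
      (exp b * 1 + 1 + b - 2 * 1 - 2 * b + 2 * 0)"
    unfolding b_def
    by (intro has_bochner_integral_add has_bochner_integral_diff has_bochner_integral_mult_right w one
        w2[unfolded b_def] wa[unfolded b_def] std_gaussian_inner std_gaussian_inner_square)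
  moreover have "(cm_density v u)\<^sup>2 + 1 + (u \<bullet> v)\<^sup>2 - 2 * cm_density v u - 2 * (cm_density v u * (u \<bullet> v)) + 2 * (u \<bullet> v)
      = (cm_density v u - 1 - u \<bullet> v)\<^sup>2" for u
    by (simp add: power2_eq_square algebra_simps)
  ultimately have main: "has_bochner_integral std_gaussian (\<lambda>u. (cm_density v u - 1 - u \<bullet> v)\<^sup>2) (exp b - 1 - b)"
    by simp
  then show "integrable std_gaussian (\<lambda>u. (cm_density v u - 1 - u \<bullet> v)\<^sup>2)"
    by (simp add: has_bochner_integral_iff)
  have "exp b \<le> 1 + b + b\<^sup>2"
    using assms by (intro exp_bound) (auto simp: b_def power_le_one)
  then show "(\<integral>u. (cm_density v u - 1 - u \<bullet> v)\<^sup>2 \<partial>std_gaussian) \<le> (norm v) ^ 4"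
    using main by (simp add: has_bochner_integral_iff b_def power4_eq_xxxx power2_eq_square)
qed

lemma integrable_power_le:
  fixes X :: "'a \<Rightarrow> real"
  assumes "finite_measure M" "X \<in> borel_measurable M" "integrable M (\<lambda>x. \<bar>X x\<bar> ^ n)" "m \<le> n"
  shows "integrable M (\<lambda>x. \<bar>X x\<bar> ^ m)"
proof (rule Bochner_Integration.integrable_bound)
  interpret finite_measure M by fact
  show "integrable M (\<lambda>x. 1 + \<bar>X x\<bar> ^ n)" using assms by auto
  have "a ^ m \<le> 1 + a ^ n" if "0 \<le> a" for a :: real
  proof (cases "a \<le> 1")
    case True then show ?thesis using that power_le_one[of a m] zero_le_power[of a n] by linarith
  next
    case False then show ?thesis using power_increasing[OF \<open>m \<le> n\<close>, of a] by linarith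
  qed
  then show "AE x in M. norm (\<bar>X x\<bar> ^ m) \<le> norm (1 + \<bar>X x\<bar> ^ n)" by (auto intro!: AE_I2)
qed (use assms in auto)

lemma integrable_std_gaussian_norm_power:
  assumes "m \<le> 4" shows "integrable std_gaussian (\<lambda>u::real^'n. (norm u) ^ m)"
  using integrable_power_le[OF prob_space.finite_measure[OF prob_space_std_gaussian], of "norm :: real^'n \<Rightarrow> real" 4 m]
    std_gaussian_norm_4[where 'n = 'n] assms by (simp add: has_bochner_integral_iff)

text \<open>Nonnegative variance of |u|^2. Bounding by the fourth moment lets the smoothed gradient
  and the estimator share one constant.\<close>

lemma std_gaussian_norm_2_le:
  "(\<integral>u. (norm (u::real^'n))\<^sup>2 \<partial>std_gaussian)\<^sup>2 \<le> (real CARD('n))\<^sup>2 + 2 * real CARD('n)"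
proof -
  interpret prob_space "std_gaussian :: (real^'n) measure" by (rule prob_space_std_gaussian)
  have sq: "((norm u)\<^sup>2)\<^sup>2 = (norm u) ^ 4" for u :: "real^'n" by simp
  have "0 \<le> variance (\<lambda>u. (norm u)\<^sup>2)" by simp
  also have "\<dots> = (\<integral>u. ((norm (u::real^'n))\<^sup>2)\<^sup>2 \<partial>std_gaussian) - (\<integral>u. (norm (u::real^'n))\<^sup>2 \<partial>std_gaussian)\<^sup>2"
    by (rule variance_eq[of "\<lambda>u. (norm u)\<^sup>2"]) (unfold sq, auto intro: integrable_std_gaussian_norm_power)
  finally show ?thesis
    using std_gaussian_norm_4[where 'n = 'n] unfolding sq by (simp add: has_bochner_integral_iff)
qed

section \<open>Gradient and weak convexity of the smoothed function\<close>

lemma weakly_convex_subgrad: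
  assumes wc: "weakly_convex \<rho> f" and gd: "GDERIV f x :> D"
  shows "f x + D \<bullet> (y - x) - \<rho> / 2 * (norm (y - x))\<^sup>2 \<le> f y"
proof -
  define c where "c = \<rho> / 2 * (norm (y - x))\<^sup>2"
  have "(f (x + s *\<^sub>R (y - x)) - f x) / s \<le> f y - f x + (1 - s) * c" if "s \<in> {0<..<1}" for s
  proof -
    have "f (s *\<^sub>R y + (1 - s) *\<^sub>R x) \<le> s * f y + (1 - s) * f x + s * (1 - s) * \<rho> / 2 * (norm (y - x))\<^sup>2"
      using wc that unfolding weakly_convex_def by simp
    also have "s *\<^sub>R y + (1 - s) *\<^sub>R x = x + s *\<^sub>R (y - x)" by (simp add: algebra_simps)
    finally have "f (x + s *\<^sub>R (y - x)) - f x \<le> (f y - f x + (1 - s) * c) * s"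
      by (simp add: c_def algebra_simps)
    then show ?thesis using that by (simp add: pos_divide_le_eq)
  qed
  then have ev: "\<forall>\<^sub>F s in at_right 0. (f (x + s *\<^sub>R (y - x)) - f x) / s \<le> f y - f x + (1 - s) * c"
    by (intro eventually_at_rightI[of 0 1]) auto
  have lim: "((\<lambda>s. f y - f x + (1 - s) * c) \<longlongrightarrow> f y - f x + (1 - 0) * c) (at_right 0)"
    by (intro tendsto_intros)
  have "D \<bullet> (y - x) \<le> f y - f x + (1 - 0) * c"
    by (rule tendsto_le[OF _ lim GDERIV_quotient_tendsto[OF gd] ev]) simp
  then show ?thesis by (simp add: c_def)
qed

text \<open>The mean of the two-point estimator, with \<open>f\<close> in place of the random
  function. For L-Lipschitz \<open>f\<close>, subtracting \<open>f x\<close> leaves the integral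
  unchanged, as \<open>u\<close> is centred, but bounds the integrand by L |u|^2 whatever \<mu>
  is.\<close>

definition smoothing_grad :: "real \<Rightarrow> (real^'n \<Rightarrow> real) \<Rightarrow> real^'n \<Rightarrow> real^'n" where
  "smoothing_grad \<mu> f x = (\<integral>u. (inverse \<mu> * (f (x + \<mu> *\<^sub>R u) - f x)) *\<^sub>R u \<partial>std_gaussian)"

context
  fixes f :: "real^'n \<Rightarrow> real" and L \<mu> :: real
  assumes lip: "L-lipschitz_on UNIV f" and mu: "0 < \<mu>"
begin

interpretation prob_space "std_gaussian :: (real^'n) measure" by (rule prob_space_std_gaussian)

lemma smoothing_measurable [measurable]: "f \<in> borel_measurable borel"
  using lipschitz_on_continuous_on[OF lip] by (rule borel_measurable_continuous_onI)

lemma smoothing_increment: "\<bar>f (x + \<mu> *\<^sub>R u) - f x\<bar> \<le> L * \<mu> * norm u"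
  using lipschitz_onD[OF lip, of "x + \<mu> *\<^sub>R u" x] mu by (simp add: dist_norm)

lemma integrable_smoothing: "integrable std_gaussian (\<lambda>u. f (x + \<mu> *\<^sub>R u))"
proof (rule Bochner_Integration.integrable_bound)
  show "integrable std_gaussian (\<lambda>u::real^'n. \<bar>f x\<bar> + L * \<mu> * norm u ^ 1)"
    by (intro Bochner_Integration.integrable_add integrable_mult_right integrable_std_gaussian_norm_power) auto
  show "AE u in std_gaussian. norm (f (x + \<mu> *\<^sub>R u)) \<le> norm (\<bar>f x\<bar> + L * \<mu> * norm u ^ 1)"
  proof (rule AE_I2)
    fix u show "norm (f (x + \<mu> *\<^sub>R u)) \<le> norm (\<bar>f x\<bar> + L * \<mu> * norm u ^ 1)"
      using smoothing_increment[of x u] by simp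
  qed
qed simp

lemma integrable_smoothing_grad:
  "integrable std_gaussian (\<lambda>u. (inverse \<mu> * (f (x + \<mu> *\<^sub>R u) - f x)) *\<^sub>R u)"
  and norm_smoothing_grad_le: "norm ((inverse \<mu> * (f (x + \<mu> *\<^sub>R u) - f x)) *\<^sub>R u) \<le> L * (norm u)\<^sup>2"
proof -
  show le: "norm ((inverse \<mu> * (f (x + \<mu> *\<^sub>R u) - f x)) *\<^sub>R u) \<le> L * (norm u)\<^sup>2" for u
  proof -
    have "inverse \<mu> * \<bar>f (x + \<mu> *\<^sub>R u) - f x\<bar> \<le> inverse \<mu> * (L * \<mu> * norm u)"
      using mu by (intro mult_left_mono smoothing_increment) auto
    also have "\<dots> = L * norm u" using mu by simp
    finally have "inverse \<mu> * \<bar>f (x + \<mu> *\<^sub>R u) - f x\<bar> * norm u \<le> L * norm u * norm u"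
      by (rule mult_right_mono) simp
    moreover have "norm ((inverse \<mu> * (f (x + \<mu> *\<^sub>R u) - f x)) *\<^sub>R u) = inverse \<mu> * \<bar>f (x + \<mu> *\<^sub>R u) - f x\<bar> * norm u"
      using mu by (simp add: abs_mult)
    ultimately show ?thesis by (simp only: power2_eq_square mult.assoc)
  qed
  show "integrable std_gaussian (\<lambda>u. (inverse \<mu> * (f (x + \<mu> *\<^sub>R u) - f x)) *\<^sub>R u)"
  proof (rule Bochner_Integration.integrable_bound)
    show "integrable std_gaussian (\<lambda>u::real^'n. L * (norm u)\<^sup>2)"
      by (intro integrable_mult_right integrable_std_gaussian_norm_power) auto
    show "AE u in std_gaussian. norm ((inverse \<mu> * (f (x + \<mu> *\<^sub>R u) - f x)) *\<^sub>R u) \<le> norm (L * (norm u)\<^sup>2)"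
      by (intro AE_I2 order_trans[OF le]) (simp only: real_norm_def abs_ge_self)
  qed simp
qed

lemma smoothing_grad_bound: "(norm (smoothing_grad \<mu> f x))\<^sup>2 \<le> ((real CARD('n))\<^sup>2 + 2 * real CARD('n)) * L\<^sup>2"
proof -
  have "norm (smoothing_grad \<mu> f x) \<le> (\<integral>u. L * (norm (u::real^'n))\<^sup>2 \<partial>std_gaussian)"
    unfolding smoothing_grad_def
    by (rule Bochner_Integration.integral_norm_bound_integral[OF integrable_smoothing_grad _ norm_smoothing_grad_le])
       (intro integrable_mult_right integrable_std_gaussian_norm_power, simp)
  then have "norm (smoothing_grad \<mu> f x) \<le> L * (\<integral>u. (norm (u::real^'n))\<^sup>2 \<partial>std_gaussian)" by simp
  then have "(norm (smoothing_grad \<mu> f x))\<^sup>2 \<le> (L * (\<integral>u. (norm (u::real^'n))\<^sup>2 \<partial>std_gaussian))\<^sup>2"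
    by (intro power_mono) auto
  also have "\<dots> = L\<^sup>2 * (\<integral>u. (norm (u::real^'n))\<^sup>2 \<partial>std_gaussian)\<^sup>2" by (simp add: power_mult_distrib)
  also have "\<dots> \<le> L\<^sup>2 * ((real CARD('n))\<^sup>2 + 2 * real CARD('n))"
    by (intro mult_left_mono std_gaussian_norm_2_le) auto
  finally show ?thesis by (simp add: mult.commute)
qed

text \<open>By the Cameron--Martin formula the remainder of the first-order expansion is
  \<open>\<integral> (f (x + \<mu> u) - f x) (w u - 1 - u \<bullet> v) \<partial>\<gamma>\<close>, where \<open>w\<close> is the density of the shift by \<open>v\<close>.\<close>

lemma smoothing_expansion:
  assumes v: "norm v \<le> 1" "v \<noteq> 0"
  shows "\<bar>smoothing \<mu> f (x + \<mu> *\<^sub>R v) - smoothing \<mu> f x - smoothing_grad \<mu> f x \<bullet> (\<mu> *\<^sub>R v)\<bar>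
    \<le> ((L * \<mu>)\<^sup>2 * (\<integral>u. (norm (u::real^'n))\<^sup>2 \<partial>std_gaussian) + 1) / 2 * (norm v)\<^sup>2"
proof -
  define h where "h = (\<lambda>u. f (x + \<mu> *\<^sub>R u) - f x)"
  define q where "q u = cm_density v u - 1 - u \<bullet> v" for u
  have [measurable]: "h \<in> borel_measurable borel" "q \<in> borel_measurable borel" unfolding h_def q_def by measurable
  have h: "integrable std_gaussian h" unfolding h_def using integrable_smoothing by simp
  have hg: "has_bochner_integral std_gaussian (\<lambda>u. h u * (u \<bullet> v)) (smoothing_grad \<mu> f x \<bullet> (\<mu> *\<^sub>R v))"
  proof -
    have "has_bochner_integral std_gaussian (\<lambda>u. ((inverse \<mu> * h u) *\<^sub>R u) \<bullet> (\<mu> *\<^sub>R v)) (smoothing_grad \<mu> f x \<bullet> (\<mu> *\<^sub>R v))"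
      unfolding smoothing_grad_def h_def
      by (intro has_bochner_integral_inner_left has_bochner_integral_integrable integrable_smoothing_grad)
    moreover have "((inverse \<mu> * h u) *\<^sub>R u) \<bullet> (\<mu> *\<^sub>R v) = h u * (u \<bullet> v)" for u using mu by simp
    ultimately show ?thesis by (simp only:)
  qed
  have hw: "has_bochner_integral std_gaussian (\<lambda>u. cm_density v u * h u) (smoothing \<mu> f (x + \<mu> *\<^sub>R v) - f x)"
  proof (rule has_bochner_integral_std_gaussian_shift)
    have "h (u + v) = f ((x + \<mu> *\<^sub>R v) + \<mu> *\<^sub>R u) - f x" for u
      by (simp add: h_def algebra_simps)
    then show "has_bochner_integral std_gaussian (\<lambda>u. h (u + v)) (smoothing \<mu> f (x + \<mu> *\<^sub>R v) - f x)"
      using integrable_smoothing[of "x + \<mu> *\<^sub>R v"]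
      by (simp add: has_bochner_integral_iff smoothing_def prob_space[simplified])
  qed simp
  have h1: "has_bochner_integral std_gaussian h (smoothing \<mu> f x - f x)"
    using h integrable_smoothing[of x]
    by (simp add: has_bochner_integral_iff h_def smoothing_def prob_space[simplified])
  have "has_bochner_integral std_gaussian (\<lambda>u. cm_density v u * h u - h u - h u * (u \<bullet> v))
      ((smoothing \<mu> f (x + \<mu> *\<^sub>R v) - f x) - (smoothing \<mu> f x - f x) - smoothing_grad \<mu> f x \<bullet> (\<mu> *\<^sub>R v))"
    by (intro has_bochner_integral_diff hw h1 hg)
  then have main: "has_bochner_integral std_gaussian (\<lambda>u. h u * q u)
      (smoothing \<mu> f (x + \<mu> *\<^sub>R v) - smoothing \<mu> f x - smoothing_grad \<mu> f x \<bullet> (\<mu> *\<^sub>R v))"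
    by (simp add: q_def algebra_simps)
  define b where "b = (norm v)\<^sup>2"
  have b: "0 < b" using v by (simp add: b_def)
  define E where "E = (\<integral>u. (norm (u::real^'n))\<^sup>2 \<partial>std_gaussian)"
  have q: "integrable std_gaussian (\<lambda>u. (q u)\<^sup>2)" "(\<integral>u. (q u)\<^sup>2 \<partial>std_gaussian) \<le> b\<^sup>2"
    using cm_density_remainder[OF v(1)] by (simp_all add: q_def b_def)
  have int: "integrable std_gaussian (\<lambda>u. b / 2 * ((L * \<mu>)\<^sup>2 * (norm u)\<^sup>2) + 1 / (2 * b) * (q u)\<^sup>2)"
    by (intro Bochner_Integration.integrable_add integrable_mult_right integrable_std_gaussian_norm_power q) simp
  \<comment> \<open>Young's inequality with weight b = |v|^2: since the mean of q^2 is at most b^2,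
    both resulting terms are of order b.\<close>
  have "\<bar>h u * q u\<bar> \<le> b / 2 * ((L * \<mu>)\<^sup>2 * (norm u)\<^sup>2) + 1 / (2 * b) * (q u)\<^sup>2" for u
  proof -
    have "0 \<le> (b * \<bar>h u\<bar> - \<bar>q u\<bar>)\<^sup>2" by simp
    then have "2 * b * \<bar>h u * q u\<bar> \<le> b\<^sup>2 * (h u)\<^sup>2 + (q u)\<^sup>2"
      by (simp add: power2_diff power_mult_distrib abs_mult)
    then have "\<bar>h u * q u\<bar> \<le> (b\<^sup>2 * (h u)\<^sup>2 + (q u)\<^sup>2) / (2 * b)"
      using b by (simp add: pos_le_divide_eq mult_ac)
    also have "\<dots> = b / 2 * (h u)\<^sup>2 + 1 / (2 * b) * (q u)\<^sup>2"
      using b by (simp add: field_simps power2_eq_square)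
    also have "(h u)\<^sup>2 \<le> (L * \<mu>)\<^sup>2 * (norm u)\<^sup>2"
      using power_mono[OF smoothing_increment[of x u] abs_ge_zero, of 2] by (simp add: h_def power_mult_distrib)
    finally show ?thesis using b by simp
  qed
  then have "\<bar>\<integral>u. h u * q u \<partial>std_gaussian\<bar> \<le> (\<integral>u. b / 2 * ((L * \<mu>)\<^sup>2 * (norm u)\<^sup>2) + 1 / (2 * b) * (q u)\<^sup>2 \<partial>std_gaussian)"
    using Bochner_Integration.integral_norm_bound_integral[OF _ int, of "\<lambda>u. h u * q u"] main by (simp add: has_bochner_integral_iff)
  also have "\<dots> = b / 2 * ((L * \<mu>)\<^sup>2 * E) + 1 / (2 * b) * (\<integral>u. (q u)\<^sup>2 \<partial>std_gaussian)"
    unfolding E_def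
    by (subst Bochner_Integration.integral_add)
       (simp_all add: q integrable_std_gaussian_norm_power)
  also have "\<dots> \<le> b / 2 * ((L * \<mu>)\<^sup>2 * E) + 1 / (2 * b) * b\<^sup>2"
    using b by (intro add_left_mono mult_left_mono q) auto
  also have "\<dots> = ((L * \<mu>)\<^sup>2 * E + 1) / 2 * b" using b by (simp add: field_simps power2_eq_square)
  finally show ?thesis
    using main by (simp add: has_bochner_integral_iff b_def E_def)
qed

lemma GDERIV_smoothing: "GDERIV (smoothing \<mu> f) x :> smoothing_grad \<mu> f x"
proof -
  define K where "K = ((L * \<mu>)\<^sup>2 * (\<integral>u. (norm (u::real^'n))\<^sup>2 \<partial>std_gaussian) + 1) / 2 / \<mu>\<^sup>2"
  have bound: "\<bar>smoothing \<mu> f y - smoothing \<mu> f x - (y - x) \<bullet> smoothing_grad \<mu> f x\<bar> \<le> K * (norm (y - x))\<^sup>2"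
    if "dist y x < \<mu>" "y \<noteq> x" for y
  proof -
    \<comment> \<open>Increments are measured in units of \<mu>, hence the division by \<mu>^2 in
      \<open>K\<close>; distance below \<mu> gives the |v| \<le> 1 that the expansion asks
      for.\<close>
    define v where "v = (y - x) /\<^sub>R \<mu>"
    have v: "\<mu> *\<^sub>R v = y - x" "norm v = norm (y - x) / \<mu>" "norm v \<le> 1" "v \<noteq> 0"
      using mu that by (simp_all add: v_def dist_norm divide_inverse_commute[symmetric])
    show ?thesis
      using smoothing_expansion[OF v(3,4), of x] unfolding v(1,2)
      by (simp add: K_def power_divide inner_commute)
  qed
  show ?thesis unfolding gderiv_def has_derivative_at2
  proof (intro conjI bounded_linear_inner_left)
    have "((\<lambda>v. K * norm (v - x)) \<longlongrightarrow> K * norm (x - x)) (at x)" by (intro tendsto_intros)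
    then have lim: "((\<lambda>v. K * norm (v - x)) \<longlongrightarrow> 0) (at x)" by simp
    have "norm ((1 / norm (v - x)) *\<^sub>R (smoothing \<mu> f v - (smoothing \<mu> f x + (v - x) \<bullet> smoothing_grad \<mu> f x)))
        \<le> K * norm (v - x)" if "dist v x < \<mu>" "v \<noteq> x" for v
      using bound[OF that] that
      by (simp add: abs_mult divide_le_eq power2_eq_square mult.assoc diff_diff_eq)
    then show "((\<lambda>v. (1 / norm (v - x)) *\<^sub>R (smoothing \<mu> f v
        - (smoothing \<mu> f x + (v - x) \<bullet> smoothing_grad \<mu> f x))) \<longlongrightarrow> 0) (at x)"
      by (intro Lim_null_comparison[OF _ lim]) (use mu in \<open>auto simp: eventually_at\<close>)
  qed
qed

lemma weakly_convex_smoothing: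
  assumes wc: "weakly_convex \<rho> f"
  shows "weakly_convex \<rho> (smoothing \<mu> f)"
  unfolding weakly_convex_def
proof (intro allI ballI)
  fix x1 x2 :: "real^'n" and l :: real assume l: "l \<in> {0..1}"
  \<comment> \<open>Both points are translated by the same multiple of u, so their distance, and
    with it this defect, does not depend on u.\<close>
  define c where "c = l * (1 - l) * \<rho> / 2 * (norm (x1 - x2))\<^sup>2"
  have "smoothing \<mu> f (l *\<^sub>R x1 + (1 - l) *\<^sub>R x2)
      \<le> (\<integral>u. l * f (x1 + \<mu> *\<^sub>R u) + (1 - l) * f (x2 + \<mu> *\<^sub>R u) + c \<partial>std_gaussian)"
    unfolding smoothing_def
  proof (rule integral_mono)
    fix u
    have "l *\<^sub>R x1 + (1 - l) *\<^sub>R x2 + \<mu> *\<^sub>R u = l *\<^sub>R (x1 + \<mu> *\<^sub>R u) + (1 - l) *\<^sub>R (x2 + \<mu> *\<^sub>R u)"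
      by (simp add: algebra_simps)
    then show "f (l *\<^sub>R x1 + (1 - l) *\<^sub>R x2 + \<mu> *\<^sub>R u) \<le> l * f (x1 + \<mu> *\<^sub>R u) + (1 - l) * f (x2 + \<mu> *\<^sub>R u) + c"
      using wc[unfolded weakly_convex_def, rule_format, OF l, of "x1 + \<mu> *\<^sub>R u" "x2 + \<mu> *\<^sub>R u"] by (simp add: c_def)
  next
    show "integrable std_gaussian (\<lambda>u. l * f (x1 + \<mu> *\<^sub>R u) + (1 - l) * f (x2 + \<mu> *\<^sub>R u) + c)"
      by (intro Bochner_Integration.integrable_add integrable_mult_right integrable_smoothing) simp
  qed (rule integrable_smoothing)
  also have "\<dots> = l * smoothing \<mu> f x1 + (1 - l) * smoothing \<mu> f x2 + c"
    by (simp add: smoothing_def integrable_smoothing prob_space[simplified])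
  finally show "smoothing \<mu> f (l *\<^sub>R x1 + (1 - l) *\<^sub>R x2)
      \<le> l * smoothing \<mu> f x1 + (1 - l) * smoothing \<mu> f x2 + l * (1 - l) * \<rho> / 2 * (norm (x1 - x2))\<^sup>2"
    by (simp add: c_def)
qed

end

section \<open>Measurability and independence\<close>

lemma (in complete_measure) borel_measurable_AE_eq:
  assumes f: "f \<in> M \<rightarrow>\<^sub>M N" and ae: "AE x in M. f x = g x" and g: "\<And>x. x \<in> space M \<Longrightarrow> g x \<in> space N"
  shows "g \<in> M \<rightarrow>\<^sub>M N"
proof (rule measurableI)
  fix A assume A: "A \<in> sets N"
  show "g -` A \<inter> space M \<in> sets M"
  proof (rule in_sets_AE)
    show "f -` A \<inter> space M \<in> sets M" using measurable_sets[OF f A] .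
    show "AE x in M. x \<in> f -` A \<inter> space M \<longleftrightarrow> x \<in> g -` A \<inter> space M"
      using ae by eventually_elim auto
  qed auto
qed (rule g)

text \<open>Only \<open>f\<close> is assumed integrable; completeness makes \<open>g\<close>
  measurable. This transfers results on modified iterates to the original ones, whose measurability
  is not evident.\<close>

lemma (in complete_measure) integrable_AE_eq:
  fixes f g :: "'a \<Rightarrow> real"
  assumes f: "integrable M f" and ae: "AE x in M. f x = g x"
  shows "integrable M g" and "integral\<^sup>L M g = integral\<^sup>L M f"
proof -
  have g: "g \<in> borel_measurable M"
    by (rule borel_measurable_AE_eq[OF _ ae]) (use f in auto)
  show "integrable M g" using integrable_cong_AE[of f M g] f g ae by auto
  show "integral\<^sup>L M g = integral\<^sup>L M f" using integral_cong_AE[of f M g] f g ae by auto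
qed

text \<open>With y replaced by simple functions converging to y, only finitely many sections of
  \<open>F\<close> occur, each measurable in z; continuity in y passes to the limit.\<close>

lemma borel_measurable_caratheodory:
  fixes F :: "'a::{metric_space, second_countable_topology} \<Rightarrow> 'z \<Rightarrow> 'b::metric_space"
  assumes meas: "\<And>y. F y \<in> borel_measurable S"
    and cont: "\<And>z. z \<in> space S \<Longrightarrow> continuous_on UNIV (\<lambda>y. F y z)"
  shows "(\<lambda>(y, z). F y z) \<in> borel_measurable (borel \<Otimes>\<^sub>M S)"
proof -
  obtain s :: "nat \<Rightarrow> 'a \<Rightarrow> 'a" where s: "\<And>i. simple_function borel (s i)" "\<And>x. (\<lambda>i. s i x) \<longlonglongrightarrow> x"
    using borel_measurable_implies_sequence_metric[of "\<lambda>x. x" borel undefined] by auto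
  show ?thesis
  proof (rule borel_measurable_LIMSEQ_metric)
    show "(\<lambda>i. case yz of (y, z) \<Rightarrow> F (s i y) z) \<longlonglongrightarrow> (case yz of (y, z) \<Rightarrow> F y z)"
      if in_space: "yz \<in> space (borel \<Otimes>\<^sub>M S)" for yz
    proof -
      obtain y z where yz: "yz = (y, z)" "z \<in> space S" using in_space by (cases yz) (auto simp: space_pair_measure)
      have "isCont (\<lambda>y. F y z) y"
        using cont[OF yz(2)] by (simp add: continuous_on_eq_continuous_at)
      then show ?thesis using isCont_tendsto_compose[OF _ s(2)[of y]] yz by auto
    qed
    show "(\<lambda>(y, z). F (s i y) z) \<in> borel_measurable (borel \<Otimes>\<^sub>M S)" for i
    proof -
      have fin: "finite (range (s i))" using simple_functionD(1)[OF s(1)[of i]] by simp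
      have "s i -` {a} \<in> sets borel" for a
        using simple_functionD(2)[OF s(1)[of i], of "{a}"] by simp
      then have "s i \<in> borel \<rightarrow>\<^sub>M count_space (range (s i))"
        by (subst measurable_count_space_eq2[OF fin]) auto
      then have "(\<lambda>yz. s i (fst yz)) \<in> borel \<Otimes>\<^sub>M S \<rightarrow>\<^sub>M count_space (range (s i))"
        by (rule measurable_compose[OF measurable_fst])
      then have "(\<lambda>yz. F (s i (fst yz)) (snd yz)) \<in> borel_measurable (borel \<Otimes>\<^sub>M S)"
        by (rule measurable_compose_countable'[where f = "\<lambda>y yz. F y (snd yz)",
              OF measurable_compose[OF measurable_snd meas] _ countable_finite[OF fin]])
      then show ?thesis by (simp add: case_prod_beta')
    qed
  qed
qed

section \<open>Independence of variables of different types, and integration over one of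
  them\<close>

context prob_space
begin

lemma indep_rv_rv: "indep_rv M A X B Y \<Longrightarrow> X \<in> M \<rightarrow>\<^sub>M A" "indep_rv M A X B Y \<Longrightarrow> Y \<in> M \<rightarrow>\<^sub>M B"
  by (auto simp: indep_rv_def)

lemma indep_rvD:
  assumes "indep_rv M A X B Y" "E \<in> sets A" "D \<in> sets B"
  shows "prob ((X -` E \<inter> space M) \<inter> (Y -` D \<inter> space M)) = prob (X -` E \<inter> space M) * prob (Y -` D \<inter> space M)"
  using assms unfolding indep_rv_def by (intro indep_setD[of "{X -` E \<inter> space M |E. E \<in> sets A}"]) auto

lemma indep_rvI:
  assumes X: "X \<in> M \<rightarrow>\<^sub>M A" and Y: "Y \<in> M \<rightarrow>\<^sub>M B"
    and *: "\<And>E D. E \<in> sets A \<Longrightarrow> D \<in> sets B \<Longrightarrow>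
      prob ((X -` E \<inter> space M) \<inter> (Y -` D \<inter> space M)) = prob (X -` E \<inter> space M) * prob (Y -` D \<inter> space M)"
  shows "indep_rv M A X B Y"
  unfolding indep_rv_def indep_sets2_eq using measurable_sets[OF X] measurable_sets[OF Y] X Y * by auto

lemma indep_rv_compose:
  assumes ind: "indep_rv M A X B Y" and f: "f \<in> A \<rightarrow>\<^sub>M A'" and g: "g \<in> B \<rightarrow>\<^sub>M B'"
  shows "indep_rv M A' (\<lambda>w. f (X w)) B' (\<lambda>w. g (Y w))"
proof (rule indep_rvI)
  note X = indep_rv_rv(1)[OF ind] and Y = indep_rv_rv(2)[OF ind]
  show "(\<lambda>w. f (X w)) \<in> M \<rightarrow>\<^sub>M A'" "(\<lambda>w. g (Y w)) \<in> M \<rightarrow>\<^sub>M B'"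
    using measurable_compose[OF X f] measurable_compose[OF Y g] .
  fix E D assume E: "E \<in> sets A'" and D: "D \<in> sets B'"
  have "(\<lambda>w. f (X w)) -` E \<inter> space M = X -` (f -` E \<inter> space A) \<inter> space M"
    "(\<lambda>w. g (Y w)) -` D \<inter> space M = Y -` (g -` D \<inter> space B) \<inter> space M"
    using measurable_space[OF X] measurable_space[OF Y] by auto
  then show "prob (((\<lambda>w. f (X w)) -` E \<inter> space M) \<inter> ((\<lambda>w. g (Y w)) -` D \<inter> space M))
      = prob ((\<lambda>w. f (X w)) -` E \<inter> space M) * prob ((\<lambda>w. g (Y w)) -` D \<inter> space M)"
    using indep_rvD[OF ind measurable_sets[OF f E] measurable_sets[OF g D]] by simp
qed

lemma indep_rv_distr:
  assumes ind: "indep_rv M A X B Y"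
  shows "distr M A X \<Otimes>\<^sub>M distr M B Y = distr M (A \<Otimes>\<^sub>M B) (\<lambda>w. (X w, Y w))"
proof (rule pair_measure_eqI)
  note [measurable] = indep_rv_rv[OF ind]
  show "sigma_finite_measure (distr M A X)" "sigma_finite_measure (distr M B Y)"
    by (auto intro!: prob_space_imp_sigma_finite prob_space_distr)
  fix E D assume "E \<in> sets (distr M A X)" "D \<in> sets (distr M B Y)"
  then have [measurable]: "E \<in> sets A" "D \<in> sets B" by auto
  have "(\<lambda>w. (X w, Y w)) -` (E \<times> D) \<inter> space M = (X -` E \<inter> space M) \<inter> (Y -` D \<inter> space M)" by auto
  then show "emeasure (distr M A X) E * emeasure (distr M B Y) D
      = emeasure (distr M (A \<Otimes>\<^sub>M B) (\<lambda>w. (X w, Y w))) (E \<times> D)"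
    using indep_rvD[OF ind, of E D] by (simp add: emeasure_distr emeasure_eq_measure ennreal_mult)
qed (auto intro!: sets_pair_measure_cong)

text \<open>Both notions say that the joint law is the product of the marginals; this gives access
  to the product rule for real expectations.\<close>

lemma indep_rv_iff_indep_var: "indep_rv M A X B Y \<longleftrightarrow> indep_var A X B Y"
proof
  assume ind: "indep_rv M A X B Y"
  then show "indep_var A X B Y"
    unfolding indep_var_distribution_eq using indep_rv_distr[OF ind] indep_rv_rv[OF ind] by simp
next
  assume ind: "indep_var A X B Y"
  show "indep_rv M A X B Y"
  proof (rule indep_rvI)
    show "X \<in> M \<rightarrow>\<^sub>M A" "Y \<in> M \<rightarrow>\<^sub>M B" using indep_var_rv1[OF ind] indep_var_rv2[OF ind] .
    fix E D assume ED: "E \<in> sets A" "D \<in> sets B"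
    have eq: "(\<lambda>x. (X x, Y x)) -` (E \<times> D) \<inter> space M = (X -` E \<inter> space M) \<inter> (Y -` D \<inter> space M)" by auto
    show "prob ((X -` E \<inter> space M) \<inter> (Y -` D \<inter> space M))
        = prob (X -` E \<inter> space M) * prob (Y -` D \<inter> space M)"
      using indep_varD[OF ind ED] unfolding eq .
  qed
qed

text \<open>Fubini for the product law: \<open>Y\<close> is integrated with \<open>X\<close> frozen.
  It stands in for conditional expectation given \<open>X\<close>.\<close>

lemma indep_rv_integral:
  fixes k :: "'x \<times> 'y \<Rightarrow> 'c::{banach, second_countable_topology}"
  assumes ind: "indep_rv M A X B Y" and k [measurable]: "k \<in> borel_measurable (A \<Otimes>\<^sub>M B)"
    and int: "integrable M (\<lambda>w. k (X w, Y w))"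
  shows "integrable M (\<lambda>w. \<integral>w'. k (X w, Y w') \<partial>M)"
    and "(\<integral>w. k (X w, Y w) \<partial>M) = (\<integral>w. \<integral>w'. k (X w, Y w') \<partial>M \<partial>M)"
proof -
  note [measurable] = indep_rv_rv[OF ind]
  interpret P: pair_prob_space "distr M A X" "distr M B Y"
    unfolding pair_prob_space_def pair_sigma_finite_def
    by (auto intro!: prob_space_imp_sigma_finite prob_space_distr)
  have int': "integrable (distr M A X \<Otimes>\<^sub>M distr M B Y) k"
    using int by (simp add: indep_rv_distr[OF ind] integrable_distr_eq)
  have inner: "(\<integral>y. k (X w, y) \<partial>distr M B Y) = (\<integral>w'. k (X w, Y w') \<partial>M)" if "w \<in> space M" for w
    using measurable_space[OF indep_rv_rv(1)[OF ind] that] by (intro integral_distr) auto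
  have m: "(\<lambda>x. \<integral>y. k (x, y) \<partial>distr M B Y) \<in> borel_measurable A"
    by (rule P.M2.borel_measurable_lebesgue_integral) simp
  have "integrable M (\<lambda>w. \<integral>y. k (X w, y) \<partial>distr M B Y)"
    using P.integrable_fst'[OF int'] m by (simp add: integrable_distr_eq)
  then show "integrable M (\<lambda>w. \<integral>w'. k (X w, Y w') \<partial>M)"
    by (subst (asm) Bochner_Integration.integrable_cong[OF refl inner]) auto
  have "(\<integral>w. k (X w, Y w) \<partial>M) = integral\<^sup>L (distr M A X \<Otimes>\<^sub>M distr M B Y) k"
    by (simp add: indep_rv_distr[OF ind] integral_distr)
  also have "\<dots> = (\<integral>x. \<integral>y. k (x, y) \<partial>distr M B Y \<partial>distr M A X)" using P.integral_fst'[OF int'] by simp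
  also have "\<dots> = (\<integral>w. \<integral>y. k (X w, y) \<partial>distr M B Y \<partial>M)" using m by (simp add: integral_distr)
  also have "\<dots> = (\<integral>w. \<integral>w'. k (X w, Y w') \<partial>M \<partial>M)" by (intro Bochner_Integration.integral_cong refl inner)
  finally show "(\<integral>w. k (X w, Y w) \<partial>M) = (\<integral>w. \<integral>w'. k (X w, Y w') \<partial>M \<partial>M)" .
qed

text \<open>Rectangles generate the product sigma-algebra, and the probability of an intersection of
  rectangle events splits first between the two sequences, then over the indices within
  each.\<close>

lemma indep_vars_pair:
  assumes X: "indep_vars (\<lambda>_. A) X UNIV" and Y: "indep_vars (\<lambda>_. B) Y UNIV"
    and ind: "indep_rv M (PiM UNIV (\<lambda>_. A)) (\<lambda>w i. X i w) (PiM UNIV (\<lambda>_. B)) (\<lambda>w i. Y i w)"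
    and I: "finite I" "I \<noteq> {}"
  shows "indep_vars (\<lambda>_. A \<Otimes>\<^sub>M B) (\<lambda>i w. (X i w, Y i w)) I"
proof (subst indep_vars_finite[where E = "\<lambda>_. {a \<times> b | a b. a \<in> sets A \<and> b \<in> sets B}"])
  have Xm: "X i \<in> M \<rightarrow>\<^sub>M A" and Ym: "Y i \<in> M \<rightarrow>\<^sub>M B" for i using X Y by (auto simp: indep_vars_def)
  then show "random_variable (A \<Otimes>\<^sub>M B) (\<lambda>w. (X i w, Y i w))" for i by simp
  show "Int_stable {a \<times> b | a b. a \<in> sets A \<and> b \<in> sets B}" by (rule Int_stable_pair_measure_generator)
  show "sets (A \<Otimes>\<^sub>M B) = sigma_sets (space (A \<Otimes>\<^sub>M B)) {a \<times> b | a b. a \<in> sets A \<and> b \<in> sets B}"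
    by (simp add: sets_pair_measure space_pair_measure)
  show "space (A \<Otimes>\<^sub>M B) \<in> {a \<times> b | a b. a \<in> sets A \<and> b \<in> sets B}" by (auto simp: space_pair_measure)
  show "{a \<times> b | a b. a \<in> sets A \<and> b \<in> sets B} \<subseteq> Pow (space (A \<Otimes>\<^sub>M B))"
    by (auto simp: space_pair_measure dest: sets.sets_into_space)
  show "\<forall>E\<in>(I \<rightarrow> {a \<times> b | a b. a \<in> sets A \<and> b \<in> sets B}).
      prob (\<Inter>j\<in>I. (\<lambda>w. (X j w, Y j w)) -` E j \<inter> space M)
        = (\<Prod>j\<in>I. prob ((\<lambda>w. (X j w, Y j w)) -` E j \<inter> space M))"
  proof
    fix E assume "E \<in> I \<rightarrow> {a \<times> b | a b. a \<in> sets A \<and> b \<in> sets B}"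
    then have "\<forall>j\<in>I. \<exists>a b. E j = a \<times> b \<and> a \<in> sets A \<and> b \<in> sets B" by blast
    then obtain a b where ab: "\<And>j. j \<in> I \<Longrightarrow> E j = a j \<times> b j \<and> a j \<in> sets A \<and> b j \<in> sets B" by metis
    \<comment> \<open>Used with J = I for the intersection and with singletons for the
      factors.\<close>
    have split: "prob (\<Inter>j\<in>J. (\<lambda>w. (X j w, Y j w)) -` E j \<inter> space M)
        = prob (\<Inter>j\<in>J. X j -` a j \<inter> space M) * prob (\<Inter>j\<in>J. Y j -` b j \<inter> space M)"
      if J: "J \<subseteq> I" "J \<noteq> {}" for J
    proof -
      have [simp]: "finite J" using J I(1) by (auto intro: finite_subset)
      define P where "P = {u \<in> space (PiM UNIV (\<lambda>_. A)). \<forall>j\<in>J. u j \<in> a j}"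
      define Q where "Q = {u \<in> space (PiM UNIV (\<lambda>_. B)). \<forall>j\<in>J. u j \<in> b j}"
      have "{u \<in> space A. u \<in> a j} = a j" "{u \<in> space B. u \<in> b j} = b j" if "j \<in> J" for j
        using ab[of j] that J(1) sets.sets_into_space by blast+
      then have "P \<in> sets (PiM UNIV (\<lambda>_. A))" "Q \<in> sets (PiM UNIV (\<lambda>_. B))"
        unfolding P_def Q_def using ab J by (auto intro!: sets.sets_Collect_finite_All sets_Collect_single' simp: subset_eq)
      note indep_rvD[OF ind this]
      moreover have "(\<lambda>w i. X i w) -` P \<inter> space M = (\<Inter>j\<in>J. X j -` a j \<inter> space M)"
        "(\<lambda>w i. Y i w) -` Q \<inter> space M = (\<Inter>j\<in>J. Y j -` b j \<inter> space M)"
        using J measurable_space[OF Xm] measurable_space[OF Ym] by (auto simp: P_def Q_def space_PiM)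
      moreover have "(\<Inter>j\<in>J. X j -` a j \<inter> space M) \<inter> (\<Inter>j\<in>J. Y j -` b j \<inter> space M)
          = (\<Inter>j\<in>J. (\<lambda>w. (X j w, Y j w)) -` E j \<inter> space M)"
      proof -
        have "E j = a j \<times> b j" if "j \<in> J" for j using ab that J by blast
        then show ?thesis by auto
      qed
      ultimately show ?thesis by simp
    qed
    have "prob (\<Inter>j\<in>I. X j -` a j \<inter> space M) = (\<Prod>j\<in>I. prob (X j -` a j \<inter> space M))"
      "prob (\<Inter>j\<in>I. Y j -` b j \<inter> space M) = (\<Prod>j\<in>I. prob (Y j -` b j \<inter> space M))"
      using indep_varsD[OF X I(2,1) subset_UNIV, of a] indep_varsD[OF Y I(2,1) subset_UNIV, of b] ab by blast+
    moreover have "prob ((\<lambda>w. (X j w, Y j w)) -` E j \<inter> space M)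
        = prob (X j -` a j \<inter> space M) * prob (Y j -` b j \<inter> space M)" if "j \<in> I" for j
      using split[of "{j}"] that by simp
    ultimately show "prob (\<Inter>j\<in>I. (\<lambda>w. (X j w, Y j w)) -` E j \<inter> space M)
        = (\<Prod>j\<in>I. prob ((\<lambda>w. (X j w, Y j w)) -` E j \<inter> space M))"
      using split[of I] I by (simp add: prod.distrib)
  qed
qed (use I in auto)

end

section \<open>The algorithm\<close>

text \<open>The case \<open>h\<close> = 0 and \<rho> = 0 of \<open>prox_lipschitz\<close>, where the
  factor 1 - l \<rho> is 1.\<close>

lemma prox_nonexpansive:
  fixes r :: "'a::euclidean_space \<Rightarrow> ereal"
  assumes "proper_fun r" "closed_fun r" "convex_fun r" "0 < a"
  shows "norm (prox a r u - prox a r v) \<le> norm (u - v)" and "continuous_on A (prox a r)"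
proof -
  interpret weakly_convex_prox "\<lambda>_. 0" "\<lambda>_. 0" 0 r a
    by unfold_locales (use assms in \<open>auto simp: GDERIV_const\<close>)
  have p: "p = r" by (auto simp: p_def)
  show "norm (prox a r u - prox a r v) \<le> norm (u - v)" "continuous_on A (prox a r)"
    using prox_lipschitz[of u v] continuous_prox[of A] by (auto simp: p)
qed

lemma square_sum3_le:
  fixes a b c :: real
  assumes "0 \<le> x" "x \<le> a + b + c"
  shows "x\<^sup>2 \<le> 3 * a\<^sup>2 + 3 * b\<^sup>2 + 3 * c\<^sup>2"
proof -
  have "x\<^sup>2 \<le> (a + b + c)\<^sup>2" using assms by (intro power_mono) auto
  moreover have "0 \<le> (a - b)\<^sup>2 + (a - c)\<^sup>2 + (b - c)\<^sup>2" by simp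
  ultimately show ?thesis by (simp add: power2_eq_square algebra_simps)
qed

text \<open>Here the Lipschitz bound is required at every point of \<open>S\<close> and \<rho> is
  positive; the final theorem is reduced to this setting.\<close>

locale zproxsg_model = prob_space M for M :: "'w measure" +
  fixes S :: "'z measure" and \<xi> :: "'w \<Rightarrow> 'z" and F :: "real^'n \<Rightarrow> 'z \<Rightarrow> real" and C :: "'z \<Rightarrow> real"
    and r :: "real^'n \<Rightarrow> ereal" and \<rho> \<mu> :: real and U :: "nat \<Rightarrow> 'w \<Rightarrow> real^'n" and \<xi>s :: "nat \<Rightarrow> 'w \<Rightarrow> 'z"
    and x0 :: "real^'n" and \<alpha> :: "nat \<Rightarrow> real" and n :: real
  assumes n_eq: "n = real CARD('n)"
    and \<xi> [measurable]: "\<xi> \<in> M \<rightarrow>\<^sub>M S"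
    and F_measurable [measurable]: "\<And>y. F y \<in> borel_measurable S"
    and F_square: "\<And>y. integrable M (\<lambda>w. (F y (\<xi> w))\<^sup>2)"
    and \<rho>_pos: "0 < \<rho>" and weakly_convex_objective: "weakly_convex \<rho> (objective M \<xi> F)"
    and C_measurable [measurable]: "C \<in> borel_measurable S"
    and C_pos: "\<And>z. z \<in> space S \<Longrightarrow> 0 < C z"
    and C_square: "integrable M (\<lambda>w. (C (\<xi> w))\<^sup>2)"
    and F_lipschitz: "\<And>x y z. z \<in> space S \<Longrightarrow> \<bar>F x z - F y z\<bar> \<le> C z * norm (x - y)"
    and r_proper: "proper_fun r" and r_closed: "closed_fun r" and r_convex: "convex_fun r"
    and samples: "zproxsg_samples M S \<xi> U \<xi>s"
    and \<mu>_pos: "0 < \<mu>" and \<alpha>_pos: "\<And>t. 0 < \<alpha> t"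
begin

abbreviation "f \<equiv> objective M \<xi> F"
abbreviation "g \<equiv> smoothing_grad \<mu> f"
abbreviation "L \<equiv> lip_const M \<xi> C"
abbreviation "N \<equiv> n\<^sup>2 + 2 * n"
abbreviation "\<phi> \<equiv> smoothed_objective M \<xi> F r \<mu>"
abbreviation "G x v \<equiv> grad_est F \<mu> x (fst v) (snd v)"
abbreviation "V t w \<equiv> (U t w, \<xi>s t w)"

definition X :: "nat \<Rightarrow> 'w \<Rightarrow> real^'n" where
  "X t w = zproxsg F r \<mu> \<alpha> x0 (\<lambda>i. U i w) (\<lambda>i. \<xi>s i w) t"

lemma X_simps: "X 0 w = x0" "X (Suc t) w = prox (\<alpha> t) r (X t w - \<alpha> t *\<^sub>R G (X t w) (V t w))"
  by (simp_all add: X_def Let_def)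

lemma L_pos: "0 < L" and f_lipschitz: "L-lipschitz_on UNIV f"
  using lip_const_lipschitz[OF prob_space_axioms \<xi> F_measurable F_square C_measurable C_pos C_square] F_lipschitz
    AE_space[of "distr M S \<xi>"] by (force elim: eventually_mono)+

lemma g_bound: "(norm (g x))\<^sup>2 \<le> N * L\<^sup>2"
  using smoothing_grad_bound[OF f_lipschitz \<mu>_pos] by (simp add: n_eq)

sublocale composite: weakly_convex_composite "smoothing \<mu> f" g \<rho> r
proof
  show "GDERIV (smoothing \<mu> f) x :> g x" for x
    by (rule GDERIV_smoothing[OF f_lipschitz \<mu>_pos])
  then show "smoothing \<mu> f x + g x \<bullet> (y - x) - \<rho> / 2 * (norm (y - x))\<^sup>2 \<le> smoothing \<mu> f y" for x y
    by (rule weakly_convex_subgrad[OF weakly_convex_smoothing[OF f_lipschitz \<mu>_pos weakly_convex_objective]])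
qed (use r_proper r_closed r_convex \<rho>_pos in auto)

lemma p_eq: "composite.p = \<phi>"
  by (simp add: fun_eq_iff composite.p_def smoothed_objective_def)

lemma U_measurable [measurable]: "U i \<in> borel_measurable M"
  and \<xi>s_measurable [measurable]: "\<xi>s i \<in> M \<rightarrow>\<^sub>M S"
  and distr_U: "distr M borel (U i) = std_gaussian"
  and distr_\<xi>s: "distr M S (\<xi>s i) = distr M S \<xi>"
  using samples by (auto simp: zproxsg_samples_def indep_vars_def)

text \<open>Continuity in the first argument is used for every \<open>z\<close>, which is what the
  pointwise Lipschitz bound provides.\<close>

lemma F_joint_measurable [measurable]: "(\<lambda>(y, z). F y z) \<in> borel_measurable (borel \<Otimes>\<^sub>M S)"
proof (rule borel_measurable_caratheodory)
  fix z assume z: "z \<in> space S"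
  have "(C z)-lipschitz_on UNIV (\<lambda>y. F y z)"
    using F_lipschitz[OF z] C_pos[OF z] by (intro lipschitz_onI) (auto simp: dist_norm)
  then show "continuous_on UNIV (\<lambda>y. F y z)" by (rule lipschitz_on_continuous_on)
qed measurable

lemma G_measurable [measurable]:
  "(\<lambda>(x, v). G x v) \<in> borel_measurable (borel \<Otimes>\<^sub>M (borel \<Otimes>\<^sub>M S))"
proof -
  have "(\<lambda>q. (\<lambda>(y, z). F y z) (fst q + \<mu> *\<^sub>R fst (snd q), snd (snd q))) \<in> borel_measurable (borel \<Otimes>\<^sub>M (borel \<Otimes>\<^sub>M S))"
    "(\<lambda>q. (\<lambda>(y, z). F y z) (fst q, snd (snd q))) \<in> borel_measurable (borel \<Otimes>\<^sub>M (borel \<Otimes>\<^sub>M S))"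
    by measurable
  then show ?thesis by (simp add: grad_est_def case_prod_beta')
qed

lemma G_bound: "z \<in> space S \<Longrightarrow> norm (G x (u, z)) \<le> C z * (norm u)\<^sup>2"
proof -
  assume z: "z \<in> space S"
  have "\<bar>F (x + \<mu> *\<^sub>R u) z - F x z\<bar> \<le> C z * (\<mu> * norm u)"
    using F_lipschitz[OF z, of "x + \<mu> *\<^sub>R u" x] \<mu>_pos by simp
  then have "inverse \<mu> * \<bar>F (x + \<mu> *\<^sub>R u) z - F x z\<bar> \<le> inverse \<mu> * (C z * (\<mu> * norm u))"
    using \<mu>_pos by (intro mult_left_mono) auto
  also have "\<dots> = C z * norm u" using \<mu>_pos by simp
  finally have "inverse \<mu> * \<bar>F (x + \<mu> *\<^sub>R u) z - F x z\<bar> * norm u \<le> C z * norm u * norm u"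
    by (rule mult_right_mono) simp
  moreover have "norm (G x (u, z)) = inverse \<mu> * \<bar>F (x + \<mu> *\<^sub>R u) z - F x z\<bar> * norm u"
    using \<mu>_pos by (simp add: grad_est_def abs_mult)
  ultimately show ?thesis by (simp only: power2_eq_square mult.assoc)
qed

lemma indep_U_\<xi>s: "indep_rv M borel (U t) S (\<xi>s t)"
proof -
  have "indep_rv M (PiM UNIV (\<lambda>_. borel)) (\<lambda>w i. U i w) (PiM UNIV (\<lambda>_. S)) (\<lambda>w i. \<xi>s i w)"
    using samples by (simp add: zproxsg_samples_def)
  from indep_rv_compose[OF this, of "\<lambda>u. u t" borel "\<lambda>z. z t" S] show ?thesis by simp
qed

text \<open>A bound for the squared estimator that does not depend on the point x, so that it also
  dominates along the random iterates.\<close>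

definition W :: "nat \<Rightarrow> 'w \<Rightarrow> real" where "W t w = (norm (U t w)) ^ 4 * (C (\<xi>s t w))\<^sup>2"

text \<open>Independence of \<open>U t\<close> and \<open>\<xi>s t\<close> factorises the mean into
  E|u|^4 = N and E C^2 = L^2; the choice of \<open>L\<close> as root mean square of \<open>C\<close>
  enters here.\<close>

lemma integrable_W: "integrable M (W t)" and integral_W: "integral\<^sup>L M (W t) = N * L\<^sup>2"
proof -
  have ind: "indep_var borel (\<lambda>w. (norm (U t w)) ^ 4) borel (\<lambda>w. (C (\<xi>s t w))\<^sup>2)"
    unfolding indep_rv_iff_indep_var[symmetric]
    by (rule indep_rv_compose[OF indep_U_\<xi>s, of "\<lambda>u. (norm u) ^ 4" borel "\<lambda>z. (C z)\<^sup>2" borel]) measurable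
  have "integrable (distr M borel (U t)) (\<lambda>u. (norm u) ^ 4)" "integral\<^sup>L (distr M borel (U t)) (\<lambda>u. (norm u) ^ 4) = N"
    using std_gaussian_norm_4[where 'n = 'n] by (simp_all add: distr_U has_bochner_integral_iff n_eq)
  then have 1: "integrable M (\<lambda>w. (norm (U t w)) ^ 4)" "integral\<^sup>L M (\<lambda>w. (norm (U t w)) ^ 4) = N"
    by (simp_all add: integrable_distr_eq integral_distr)
  have "integrable (distr M S \<xi>) (\<lambda>z. (C z)\<^sup>2)" "integral\<^sup>L (distr M S \<xi>) (\<lambda>z. (C z)\<^sup>2) = L\<^sup>2"
    using C_square by (simp_all add: integrable_distr_eq integral_distr lip_const_def)
  then have 2: "integrable M (\<lambda>w. (C (\<xi>s t w))\<^sup>2)" "integral\<^sup>L M (\<lambda>w. (C (\<xi>s t w))\<^sup>2) = L\<^sup>2"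
    unfolding distr_\<xi>s[of t, symmetric] by (simp_all add: integrable_distr_eq integral_distr)
  show "integrable M (W t)" unfolding W_def by (rule indep_var_integrable[OF ind 1(1) 2(1)])
  show "integral\<^sup>L M (W t) = N * L\<^sup>2"
    unfolding W_def indep_var_lebesgue_integral[OF ind 1(1) 2(1)] 1(2) 2(2) ..
qed

lemma G_square_bound: "w \<in> space M \<Longrightarrow> (norm (G x (V t w)))\<^sup>2 \<le> W t w"
proof -
  assume "w \<in> space M"
  then have "norm (G x (V t w)) \<le> C (\<xi>s t w) * (norm (U t w))\<^sup>2"
    by (intro G_bound measurable_space[OF \<xi>s_measurable])
  then have "(norm (G x (V t w)))\<^sup>2 \<le> (C (\<xi>s t w) * (norm (U t w))\<^sup>2)\<^sup>2" by (intro power_mono) auto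
  then show ?thesis by (simp add: W_def power_mult_distrib mult.commute)
qed

lemma integrable_G: "integrable M (\<lambda>w. G x (V t w))"
proof (rule Bochner_Integration.integrable_bound)
  show "integrable M (\<lambda>w. 1 + W t w)" using integrable_W by simp
  show "AE w in M. norm (G x (V t w)) \<le> norm (1 + W t w)"
  proof (rule AE_I2)
    fix w assume "w \<in> space M"
    have "2 * norm (G x (V t w)) \<le> 1 + (norm (G x (V t w)))\<^sup>2"
      using sum_squares_bound[of 1 "norm (G x (V t w))"] by simp
    with G_square_bound[OF \<open>w \<in> space M\<close>, of x t] show "norm (G x (V t w)) \<le> norm (1 + W t w)"
      using norm_ge_zero[of "G x (V t w)"] unfolding real_norm_def by linarith
  qed
  have "(\<lambda>w. (\<lambda>(x, v). G x v) (x, V t w)) \<in> borel_measurable M" by measurable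
  then show "(\<lambda>w. G x (V t w)) \<in> borel_measurable M" by simp
qed

text \<open>Integrating first over the sample \<open>\<xi>s t\<close> with the direction frozen
  turns \<open>F\<close> into its expectation \<open>f\<close>; the remaining Gaussian mean defines
  \<open>g\<close>.\<close>

lemma integral_G: "(\<integral>w. G x (V t w) \<partial>M) = g x"
proof -
  have "(\<lambda>v. (\<lambda>(x, v). G x v) (x, v)) \<in> borel_measurable (borel \<Otimes>\<^sub>M S)" by measurable
  then have "(\<integral>w. G x (V t w) \<partial>M) = (\<integral>w. \<integral>w'. G x (U t w, \<xi>s t w') \<partial>M \<partial>M)"
    by (intro indep_rv_integral(2)[OF indep_U_\<xi>s]) (use integrable_G in auto)
  also have "\<dots> = (\<integral>w. (inverse \<mu> * (f (x + \<mu> *\<^sub>R U t w) - f x)) *\<^sub>R U t w \<partial>M)"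
  proof -
    have int: "integrable M (\<lambda>w. F y (\<xi>s t w))" and val: "(\<integral>w. F y (\<xi>s t w) \<partial>M) = f y" for y
    proof -
      have "integrable (distr M S \<xi>) (F y)" "integral\<^sup>L (distr M S \<xi>) (F y) = f y"
        using square_integrable_imp_integrable[OF _ F_square[of y]]
        by (simp_all add: integrable_distr_eq integral_distr objective_def)
      then show "integrable M (\<lambda>w. F y (\<xi>s t w))" "(\<integral>w. F y (\<xi>s t w) \<partial>M) = f y"
        unfolding distr_\<xi>s[of t, symmetric] by (simp_all add: integrable_distr_eq integral_distr)
    qed
    show ?thesis by (simp add: grad_est_def int val)
  qed
  also have "\<dots> = (\<integral>u. (inverse \<mu> * (f (x + \<mu> *\<^sub>R u) - f x)) *\<^sub>R u \<partial>distr M borel (U t))"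
    using smoothing_measurable[OF f_lipschitz \<mu>_pos] by (subst integral_distr) auto
  finally show ?thesis by (simp add: distr_U smoothing_grad_def)
qed

text \<open>As the mean of the estimator, \<open>g\<close> is a parameter integral with jointly
  measurable integrand.\<close>

lemma g_measurable [measurable]: "g \<in> borel_measurable borel"
proof -
  have "(\<lambda>x. \<integral>w. (\<lambda>(x, v). G x v) (x, V 0 w) \<partial>M) \<in> borel_measurable borel"
    by (rule borel_measurable_lebesgue_integral) measurable
  then show ?thesis by (simp add: integral_G[simplified])
qed

section \<open>Iterates as functions of the sampled pairs; independence from the current
  sample\<close>

definition iter :: "nat \<Rightarrow> (nat \<Rightarrow> (real^'n) \<times> 'z) \<Rightarrow> real^'n" where
  "iter t v = zproxsg F r \<mu> \<alpha> x0 (\<lambda>i. fst (v i)) (\<lambda>i. snd (v i)) t"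

lemma iter_simps: "iter 0 v = x0" "iter (Suc t) v = prox (\<alpha> t) r (iter t v - \<alpha> t *\<^sub>R G (iter t v) (v t))"
  by (simp_all add: iter_def Let_def)

lemma iter_cong: "(\<And>i. i < t \<Longrightarrow> v i = v' i) \<Longrightarrow> iter t v = iter t v'"
  by (induction t) (simp_all add: iter_simps)

lemma prox_measurable [measurable]: "prox (\<alpha> t) r \<in> borel_measurable borel"
  by (intro borel_measurable_continuous_onI prox_nonexpansive r_proper r_closed r_convex \<alpha>_pos)

text \<open>The index set is left free: \<open>{..<t}\<close> serves independence from the sample
  \<open>t\<close>, \<open>UNIV\<close> serves measurability of \<open>X t\<close>.\<close>

lemma iter_measurable [measurable]:
  assumes "{..<t} \<subseteq> I"
  shows "iter t \<in> borel_measurable (PiM I (\<lambda>_. borel \<Otimes>\<^sub>M S))"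
  using assms
proof (induction t)
  case (Suc t)
  then have "{..<t} \<subseteq> I" and [measurable]: "t \<in> I" by auto
  note [measurable] = Suc.IH[OF this(1)]
  have "(\<lambda>v. prox (\<alpha> t) r (iter t v - \<alpha> t *\<^sub>R (\<lambda>(x, v). G x v) (iter t v, v t))) \<in> borel_measurable (PiM I (\<lambda>_. borel \<Otimes>\<^sub>M S))"
    by measurable
  then show ?case by (simp add: iter_simps[abs_def])
qed (simp add: iter_simps[abs_def])

lemma X_iter: "X t w = iter t (\<lambda>i. V i w)"
  by (simp add: X_def iter_def)

lemma X_measurable [measurable]: "X t \<in> borel_measurable M"
proof -
  have "(\<lambda>w. iter t (\<lambda>i. V i w)) \<in> borel_measurable M"
    by (rule measurable_compose[OF _ iter_measurable[of t UNIV]]) (auto intro!: measurable_abs_UNIV)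
  then show ?thesis by (simp add: X_iter[abs_def])
qed

text \<open>\<open>X t\<close> is a function of the pairs with index below \<open>t\<close>, and
  disjoint blocks of independent variables are independent.\<close>

lemma indep_X_V: "indep_rv M borel (X t) (borel \<Otimes>\<^sub>M S) (V t)"
proof -
  have "indep_vars (\<lambda>_. borel \<Otimes>\<^sub>M S) V {..t}"
    using samples by (intro indep_vars_pair) (auto simp: zproxsg_samples_def)
  then have "indep_var (PiM {..<t} (\<lambda>_. borel \<Otimes>\<^sub>M S)) (\<lambda>w. restrict (\<lambda>i. V i w) {..<t})
      (PiM {t} (\<lambda>_. borel \<Otimes>\<^sub>M S)) (\<lambda>w. restrict (\<lambda>i. V i w) {t})"
    by (rule indep_var_restrict) auto
  then have "indep_rv M borel (\<lambda>w. iter t (restrict (\<lambda>i. V i w) {..<t})) (borel \<Otimes>\<^sub>M S) (\<lambda>w. restrict (\<lambda>i. V i w) {t} t)"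
    unfolding indep_rv_iff_indep_var[symmetric]
    by (rule indep_rv_compose) (auto intro!: iter_measurable)
  moreover have "iter t (restrict (\<lambda>i. V i w) {..<t}) = X t w" for w
    unfolding X_iter by (rule iter_cong) simp
  ultimately show ?thesis by simp
qed

text \<open>Nonexpansiveness bounds the next iterate by the norms of
  \<open>prox (\<alpha> t) r 0\<close>, of the current iterate and of the scaled estimator, whose
  square is dominated through \<open>W t\<close>.\<close>

lemma integrable_X_square: "integrable M (\<lambda>w. (norm (X t w))\<^sup>2)"
proof (induction t)
  case (Suc t)
  define b where "b w = 3 * (norm (prox (\<alpha> t) r 0))\<^sup>2 + 3 * (norm (X t w))\<^sup>2 + 3 * ((\<alpha> t)\<^sup>2 * W t w)" for w
  show ?case
  proof (rule Bochner_Integration.integrable_bound)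
    show "integrable M b" unfolding b_def using Suc integrable_W by simp
    show "AE w in M. norm ((norm (X (Suc t) w))\<^sup>2) \<le> norm (b w)"
    proof (rule AE_I2)
      fix w assume w: "w \<in> space M"
      define y where "y = X t w - \<alpha> t *\<^sub>R G (X t w) (V t w)"
      have "norm (X (Suc t) w) \<le> norm (prox (\<alpha> t) r 0) + norm (prox (\<alpha> t) r y - prox (\<alpha> t) r 0)"
        unfolding X_simps y_def by (rule norm_triangle_sub)
      also have "norm (prox (\<alpha> t) r y - prox (\<alpha> t) r 0) \<le> norm y"
        using prox_nonexpansive(1)[OF r_proper r_closed r_convex \<alpha>_pos, of t y 0] by simp
      also have "norm y \<le> norm (X t w) + \<alpha> t * norm (G (X t w) (V t w))"
        using norm_triangle_ineq4[of "X t w" "\<alpha> t *\<^sub>R G (X t w) (V t w)"] \<alpha>_pos[of t] by (simp add: y_def)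
      finally have "(norm (X (Suc t) w))\<^sup>2 \<le> 3 * (norm (prox (\<alpha> t) r 0))\<^sup>2 + 3 * (norm (X t w))\<^sup>2
          + 3 * (\<alpha> t * norm (G (X t w) (V t w)))\<^sup>2"
        by (intro square_sum3_le) auto
      also have "\<dots> \<le> b w"
        unfolding b_def power_mult_distrib by (intro add_left_mono mult_left_mono G_square_bound w) auto
      finally show "norm ((norm (X (Suc t) w))\<^sup>2) \<le> norm (b w)" by simp
    qed
  qed measurable
qed (simp add: X_simps)

end

section \<open>Descent of the Moreau envelope\<close>

locale zproxsg_envelope = zproxsg_model M S \<xi> F C r \<rho> \<mu> U \<xi>s x0 \<alpha> n
  for M :: "'w measure" and S :: "'z measure" and \<xi> and F :: "real^'n \<Rightarrow> 'z \<Rightarrow> real" and C r \<rho> \<mu> U \<xi>s x0 \<alpha> n +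
  fixes \<rho>' :: real
  assumes \<rho>'_gt: "\<rho> < \<rho>'" and \<rho>'_le: "\<rho>' \<le> 2 * \<rho>"
begin

lemma \<rho>'_pos: "0 < \<rho>'"
  using \<rho>_pos \<rho>'_gt by simp

sublocale prox: weakly_convex_prox "smoothing \<mu> f" g \<rho> r "1 / \<rho>'"
  by unfold_locales (use \<rho>'_gt \<rho>'_pos in auto)

abbreviation "env \<equiv> moreau_env (1 / \<rho>') \<phi>"

definition Z :: "real^'n \<Rightarrow> real^'n" where "Z = prox (1 / \<rho>') \<phi>"
definition D :: "nat \<Rightarrow> 'w \<Rightarrow> real^'n" where "D t w = X t w - Z (X t w)"

text \<open>The gradient is \<rho>' times the displacement. Later computations use \<open>D\<close>,
  whose measurability is plain, whereas \<open>grad\<close> is given by a description.\<close>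

lemma norm_grad_env: "(norm (grad env (X t w)))\<^sup>2 = \<rho>'\<^sup>2 * (norm (D t w))\<^sup>2"
  using \<rho>'_pos prox.grad_moreau_env[of "X t w"] by (simp add: p_eq D_def Z_def power_mult_distrib)

lemma Z_measurable [measurable]: "Z \<in> borel_measurable borel"
  unfolding Z_def p_eq[symmetric] by (intro borel_measurable_continuous_onI prox.continuous_prox)

lemma env_measurable [measurable]: "env \<in> borel_measurable borel"
  unfolding p_eq[symmetric] by (intro borel_measurable_continuous_onI prox.continuous_moreau_env)

lemma D_measurable [measurable]: "D t \<in> borel_measurable M"
  unfolding D_def by measurable

lemma integrable_env: "integrable M (\<lambda>w. env (X t w))"
proof -
  obtain K where K: "\<And>u. \<bar>env u\<bar> \<le> K * (1 + (norm u)\<^sup>2)"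
    using prox.moreau_env_quadratic_growth unfolding p_eq by metis
  show ?thesis
  proof (rule Bochner_Integration.integrable_bound)
    show "integrable M (\<lambda>w. K * (1 + (norm (X t w))\<^sup>2))" using integrable_X_square by simp
    show "AE w in M. norm (env (X t w)) \<le> norm (K * (1 + (norm (X t w))\<^sup>2))"
      using K by (intro AE_I2) (simp only: real_norm_def, meson abs_ge_self order_trans)
  qed measurable
qed

lemma integrable_D_square: "integrable M (\<lambda>w. (norm (D t w))\<^sup>2)"
proof -
  obtain K where K: "0 \<le> K" "\<And>u. norm (u - Z u) \<le> K * (1 + norm u)"
    using prox.displacement_linear_growth unfolding p_eq Z_def by metis
  have le: "(norm (D t w))\<^sup>2 \<le> K\<^sup>2 * (2 + 2 * (norm (X t w))\<^sup>2)" for w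
  proof -
    have "(norm (D t w))\<^sup>2 \<le> (K * (1 + norm (X t w)))\<^sup>2"
      unfolding D_def using K by (intro power_mono) auto
    also have "\<dots> \<le> K\<^sup>2 * (2 + 2 * (norm (X t w))\<^sup>2)"
      unfolding power_mult_distrib using sum_squares_bound[of 1 "norm (X t w)"]
      by (intro mult_left_mono) (simp_all add: power2_sum)
    finally show ?thesis .
  qed
  show ?thesis
  proof (rule Bochner_Integration.integrable_bound)
    show "integrable M (\<lambda>w. K\<^sup>2 * (2 + 2 * (norm (X t w))\<^sup>2))" using integrable_X_square by simp
    show "AE w in M. norm ((norm (D t w))\<^sup>2) \<le> norm (K\<^sup>2 * (2 + 2 * (norm (X t w))\<^sup>2))"
      using le by (intro AE_I2) (simp add: order_trans[OF le])
  qed measurable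
qed

lemma integrable_grad_env: "integrable M (\<lambda>w. (norm (grad env (X t w)))\<^sup>2)"
  unfolding norm_grad_env using integrable_D_square by simp

lemma integrable_inner_D:
  assumes [measurable]: "Y \<in> borel_measurable M" and Y: "integrable M b" "\<And>w. w \<in> space M \<Longrightarrow> (norm (Y w))\<^sup>2 \<le> b w"
  shows "integrable M (\<lambda>w. D t w \<bullet> Y w)"
proof (rule Bochner_Integration.integrable_bound)
  show "integrable M (\<lambda>w. (norm (D t w))\<^sup>2 + b w)" using integrable_D_square Y(1) by simp
  show "AE w in M. norm (D t w \<bullet> Y w) \<le> norm ((norm (D t w))\<^sup>2 + b w)"
  proof (rule AE_I2)
    fix w assume w: "w \<in> space M"
    have "\<bar>D t w \<bullet> Y w\<bar> \<le> norm (D t w) * norm (Y w)" by (rule Cauchy_Schwarz_ineq2)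
    moreover have "2 * (norm (D t w) * norm (Y w)) \<le> (norm (D t w))\<^sup>2 + (norm (Y w))\<^sup>2"
      using sum_squares_bound[of "norm (D t w)" "norm (Y w)"] by (simp add: mult.assoc)
    moreover have "0 \<le> norm (D t w) * norm (Y w)" by simp
    ultimately show "norm (D t w \<bullet> Y w) \<le> norm ((norm (D t w))\<^sup>2 + b w)"
      using Y(2)[OF w] unfolding real_norm_def by linarith
  qed
qed measurable

lemma G_path_measurable [measurable]: "(\<lambda>w. G (X t w) (V t w)) \<in> borel_measurable M"
proof -
  have "(\<lambda>w. (\<lambda>(x, v). G x v) (X t w, V t w)) \<in> borel_measurable M" by measurable
  then show ?thesis by simp
qed

lemma integrable_inner_G: "integrable M (\<lambda>w. D t w \<bullet> G (X t w) (V t w))"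
  by (rule integrable_inner_D[OF G_path_measurable integrable_W G_square_bound])

text \<open>\<open>D t\<close> depends on \<open>X t\<close> alone, so the current sample can be
  integrated out with \<open>X t\<close> frozen, where the estimator has mean
  \<open>g\<close>.\<close>

lemma integral_inner_G:
  shows "integrable M (\<lambda>w. D t w \<bullet> g (X t w))"
    and "(\<integral>w. D t w \<bullet> G (X t w) (V t w) \<partial>M) = (\<integral>w. D t w \<bullet> g (X t w) \<partial>M)"
proof -
  let ?k = "\<lambda>(x, v). (x - Z x) \<bullet> (\<lambda>(x, v). G x v) (x, v)"
  have k: "?k \<in> borel_measurable (borel \<Otimes>\<^sub>M (borel \<Otimes>\<^sub>M S))" by measurable
  have int: "integrable M (\<lambda>w. ?k (X t w, V t w))"
    using integrable_inner_G[of t] by (simp add: D_def)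
  have inner: "(\<integral>w'. ?k (X t w, V t w') \<partial>M) = D t w \<bullet> g (X t w)" for w
    using integrable_G[of "X t w" t] integral_G[of "X t w" t] by (simp add: D_def)
  show "integrable M (\<lambda>w. D t w \<bullet> g (X t w))"
    using indep_rv_integral(1)[OF indep_X_V k int] unfolding inner .
  show "(\<integral>w. D t w \<bullet> G (X t w) (V t w) \<partial>M) = (\<integral>w. D t w \<bullet> g (X t w) \<partial>M)"
    using indep_rv_integral(2)[OF indep_X_V k int] unfolding inner by (simp add: D_def)
qed

lemma envelope_step:
  assumes \<alpha>_le: "\<alpha> t \<le> 1 / \<rho>'"
  shows "(\<integral>w. env (X (Suc t) w) \<partial>M) \<le> (\<integral>w. env (X t w) \<partial>M)
    - \<alpha> t * (\<rho>' - \<rho>) / \<rho>' * (\<integral>w. (norm (grad env (X t w)))\<^sup>2 \<partial>M)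
    + 2 * N * \<rho>' * (\<alpha> t)\<^sup>2 * L\<^sup>2"
proof -
  define a where "a = \<alpha> t"
  define c where "c = 1 - a * \<rho>'"
  have a: "0 < a" using \<alpha>_pos by (simp add: a_def)
  have c: "0 \<le> c" using \<alpha>_le \<rho>'_pos by (simp add: c_def a_def field_simps)
  define E where "E = (\<integral>w. (norm (D t w))\<^sup>2 \<partial>M)"
  define P where "P = (\<integral>w. D t w \<bullet> g (X t w) \<partial>M)"
  define Q where "Q = (\<integral>w. D t w \<bullet> g (Z (X t w)) \<partial>M)"
  have int_Q: "integrable M (\<lambda>w. D t w \<bullet> g (Z (X t w)))"
    by (rule integrable_inner_D[where b = "\<lambda>_. N * L\<^sup>2"]) (auto simp: g_bound)
  have int_rhs: "integrable M (\<lambda>w. env (X t w) + \<rho>' / 2 * ((c\<^sup>2 - 1) * (norm (D t w))\<^sup>2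
      - 2 * a * c * (D t w \<bullet> G (X t w) (V t w) - D t w \<bullet> g (Z (X t w))) + a\<^sup>2 * (2 * W t w + 2 * (N * L\<^sup>2))))"
    by (intro Bochner_Integration.integrable_add Bochner_Integration.integrable_diff integrable_mult_right
        integrable_env integrable_D_square integrable_inner_G int_Q integrable_W integrable_const)
  have "(\<integral>w. env (X (Suc t) w) \<partial>M) \<le> (\<integral>w. env (X t w) + \<rho>' / 2 * ((c\<^sup>2 - 1) * (norm (D t w))\<^sup>2
      - 2 * a * c * (D t w \<bullet> G (X t w) (V t w) - D t w \<bullet> g (Z (X t w))) + a\<^sup>2 * (2 * W t w + 2 * (N * L\<^sup>2))) \<partial>M)"
  proof (rule integral_mono[OF integrable_env int_rhs])
    fix w assume w: "w \<in> space M"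
    define G' where "G' = G (X t w) (V t w)"
    define z where "z = g (Z (X t w))"
    have "env (X (Suc t) w) \<le> env (X t w) + (((1 - a / (1 / \<rho>'))\<^sup>2 - 1) * (norm (D t w))\<^sup>2
        - 2 * a * (1 - a / (1 / \<rho>')) * (D t w \<bullet> (G' - z)) + a\<^sup>2 * (norm (G' - z))\<^sup>2) / (2 * (1 / \<rho>'))"
      using prox.moreau_env_step[OF a, of "X t w" G']
      unfolding X_simps D_def Z_def z_def G'_def p_eq a_def .
    also have "\<dots> = env (X t w) + \<rho>' / 2 * ((c\<^sup>2 - 1) * (norm (D t w))\<^sup>2
        - 2 * a * c * (D t w \<bullet> G' - D t w \<bullet> z) + a\<^sup>2 * (norm (G' - z))\<^sup>2)"
      by (simp add: c_def inner_diff_right)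
    also have "\<dots> \<le> env (X t w) + \<rho>' / 2 * ((c\<^sup>2 - 1) * (norm (D t w))\<^sup>2
        - 2 * a * c * (D t w \<bullet> G' - D t w \<bullet> z) + a\<^sup>2 * (2 * W t w + 2 * (N * L\<^sup>2)))"
    proof -
      have "(norm (G' - z))\<^sup>2 \<le> (norm G' + norm z)\<^sup>2" by (intro power_mono norm_triangle_ineq4) auto
      also have "\<dots> \<le> 2 * (norm G')\<^sup>2 + 2 * (norm z)\<^sup>2"
        using sum_squares_bound[of "norm G'" "norm z"] by (simp add: power2_sum)
      also have "\<dots> \<le> 2 * W t w + 2 * (N * L\<^sup>2)"
        using G_square_bound[OF w, of "X t w" t] g_bound[of "Z (X t w)"] unfolding G'_def z_def by linarith
      finally show ?thesis using \<rho>'_pos by (intro add_left_mono mult_left_mono) auto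
    qed
    finally show "env (X (Suc t) w) \<le> env (X t w) + \<rho>' / 2 * ((c\<^sup>2 - 1) * (norm (D t w))\<^sup>2
      - 2 * a * c * (D t w \<bullet> G (X t w) (V t w) - D t w \<bullet> g (Z (X t w))) + a\<^sup>2 * (2 * W t w + 2 * (N * L\<^sup>2)))"
      unfolding G'_def z_def .
  qed
  also have "\<dots> = (\<integral>w. env (X t w) \<partial>M) + \<rho>' / 2 * ((c\<^sup>2 - 1) * E - 2 * a * c * (P - Q) + a\<^sup>2 * (4 * (N * L\<^sup>2)))"
  proof -
    have "has_bochner_integral M (\<lambda>w. env (X t w) + \<rho>' / 2 * ((c\<^sup>2 - 1) * (norm (D t w))\<^sup>2
      - 2 * a * c * (D t w \<bullet> G (X t w) (V t w) - D t w \<bullet> g (Z (X t w))) + a\<^sup>2 * (2 * W t w + 2 * (N * L\<^sup>2))))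
      ((\<integral>w. env (X t w) \<partial>M) + \<rho>' / 2 * ((c\<^sup>2 - 1) * E
      - 2 * a * c * ((\<integral>w. D t w \<bullet> G (X t w) (V t w) \<partial>M) - Q) + a\<^sup>2 * (2 * integral\<^sup>L M (W t) + (\<integral>w. 2 * (N * L\<^sup>2) \<partial>M))))"
      unfolding E_def Q_def
      by (intro has_bochner_integral_add has_bochner_integral_diff has_bochner_integral_mult_right
          has_bochner_integral_integrable integrable_env integrable_D_square integrable_inner_G int_Q integrable_W integrable_const)
    then show ?thesis
      unfolding integral_inner_G(2) integral_W P_def by (simp add: has_bochner_integral_iff prob_space)
  qed
  also have "\<dots> \<le> (\<integral>w. env (X t w) \<partial>M) - a * (\<rho>' - \<rho>) / \<rho>' * (\<rho>'\<^sup>2 * E) + 2 * N * \<rho>' * a\<^sup>2 * L\<^sup>2"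
  proof -
    \<comment> \<open>Hypomonotonicity of \<open>g\<close> between the iterate and its proximal
      point, whose difference is \<open>D t\<close>.\<close>
    have "- \<rho> * E \<le> P - Q"
    proof -
      have "(\<integral>w. - \<rho> * (norm (D t w))\<^sup>2 \<partial>M) \<le> (\<integral>w. D t w \<bullet> g (X t w) - D t w \<bullet> g (Z (X t w)) \<partial>M)"
      proof (rule integral_mono)
        show "- \<rho> * (norm (D t w))\<^sup>2 \<le> D t w \<bullet> g (X t w) - D t w \<bullet> g (Z (X t w))" for w
          using composite.hypomonotone[of "X t w" "Z (X t w)"]
          by (simp add: D_def inner_diff_right inner_diff_left inner_commute)
      qed (intro Bochner_Integration.integrable_diff integrable_mult_right integrable_D_square integral_inner_G int_Q)+
      then show ?thesis
        by (simp add: E_def P_def Q_def integral_inner_G int_Q)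
    qed
    then have "2 * a * c * (- \<rho> * E) \<le> 2 * a * c * (P - Q)" using a c by (intro mult_left_mono) auto
    moreover have "0 \<le> E" by (simp add: E_def)
    then have "a\<^sup>2 * \<rho>' * (\<rho>' - 2 * \<rho>) * E \<le> 0"
      using \<rho>'_pos \<rho>'_le by (intro mult_nonpos_nonneg mult_nonneg_nonpos) auto
    \<comment> \<open>Substituting c = 1 - a \<rho>' separates the descent term, linear in
      \<open>a\<close>, from the term of order a^2 just shown to be nonpositive.\<close>
    moreover have "(c\<^sup>2 - 1) * E + 2 * a * c * (\<rho> * E) = a\<^sup>2 * \<rho>' * (\<rho>' - 2 * \<rho>) * E - 2 * a * (\<rho>' - \<rho>) * E"
      by (simp add: c_def power2_eq_square algebra_simps)
    ultimately have "(c\<^sup>2 - 1) * E - 2 * a * c * (P - Q) \<le> - 2 * a * (\<rho>' - \<rho>) * E" by linarith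
    then have "\<rho>' / 2 * ((c\<^sup>2 - 1) * E - 2 * a * c * (P - Q) + a\<^sup>2 * (4 * (N * L\<^sup>2)))
        \<le> \<rho>' / 2 * (- 2 * a * (\<rho>' - \<rho>) * E + a\<^sup>2 * (4 * (N * L\<^sup>2)))"
      using \<rho>'_pos by (intro mult_left_mono add_right_mono) auto
    also have "\<dots> = - (a * (\<rho>' - \<rho>) / \<rho>' * (\<rho>'\<^sup>2 * E)) + 2 * N * \<rho>' * a\<^sup>2 * L\<^sup>2"
      using \<rho>'_pos by (simp add: field_simps power2_eq_square)
    finally show ?thesis by simp
  qed
  finally show ?thesis
    unfolding norm_grad_env by (simp add: E_def a_def)
qed

text \<open>Telescoping from 0 to T + 1: the first expectation is deterministic, and the last is at
  least \<open>m\<close> because the envelope never falls below a lower bound of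
  \<open>\<phi>\<close>.\<close>

lemma envelope_sum:
  assumes "\<And>t. t \<le> T \<Longrightarrow> \<alpha> t \<le> 1 / \<rho>'" and m: "\<And>y. ereal m \<le> \<phi> y"
  shows "(\<rho>' - \<rho>) / \<rho>' * (\<Sum>t\<le>T. \<alpha> t * (\<integral>w. (norm (grad env (X t w)))\<^sup>2 \<partial>M))
    \<le> env x0 - m + 2 * N * \<rho>' * L\<^sup>2 * (\<Sum>t\<le>T. (\<alpha> t)\<^sup>2)"
proof -
  define e where "e t = (\<integral>w. env (X t w) \<partial>M)" for t
  have "(\<rho>' - \<rho>) / \<rho>' * (\<Sum>t\<le>T. \<alpha> t * (\<integral>w. (norm (grad env (X t w)))\<^sup>2 \<partial>M))
      = (\<Sum>t\<le>T. \<alpha> t * (\<rho>' - \<rho>) / \<rho>' * (\<integral>w. (norm (grad env (X t w)))\<^sup>2 \<partial>M))"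
    by (simp add: sum_distrib_left mult_ac)
  also have "\<dots> \<le> (\<Sum>t\<le>T. (e t - e (Suc t)) + 2 * N * \<rho>' * L\<^sup>2 * (\<alpha> t)\<^sup>2)"
  proof (rule sum_mono)
    fix t assume "t \<in> {..T}"
    then show "\<alpha> t * (\<rho>' - \<rho>) / \<rho>' * (\<integral>w. (norm (grad env (X t w)))\<^sup>2 \<partial>M)
        \<le> (e t - e (Suc t)) + 2 * N * \<rho>' * L\<^sup>2 * (\<alpha> t)\<^sup>2"
      using envelope_step[OF assms(1), of t] by (simp add: e_def mult_ac)
  qed
  also have "\<dots> = e 0 - e (Suc T) + 2 * N * \<rho>' * L\<^sup>2 * (\<Sum>t\<le>T. (\<alpha> t)\<^sup>2)"
    by (simp add: sum.distrib sum_telescope sum_distrib_left)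
  also have "e 0 = env x0" by (simp add: e_def X_simps prob_space)
  finally have "(\<rho>' - \<rho>) / \<rho>' * (\<Sum>t\<le>T. \<alpha> t * (\<integral>w. (norm (grad env (X t w)))\<^sup>2 \<partial>M))
      \<le> env x0 - e (Suc T) + 2 * N * \<rho>' * L\<^sup>2 * (\<Sum>t\<le>T. (\<alpha> t)\<^sup>2)" .
  moreover have "m \<le> e (Suc T)"
  proof -
    have "m \<le> env y" for y
    proof -
      have "ereal m \<le> (INF y. \<phi> y)" by (intro INF_greatest m)
      also have "\<dots> \<le> ereal (env y)" using prox.INF_le_moreau_env unfolding p_eq .
      finally show ?thesis by simp
    qed
    then have "(\<integral>w. m \<partial>M) \<le> e (Suc T)"
      unfolding e_def by (intro integral_mono integrable_env integrable_const) auto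
    then show ?thesis by (simp add: prob_space)
  qed
  ultimately show ?thesis by linarith
qed

section \<open>The random output index\<close>

context
  fixes T :: nat and \<tau> :: "'w \<Rightarrow> nat"
  assumes \<tau>: "zproxsg_index M S U \<xi>s \<alpha> T \<tau>"
begin

text \<open>The output is split over the events \<tau> = t. As \<tau> is independent of all samples,
  each indicator is independent of the squared gradient at \<open>X t\<close>, and the expectations
  factorise.\<close>

lemma integral_output:
  shows "integrable M (\<lambda>w. (norm (grad env (X (\<tau> w) w)))\<^sup>2)"
    and "(\<integral>w. (norm (grad env (X (\<tau> w) w)))\<^sup>2 \<partial>M)
      = (\<Sum>t\<le>T. \<alpha> t * (\<integral>w. (norm (grad env (X t w)))\<^sup>2 \<partial>M)) / (\<Sum>t\<le>T. \<alpha> t)"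
proof -
  let ?N = "PiM UNIV (\<lambda>_. borel) \<Otimes>\<^sub>M PiM UNIV (\<lambda>_. S)"
  have ind: "indep_rv M (count_space {..T}) \<tau> ?N (\<lambda>w. (\<lambda>i. U i w, \<lambda>i. \<xi>s i w))"
    and pr: "\<And>t. t \<le> T \<Longrightarrow> prob {w \<in> space M. \<tau> w = t} = \<alpha> t / (\<Sum>i\<le>T. \<alpha> i)"
    using \<tau> by (auto simp: zproxsg_index_def)
  note [measurable] = indep_rv_rv(1)[OF ind]
  have \<tau>_le: "\<tau> w \<le> T" if "w \<in> space M" for w using measurable_space[OF indep_rv_rv(1)[OF ind] that] by simp
  define A where "A t = {w \<in> space M. \<tau> w = t}" for t
  have A [measurable]: "A t \<in> sets M" for t
  proof (cases "t \<le> T")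
    case True
    then have "\<tau> -` {t} \<inter> space M \<in> sets M" by (intro measurable_sets[OF indep_rv_rv(1)[OF ind]]) auto
    moreover have "A t = \<tau> -` {t} \<inter> space M" by (auto simp: A_def)
    ultimately show ?thesis by simp
  next
    case False
    then have "A t = {}" using \<tau>_le by (auto simp: A_def)
    then show ?thesis by simp
  qed
  define H where "H t w = (norm (grad env (X t w)))\<^sup>2" for t w
  have int_H: "integrable M (H t)" for t using integrable_grad_env[of t] by (simp add: H_def[abs_def])
  have ind_t: "indep_var borel (\<lambda>w. indicator {t} (\<tau> w) :: real) borel (H t)" for t
  proof -
    \<comment> \<open>The squared gradient at \<open>X t\<close> as a function of both sample
      sequences, the form in which independence of \<tau> is given. Its measurability is read off
      the displacement formula.\<close>
    define k where "k = (\<lambda>s. (norm (grad env (iter t (\<lambda>i. (fst s i, snd s i)))))\<^sup>2)"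
    have "(\<lambda>s. \<rho>'\<^sup>2 * (norm (iter t (\<lambda>i. (fst s i, snd s i)) - Z (iter t (\<lambda>i. (fst s i, snd s i)))))\<^sup>2) \<in> borel_measurable ?N"
    proof -
      have "(\<lambda>s. (\<lambda>i. (fst s i, snd s i))) \<in> ?N \<rightarrow>\<^sub>M PiM UNIV (\<lambda>_. borel \<Otimes>\<^sub>M S)"
        by (intro measurable_abs_UNIV) measurable
      from measurable_compose[OF this iter_measurable[of t UNIV]] have [measurable]:
        "(\<lambda>s. iter t (\<lambda>i. (fst s i, snd s i))) \<in> borel_measurable ?N" by simp
      show ?thesis by measurable
    qed
    then have k: "k \<in> borel_measurable ?N"
      using prox.grad_moreau_env \<rho>'_pos by (simp add: k_def p_eq Z_def power_mult_distrib)
    have "indep_rv M borel (\<lambda>w. indicator {t} (\<tau> w) :: real) borel (\<lambda>w. k (\<lambda>i. U i w, \<lambda>i. \<xi>s i w))"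
      by (rule indep_rv_compose[OF ind _ k]) simp
    then show ?thesis
      unfolding indep_rv_iff_indep_var[symmetric] by (simp add: k_def H_def[abs_def] X_iter)
  qed
  have ind_eq: "indicator {t} (\<tau> w) = (indicator (A t) w :: real)" if "w \<in> space M" for t w
    using that by (simp add: A_def indicator_def)
  have int_ind: "integrable M (\<lambda>w. indicator {t} (\<tau> w) :: real)" for t
  proof -
    have "integrable M (indicator (A t) :: _ \<Rightarrow> real)" by (simp add: integrable_indicator_iff less_top[symmetric])
    then show ?thesis by (subst Bochner_Integration.integrable_cong[OF refl ind_eq]) auto
  qed
  have decomp: "H (\<tau> w) w = (\<Sum>t\<le>T. indicator {t} (\<tau> w) * H t w)" if "w \<in> space M" for w
    using \<tau>_le[OF that] by (subst sum.remove[of _ "\<tau> w"]) (auto simp: indicator_def intro!: sum.neutral)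
  have int_t: "integrable M (\<lambda>w. indicator {t} (\<tau> w) * H t w)" for t
    by (rule indep_var_integrable[OF ind_t int_ind int_H])
  have val_t: "(\<integral>w. indicator {t} (\<tau> w) * H t w \<partial>M) = \<alpha> t / (\<Sum>i\<le>T. \<alpha> i) * integral\<^sup>L M (H t)" if "t \<le> T" for t
  proof -
    have "(\<integral>w. indicator {t} (\<tau> w) \<partial>M) = (\<integral>w. (indicator (A t) w :: real) \<partial>M)"
      by (intro Bochner_Integration.integral_cong refl ind_eq)
    also have "\<dots> = \<alpha> t / (\<Sum>i\<le>T. \<alpha> i)" using pr[OF that] by (simp add: A_def)
    finally show ?thesis using indep_var_lebesgue_integral[OF ind_t int_ind int_H, of t] by simp
  qed
  have "integrable M (\<lambda>w. H (\<tau> w) w)"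
    by (rule Bochner_Integration.integrable_cong[THEN iffD2, OF refl decomp Bochner_Integration.integrable_sum[OF int_t]])
  then show "integrable M (\<lambda>w. (norm (grad env (X (\<tau> w) w)))\<^sup>2)" by (simp add: H_def)
  have "(\<integral>w. H (\<tau> w) w \<partial>M) = (\<integral>w. (\<Sum>t\<le>T. indicator {t} (\<tau> w) * H t w) \<partial>M)"
    by (intro Bochner_Integration.integral_cong refl decomp)
  also have "\<dots> = (\<Sum>t\<le>T. \<alpha> t / (\<Sum>i\<le>T. \<alpha> i) * integral\<^sup>L M (H t))"
    unfolding Bochner_Integration.integral_sum[OF int_t] by (intro sum.cong refl val_t) simp
  finally show "(\<integral>w. (norm (grad env (X (\<tau> w) w)))\<^sup>2 \<partial>M)
      = (\<Sum>t\<le>T. \<alpha> t * (\<integral>w. (norm (grad env (X t w)))\<^sup>2 \<partial>M)) / (\<Sum>t\<le>T. \<alpha> t)"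
    by (simp add: H_def[abs_def] sum_divide_distrib)
qed

lemma output_bound:
  assumes "\<And>t. t \<le> T \<Longrightarrow> \<alpha> t \<le> 1 / \<rho>'" and m: "\<And>y. ereal m \<le> \<phi> y"
  shows "(\<integral>w. (norm (grad env (X (\<tau> w) w)))\<^sup>2 \<partial>M)
    \<le> \<rho>' / (\<rho>' - \<rho>) * ((env x0 - m + 2 * N * \<rho>' * L\<^sup>2 * (\<Sum>t\<le>T. (\<alpha> t)\<^sup>2)) / (\<Sum>t\<le>T. \<alpha> t))"
proof -
  define Y where "Y = (\<Sum>t\<le>T. \<alpha> t * (\<integral>w. (norm (grad env (X t w)))\<^sup>2 \<partial>M))"
  define R where "R = env x0 - m + 2 * N * \<rho>' * L\<^sup>2 * (\<Sum>t\<le>T. (\<alpha> t)\<^sup>2)"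
  have s: "0 < (\<Sum>t\<le>T. \<alpha> t)" by (intro sum_pos) (auto simp: \<alpha>_pos)
  have "(\<rho>' - \<rho>) / \<rho>' * Y \<le> R" unfolding Y_def R_def by (rule envelope_sum[OF assms])
  then have "Y \<le> \<rho>' / (\<rho>' - \<rho>) * R" using \<rho>'_pos \<rho>'_gt by (simp add: field_simps)
  then have "Y / (\<Sum>t\<le>T. \<alpha> t) \<le> \<rho>' / (\<rho>' - \<rho>) * R / (\<Sum>t\<le>T. \<alpha> t)" using s by (intro divide_right_mono) auto
  then show ?thesis unfolding integral_output(2) Y_def[symmetric] R_def[symmetric] by simp
qed

text \<open>If the infimum is minus infinity, the right-hand side is infinite; otherwise it is a
  real lower bound and the real estimate applies.\<close>

lemma output_bound_ereal:
  assumes "\<And>t. t \<le> T \<Longrightarrow> \<alpha> t \<le> 1 / \<rho>'"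
  shows "ereal (\<integral>w. (norm (grad env (X (\<tau> w) w)))\<^sup>2 \<partial>M)
    \<le> ereal (\<rho>' / (\<rho>' - \<rho>)) * ((ereal (env x0) - (INF y. \<phi> y)
        + ereal (2 * N * \<rho>' * L\<^sup>2 * (\<Sum>t\<le>T. (\<alpha> t)\<^sup>2))) / ereal (\<Sum>t\<le>T. \<alpha> t))"
proof -
  have s: "0 < (\<Sum>t\<le>T. \<alpha> t)" by (intro sum_pos) (auto simp: \<alpha>_pos)
  have "(INF y. \<phi> y) \<noteq> \<infinity>"
    using prox.INF_le_moreau_env[of x0] by (auto simp: p_eq)
  then consider m where "(INF y. \<phi> y) = ereal m" | "(INF y. \<phi> y) = -\<infinity>" by (cases "INF y. \<phi> y") auto
  then show ?thesis
  proof cases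
    case 1
    then have "ereal m \<le> \<phi> y" for y by (metis INF_lower UNIV_I)
    from output_bound[OF assms this] s show ?thesis by (simp add: 1)
  next
    case 2
    then show ?thesis using s \<rho>'_gt \<rho>'_pos by simp
  qed
qed

end

end

text \<open>With \<open>q = N \<rho> L\<^sup>2\<close> and the square root \<open>s\<close> in the step size one has \<open>\<Delta> = s\<^sup>2 q T1\<close>, so the bound becomes
  \<open>2 s\<^sup>2 q / a + 8 q a\<close> with \<open>a = min (1 / \<rho>) s / 2\<close>.\<close>

lemma step_size_bound:
  fixes \<rho> L N T1 \<Delta> a :: real
  assumes pos: "0 < \<rho>" "0 < L" "0 < N" "0 < T1" "0 < a"
    and a: "a = 1 / 2 * min (1 / \<rho>) (sqrt (\<Delta> / (N * \<rho> * L\<^sup>2 * T1)))"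
  shows "2 * ((\<Delta> + 4 * N * \<rho> * L\<^sup>2 * (T1 * a\<^sup>2)) / (T1 * a)) \<le> 8 * max (\<Delta> * \<rho> / T1) (L * sqrt (\<Delta> * \<rho> * N / T1))"
proof -
  define s where "s = sqrt (\<Delta> / (N * \<rho> * L\<^sup>2 * T1))"
  define q where "q = N * \<rho> * L\<^sup>2"
  have q: "0 < q" using pos by (simp add: q_def)
  \<comment> \<open>A positive step forces s > 0, and then \<Delta> > 0, since the real square root
    is positive only at positive arguments.\<close>
  have "2 * a \<le> s" using a by (simp add: s_def)
  then have s: "0 < s" using pos by linarith
  then have "0 < \<Delta> / (q * T1)" by (simp add: s_def q_def)
  then have "s\<^sup>2 = \<Delta> / (q * T1)" by (simp add: s_def q_def)
  then have \<Delta>: "\<Delta> = s\<^sup>2 * q * T1" using q pos by (simp add: field_simps)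
  have "\<Delta> * \<rho> * N / T1 = (s * N * \<rho> * L)\<^sup>2"
    using pos by (simp add: \<Delta> q_def power2_eq_square)
  then have "sqrt (\<Delta> * \<rho> * N / T1) = s * N * \<rho> * L" using pos s by simp
  then have m2: "L * sqrt (\<Delta> * \<rho> * N / T1) = q * s" by (simp add: q_def power2_eq_square)
  have m1: "\<Delta> * \<rho> / T1 = s\<^sup>2 * q * \<rho>" using pos by (simp add: \<Delta>)
  have "2 * ((\<Delta> + 4 * N * \<rho> * L\<^sup>2 * (T1 * a\<^sup>2)) / (T1 * a)) = 2 * ((s\<^sup>2 * q * T1 + 4 * q * (T1 * a\<^sup>2)) / (T1 * a))"
    by (simp add: \<Delta> q_def mult.assoc)
  also have "\<dots> = 2 * s\<^sup>2 * q / a + 8 * q * a"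
    using pos by (simp add: field_simps power2_eq_square)
  also have "\<dots> \<le> 8 * max (s\<^sup>2 * q * \<rho>) (q * s)"
  \<comment> \<open>If 1/\<rho> is the smaller, the two terms are 4 s^2 q \<rho> and 4 q / \<rho>
    \<le> 4 q s; otherwise each equals 4 q s.\<close>
  proof (cases "1 / \<rho> \<le> s")
    case True
    then have a: "a = 1 / (2 * \<rho>)" using a by (simp add: s_def[symmetric])
    have "q * (1 / \<rho>) \<le> q * s" using True q by (intro mult_left_mono) auto
    then have "2 * s\<^sup>2 * q / a + 8 * q * a \<le> 4 * (s\<^sup>2 * q * \<rho>) + 4 * (q * s)"
      using pos by (simp add: a)
    then show ?thesis by linarith
  next
    case False
    then have a: "a = s / 2" using a by (simp add: s_def[symmetric])
    have "2 * s\<^sup>2 * q / a + 8 * q * a = 8 * (q * s)"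
      using s by (simp add: a power2_eq_square)
    then show ?thesis by linarith
  qed
  finally show ?thesis unfolding m1 m2 .
qed

section \<open>Constant step size\<close>

lemma (in zproxsg_envelope) output_bound_constant_step:
  assumes \<tau>: "zproxsg_index M S U \<xi>s \<alpha> T \<tau>" and \<rho>'_eq: "\<rho>' = 2 * \<rho>"
    and \<Delta>: "ereal (env x0) - (INF y. \<phi> y) \<le> ereal \<Delta>"
    and \<alpha>: "\<And>t. t \<le> T \<Longrightarrow> \<alpha> t = 1 / 2 * min (1 / \<rho>) (sqrt (\<Delta> / (N * \<rho> * L\<^sup>2 * (real T + 1))))"
  shows "(\<integral>w. (norm (grad env (X (\<tau> w) w)))\<^sup>2 \<partial>M)
    \<le> 8 * max (\<Delta> * \<rho> / (real T + 1)) (L * sqrt (\<Delta> * \<rho> * N / (real T + 1)))"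
proof -
  define a where "a = \<alpha> 0"
  have a: "\<alpha> t = a" if "t \<le> T" for t using \<alpha>[OF that] \<alpha>[of 0] by (simp add: a_def)
  have a_pos: "0 < a" using \<alpha>_pos by (simp add: a_def)
  have N_pos: "0 < N" by (simp add: n_eq add_pos_pos)
  \<comment> \<open>Half of 1/\<rho> is 1/\<rho>', so the factor 1/2 in the step size meets the step
    bound.\<close>
  have le: "\<alpha> t \<le> 1 / \<rho>'" if "t \<le> T" for t
    using \<rho>_pos unfolding \<alpha>[OF that] \<rho>'_eq by simp
  \<comment> \<open>A finite \<Delta> excludes minus infinity as the infimum, and a finite envelope
    value excludes plus infinity.\<close>
  obtain m where m: "(INF y. \<phi> y) = ereal m"
    using prox.INF_le_moreau_env[of x0] \<Delta> by (cases "INF y. \<phi> y") (auto simp: p_eq)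
  then have lower: "ereal m \<le> \<phi> y" for y by (metis INF_lower UNIV_I)
  have "(\<integral>w. (norm (grad env (X (\<tau> w) w)))\<^sup>2 \<partial>M)
      \<le> \<rho>' / (\<rho>' - \<rho>) * ((env x0 - m + 2 * N * \<rho>' * L\<^sup>2 * (\<Sum>t\<le>T. (\<alpha> t)\<^sup>2)) / (\<Sum>t\<le>T. \<alpha> t))"
    by (rule output_bound[OF \<tau> le lower])
  also have "\<dots> = 2 * ((env x0 - m + 4 * N * \<rho> * L\<^sup>2 * ((real T + 1) * a\<^sup>2)) / ((real T + 1) * a))"
  proof -
    have "(\<Sum>t\<le>T. \<alpha> t) = (real T + 1) * a" "(\<Sum>t\<le>T. (\<alpha> t)\<^sup>2) = (real T + 1) * a\<^sup>2" by (simp_all add: a)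
    moreover have "\<rho>' / (\<rho>' - \<rho>) = 2" using \<rho>_pos by (simp add: \<rho>'_eq)
    ultimately show ?thesis by (simp add: \<rho>'_eq mult_ac)
  qed
  also have "\<dots> \<le> 2 * ((\<Delta> + 4 * N * \<rho> * L\<^sup>2 * ((real T + 1) * a\<^sup>2)) / ((real T + 1) * a))"
    using \<Delta> a_pos by (intro mult_left_mono divide_right_mono add_right_mono) (auto simp: m)
  also have "\<dots> \<le> 8 * max (\<Delta> * \<rho> / (real T + 1)) (L * sqrt (\<Delta> * \<rho> * N / (real T + 1)))"
    by (rule step_size_bound[OF \<rho>_pos L_pos N_pos _ a_pos]) (use \<alpha>[of 0] in \<open>simp_all add: a_def\<close>)
  finally show ?thesis .
qed

section \<open>From a pointwise to an almost sure Lipschitz bound\<close>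

lemma zproxsg_cong:
  assumes "\<And>i y. F y (z i) = F' y (z i)"
  shows "zproxsg F r \<mu> \<alpha> x0 u z t = zproxsg F' r \<mu> \<alpha> x0 u z t"
  using assms by (induction t) (simp_all add: grad_est_def Let_def)

text \<open>The infimum of \<open>\<phi>\<close> is subtracted in the extended reals, as
  \<open>\<phi>\<close> may be unbounded below. Integrability is claimed with the bounds because the
  integral of a nonintegrable function is 0 by convention, which would make them void.\<close>

theorem theorem3p3:
  fixes M :: "'w measure" and Xi :: "(real ^ 'd) set" and \<xi> :: "'w \<Rightarrow> real ^ 'd"
    and F :: "real ^ 'n \<Rightarrow> real ^ 'd \<Rightarrow> real" and C :: "real ^ 'd \<Rightarrow> real"
    and r :: "real ^ 'n \<Rightarrow> ereal" and \<rho> \<mu> :: real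
    and U :: "nat \<Rightarrow> 'w \<Rightarrow> real ^ 'n" and \<xi>s :: "nat \<Rightarrow> 'w \<Rightarrow> real ^ 'd"
    and x0 :: "real ^ 'n" and \<alpha> :: "nat \<Rightarrow> real" and T :: nat and \<tau> :: "'w \<Rightarrow> nat"
  defines "S \<equiv> restrict_space borel Xi"
    and "n \<equiv> real CARD('n)"
    and "L \<equiv> lip_const M \<xi> C"
    and "\<phi> \<equiv> smoothed_objective M \<xi> F r \<mu>"
    and "x \<equiv> (\<lambda>t w. zproxsg F r \<mu> \<alpha> x0 (\<lambda>i. U i w) (\<lambda>i. \<xi>s i w) t)"
  assumes "prob_space M" and "complete_measure M"
    and "\<xi> \<in> M \<rightarrow>\<^sub>M S"
    and "\<forall>y. F y \<in> borel_measurable S \<and> integrable M (\<lambda>w. (F y (\<xi> w))\<^sup>2)"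
    and "0 \<le> \<rho>" and "weakly_convex \<rho> (objective M \<xi> F)"
    and "C \<in> borel_measurable S" and "\<forall>z\<in>Xi. 0 < C z"
    and "integrable M (\<lambda>w. (C (\<xi> w))\<^sup>2)"
    and "AE z in distr M S \<xi>. \<forall>x1 x2. \<bar>F x1 z - F x2 z\<bar> \<le> C z * norm (x1 - x2)"
    and "proper_fun r" and "closed_fun r" and "convex_fun r"
    and "zproxsg_samples M S \<xi> U \<xi>s"
    and "0 < \<mu>" and "x0 \<in> dom_ext r" and "\<forall>t. 0 < \<alpha> t" and "0 < T"
    and "zproxsg_index M S U \<xi>s \<alpha> T \<tau>"
  shows
    "(\<forall>t. \<forall>\<rho>'\<in>{\<rho><..2*\<rho>}. \<alpha> t \<le> 1 / \<rho>' \<longrightarrow>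
        integrable M (\<lambda>w. moreau_env (1 / \<rho>') \<phi> (x t w)) \<and>
        integrable M (\<lambda>w. moreau_env (1 / \<rho>') \<phi> (x (Suc t) w)) \<and>
        integrable M (\<lambda>w. (norm (grad (moreau_env (1 / \<rho>') \<phi>) (x t w)))\<^sup>2) \<and>
        (\<integral>w. moreau_env (1 / \<rho>') \<phi> (x (Suc t) w) \<partial>M)
          \<le> (\<integral>w. moreau_env (1 / \<rho>') \<phi> (x t w) \<partial>M)
            - \<alpha> t * (\<rho>' - \<rho>) / \<rho>'
                * (\<integral>w. (norm (grad (moreau_env (1 / \<rho>') \<phi>) (x t w)))\<^sup>2 \<partial>M)
            + 2 * (n\<^sup>2 + 2 * n) * \<rho>' * (\<alpha> t)\<^sup>2 * L\<^sup>2) \<and>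
     (\<forall>\<rho>'\<in>{\<rho><..2*\<rho>}. (\<forall>t\<le>T. \<alpha> t \<le> 1 / \<rho>') \<longrightarrow>
        integrable M (\<lambda>w. (norm (grad (moreau_env (1 / \<rho>') \<phi>) (x (\<tau> w) w)))\<^sup>2) \<and>
        ereal (\<integral>w. (norm (grad (moreau_env (1 / \<rho>') \<phi>) (x (\<tau> w) w)))\<^sup>2 \<partial>M)
          \<le> ereal (\<rho>' / (\<rho>' - \<rho>))
            * ((ereal (moreau_env (1 / \<rho>') \<phi> x0) - (INF y. \<phi> y)
                + ereal (2 * (n\<^sup>2 + 2 * n) * \<rho>' * L\<^sup>2 * (\<Sum>t\<le>T. (\<alpha> t)\<^sup>2)))
               / ereal (\<Sum>t\<le>T. \<alpha> t))) \<and>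
     (\<forall>\<Delta>::real. 0 < \<rho> \<longrightarrow>
        ereal (moreau_env (1 / (2 * \<rho>)) \<phi> x0) - (INF y. \<phi> y) \<le> ereal \<Delta> \<longrightarrow>
        (\<forall>t\<le>T. \<alpha> t = 1 / 2 * min (1 / \<rho>) (sqrt (\<Delta> / ((n\<^sup>2 + 2 * n) * \<rho> * L\<^sup>2 * (real T + 1))))) \<longrightarrow>
        integrable M (\<lambda>w. (norm (grad (moreau_env (1 / (2 * \<rho>)) \<phi>) (x (\<tau> w) w)))\<^sup>2) \<and>
        (\<integral>w. (norm (grad (moreau_env (1 / (2 * \<rho>)) \<phi>) (x (\<tau> w) w)))\<^sup>2 \<partial>M)
          \<le> 8 * max (\<Delta> * \<rho> / (real T + 1)) (L * sqrt (\<Delta> * \<rho> * n * (n + 2) / (real T + 1))))"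
\<comment> \<open>For \<rho> = 0 the interval of admissible \<rho>' is empty, and the last claim
  presupposes \<rho> > 0.\<close>
proof (cases "0 < \<rho>")
  case False
  then show ?thesis using \<open>0 \<le> \<rho>\<close> by auto
next
  case \<rho>_pos: True
  interpret prob_space M by fact
  interpret complete_measure M by fact
  have space_S: "space S = Xi" by (simp add: S_def space_restrict_space)
  note \<xi> [measurable] = \<open>\<xi> \<in> M \<rightarrow>\<^sub>M S\<close>
  have F [measurable]: "F y \<in> borel_measurable S" and F2: "integrable M (\<lambda>w. (F y (\<xi> w))\<^sup>2)" for y
    using \<open>\<forall>y. F y \<in> borel_measurable S \<and> _ y\<close> by auto
  obtain B where B: "B \<in> null_sets (distr M S \<xi>)"
      "{z \<in> space S. \<not> (\<forall>x1 x2. \<bar>F x1 z - F x2 z\<bar> \<le> C z * norm (x1 - x2))} \<subseteq> B"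
    using \<open>AE z in distr M S \<xi>. _ z\<close> by (auto simp: eventually_ae_filter)
  have [measurable]: "B \<in> sets S" using null_setsD2[OF B(1)] by simp
  \<comment> \<open>\<open>F\<close> is jointly measurable only after it has been changed on the null set \<open>B\<close>.\<close>
  define F' where "F' y z = (if z \<in> B then 0 else F y z)" for y z
  have F'_m [measurable]: "F' y \<in> borel_measurable S" for y unfolding F'_def by measurable
  have "AE w in M. \<xi> w \<notin> B" using AE_distrD[OF \<xi> AE_not_in[OF B(1)]] .
  then have F'_AE: "AE w in M. F' y (\<xi> w) = F y (\<xi> w)" for y
    by eventually_elim (simp add: F'_def)
  have obj: "objective M \<xi> F' = objective M \<xi> F"
    unfolding objective_def by (intro ext integral_cong_AE F'_AE) auto
  have \<phi>_eq: "smoothed_objective M \<xi> F' r \<mu> = \<phi>"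
    by (simp add: \<phi>_def smoothed_objective_def[abs_def] obj)
  have env_locale: "zproxsg_envelope M S \<xi> F' C r \<rho> \<mu> U \<xi>s \<alpha> n \<rho>'" if "\<rho>' \<in> {\<rho><..2*\<rho>}" for \<rho>'
  proof unfold_locales
    show "integrable M (\<lambda>w. (F' y (\<xi> w))\<^sup>2)" for y
      by (rule Bochner_Integration.integrable_bound[OF F2[of y]]) (auto simp: F'_def)
    \<comment> \<open>On \<open>B\<close> the modified function is 0 and the bound holds as
      \<open>C\<close> is positive; off \<open>B\<close> the original bound holds.\<close>
    show "\<bar>F' x z - F' y z\<bar> \<le> C z * norm (x - y)" if "z \<in> space S" for x y z
      using B(2) that \<open>\<forall>z\<in>Xi. 0 < C z\<close> space_S by (auto simp: F'_def less_imp_le)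
  next
    show "F' y \<in> borel_measurable S" for y by (rule F'_m)
  qed (use assms that \<rho>_pos obj space_S in auto)
  define X where "X t w = zproxsg F' r \<mu> \<alpha> x0 (\<lambda>i. U i w) (\<lambda>i. \<xi>s i w) t" for t w
  \<comment> \<open>Every sample has the law of \<open>\<xi>\<close> and so avoids \<open>B\<close>
    almost surely; countably many do so simultaneously, and then both runs coincide for all
    t.\<close>
  have X_eq: "AE w in M. \<forall>t. X t w = x t w"
  proof -
    have "AE w in M. \<xi>s i w \<notin> B" for i
    proof -
      have m: "\<xi>s i \<in> M \<rightarrow>\<^sub>M S" and d: "distr M S (\<xi>s i) = distr M S \<xi>"
        using \<open>zproxsg_samples M S \<xi> U \<xi>s\<close> by (auto simp: zproxsg_samples_def indep_vars_def)
      have "AE z in distr M S (\<xi>s i). z \<notin> B" unfolding d by (rule AE_not_in[OF B(1)])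
      then show ?thesis by (rule AE_distrD[OF m])
    qed
    then have "AE w in M. \<forall>i. \<xi>s i w \<notin> B" by (simp add: AE_all_countable)
    then show ?thesis
    proof eventually_elim
      case (elim w)
      then show ?case unfolding X_def x_def by (auto intro!: zproxsg_cong simp: F'_def)
    qed
  qed
  have X_eq1: "AE w in M. k (X t w) = k (x t w)" for k :: "real^'n \<Rightarrow> real" and t
    using X_eq by eventually_elim simp
  have X_eq2: "AE w in M. k (X (\<tau> w) w) = k (x (\<tau> w) w)" for k :: "real^'n \<Rightarrow> real"
    using X_eq by eventually_elim simp
  \<comment> \<open>Integrability and value pass from \<open>X\<close> to \<open>x\<close> for any
    function of the iterate; completeness supplies the measurability.\<close>
  note tr1 = integrable_AE_eq[OF _ X_eq1] and tr2 = integrable_AE_eq[OF _ X_eq2]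
  show ?thesis
  proof (intro conjI allI ballI impI)
    fix t \<rho>' assume \<rho>': "\<rho>' \<in> {\<rho><..2*\<rho>}" and \<alpha>: "\<alpha> t \<le> 1 / \<rho>'"
    interpret E: zproxsg_envelope M S \<xi> F' C r \<rho> \<mu> U \<xi>s x0 \<alpha> n \<rho>' by (rule env_locale[OF \<rho>'])
    have X: "E.X = X" by (simp add: fun_eq_iff X_def E.X_def)
    note env = E.integrable_env[unfolded \<phi>_eq X] and gr = E.integrable_grad_env[unfolded \<phi>_eq X]
    show "integrable M (\<lambda>w. moreau_env (1 / \<rho>') \<phi> (x t w))"
      "integrable M (\<lambda>w. moreau_env (1 / \<rho>') \<phi> (x (Suc t) w))"
      "integrable M (\<lambda>w. (norm (grad (moreau_env (1 / \<rho>') \<phi>) (x t w)))\<^sup>2)"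
      using tr1(1)[OF env] tr1(1)[OF gr] by blast+
    show "(\<integral>w. moreau_env (1 / \<rho>') \<phi> (x (Suc t) w) \<partial>M)
          \<le> (\<integral>w. moreau_env (1 / \<rho>') \<phi> (x t w) \<partial>M)
            - \<alpha> t * (\<rho>' - \<rho>) / \<rho>'
                * (\<integral>w. (norm (grad (moreau_env (1 / \<rho>') \<phi>) (x t w)))\<^sup>2 \<partial>M)
            + 2 * (n\<^sup>2 + 2 * n) * \<rho>' * (\<alpha> t)\<^sup>2 * L\<^sup>2"
      using E.envelope_step[OF \<alpha>, unfolded \<phi>_eq X] unfolding tr1(2)[OF env] tr1(2)[OF gr] L_def .
  next
    fix \<rho>' assume \<rho>': "\<rho>' \<in> {\<rho><..2*\<rho>}" and \<alpha>: "\<forall>t\<le>T. \<alpha> t \<le> 1 / \<rho>'"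
    interpret E: zproxsg_envelope M S \<xi> F' C r \<rho> \<mu> U \<xi>s x0 \<alpha> n \<rho>' by (rule env_locale[OF \<rho>'])
    have X: "E.X = X" by (simp add: fun_eq_iff X_def E.X_def)
    note gr = E.integral_output(1)[OF \<open>zproxsg_index M S U \<xi>s \<alpha> T \<tau>\<close>, unfolded \<phi>_eq X]
    show "integrable M (\<lambda>w. (norm (grad (moreau_env (1 / \<rho>') \<phi>) (x (\<tau> w) w)))\<^sup>2)"
      by (rule tr2(1)[OF gr])
    show "ereal (\<integral>w. (norm (grad (moreau_env (1 / \<rho>') \<phi>) (x (\<tau> w) w)))\<^sup>2 \<partial>M)
          \<le> ereal (\<rho>' / (\<rho>' - \<rho>))
            * ((ereal (moreau_env (1 / \<rho>') \<phi> x0) - (INF y. \<phi> y)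
                + ereal (2 * (n\<^sup>2 + 2 * n) * \<rho>' * L\<^sup>2 * (\<Sum>t\<le>T. (\<alpha> t)\<^sup>2)))
               / ereal (\<Sum>t\<le>T. \<alpha> t))"
      using E.output_bound_ereal[OF \<open>zproxsg_index M S U \<xi>s \<alpha> T \<tau>\<close> \<alpha>[rule_format], unfolded \<phi>_eq X]
      unfolding tr2(2)[OF gr] L_def .
  next
    fix \<Delta> :: real
    assume \<Delta>: "ereal (moreau_env (1 / (2 * \<rho>)) \<phi> x0) - (INF y. \<phi> y) \<le> ereal \<Delta>"
      and \<alpha>: "\<forall>t\<le>T. \<alpha> t = 1 / 2 * min (1 / \<rho>) (sqrt (\<Delta> / ((n\<^sup>2 + 2 * n) * \<rho> * L\<^sup>2 * (real T + 1))))"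
    have \<rho>': "2 * \<rho> \<in> {\<rho><..2*\<rho>}" using \<rho>_pos by simp
    interpret E: zproxsg_envelope M S \<xi> F' C r \<rho> \<mu> U \<xi>s x0 \<alpha> n "2 * \<rho>" by (rule env_locale[OF \<rho>'])
    have X: "E.X = X" by (simp add: fun_eq_iff X_def E.X_def)
    note gr = E.integral_output(1)[OF \<open>zproxsg_index M S U \<xi>s \<alpha> T \<tau>\<close>, unfolded \<phi>_eq X]
    show "integrable M (\<lambda>w. (norm (grad (moreau_env (1 / (2 * \<rho>)) \<phi>) (x (\<tau> w) w)))\<^sup>2)"
      by (rule tr2(1)[OF gr])
    have N: "\<Delta> * \<rho> * n * (n + 2) = \<Delta> * \<rho> * (n\<^sup>2 + 2 * n)" by (simp add: power2_eq_square algebra_simps)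
    show "(\<integral>w. (norm (grad (moreau_env (1 / (2 * \<rho>)) \<phi>) (x (\<tau> w) w)))\<^sup>2 \<partial>M)
          \<le> 8 * max (\<Delta> * \<rho> / (real T + 1)) (L * sqrt (\<Delta> * \<rho> * n * (n + 2) / (real T + 1)))"
      using E.output_bound_constant_step[OF \<open>zproxsg_index M S U \<xi>s \<alpha> T \<tau>\<close> refl, unfolded \<phi>_eq X, OF \<Delta> \<alpha>[rule_format, unfolded L_def]]
      unfolding tr2(2)[OF gr] L_def N .
  qed
qed

end
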